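(* Let $L$ be a finite-dimensional non-Lie supersolvable Leibniz algebra over a field $F$ of characteristic zero, and let $L^*$ be a finite-dimensional Leibniz algebra over $F$ for which there is a lattice isomorphism from $L$ to $L^*$. Then $L^*$ is supersolvable.
   Context: A (right) Leibniz algebra over a field $F$ is an $F$-vector space $L$ with a bilinear product satisfying $[x,[y,z]]=[[x,y],z]-[[x,z],y]$ for all $x,y,z\in L$. It is a Lie algebra if and only if $[x,x]=0$ for all $x\in L$; it is called non-Lie otherwise. The set $\mathcal{L}(L)$ of all subalgebras of $L$ is a lattice, where $A\cap B$ is the usual intersection and $A\cup B$ denotes the subalgebra generated by the set-theoretic union of $A$ and $B$. A lattice isomorphism from $L$ to $L^*$ is a bijective map $\theta:\mathcal{L}(L)\to\mathcal{L}(L^* )$ such that $\theta(A\cup B)=\theta(A)\cup\theta(B)$ and $\theta(A\cap B)=\theta(A)\cap\theta(B)$ for all $A,B\in\mathcal{L}(L)$. $L$ is supersolvable if it has a chain $0=L_0\subset L_1\subset\cdots\subset L_n=L$ of (two-sided) ideals of $L$ with $\dim L_i=i$ for each $i$. *)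

theory Defs
  imports Complex_Main
begin

locale bilinear_algebra = vector_space scale
  for scale :: "'f::field \<Rightarrow> 'v::ab_group_add \<Rightarrow> 'v" (infixr \<open>*s\<close> 75) +
  fixes bracket :: "'v \<Rightarrow> 'v \<Rightarrow> 'v" (infixl \<open>\<odot>\<close> 70)
  assumes linear_left: "Vector_Spaces.linear scale scale (\<lambda>x. x \<odot> y)"
    and linear_right: "Vector_Spaces.linear scale scale (\<lambda>y. x \<odot> y)"
begin

definition subalgebra :: "'v set \<Rightarrow> bool" where
  "subalgebra A \<longleftrightarrow> subspace A \<and> (\<forall>x\<in>A. \<forall>y\<in>A. x \<odot> y \<in> A)"

definition subalgebras :: "'v set set" where
  "subalgebras = {A. subalgebra A}"

definition generated :: "'v set \<Rightarrow> 'v set" where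
  "generated S = \<Inter>{A. subalgebra A \<and> S \<subseteq> A}"

definition ideal :: "'v set \<Rightarrow> bool" where
  "ideal I \<longleftrightarrow> subspace I \<and> (\<forall>i\<in>I. \<forall>x. x \<odot> i \<in> I \<and> i \<odot> x \<in> I)"

definition supersolvable :: bool where
  "supersolvable \<longleftrightarrow>
     (\<exists>n (I :: nat \<Rightarrow> 'v set).
        I 0 = {0} \<and> I n = UNIV \<and>
        (\<forall>i<n. I i \<subset> I (Suc i)) \<and>
        (\<forall>i\<le>n. ideal (I i) \<and> dim (I i) = i))"

end

locale leibniz_algebra = bilinear_algebra +
  assumes leibniz: "x \<odot> (y \<odot> z) = (x \<odot> y) \<odot> z - (x \<odot> z) \<odot> y"

locale lie_algebra = bilinear_algebra +
  assumes alternating: "x \<odot> x = 0"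
    and jacobi: "x \<odot> (y \<odot> z) + y \<odot> (z \<odot> x) + z \<odot> (x \<odot> y) = 0"

lemma (in leibniz_algebra) lie_algebra_iff:
  "lie_algebra scale bracket \<longleftrightarrow> (\<forall>x. x \<odot> x = 0)"
proof
  assume "lie_algebra scale bracket"
  then show "\<forall>x. x \<odot> x = 0"
    by (simp add: lie_algebra.alternating)
next
  assume alt: "\<forall>x. x \<odot> x = 0"
  have add_left: "(x + y) \<odot> z = x \<odot> z + y \<odot> z" for x y z
    using linear_left[of z, folded module_hom_iff_linear] by (rule module_hom.add)
  have add_right: "z \<odot> (x + y) = z \<odot> x + z \<odot> y" for x y z
    using linear_right[of z, folded module_hom_iff_linear] by (rule module_hom.add)
  have neg_right: "z \<odot> (- x) = - (z \<odot> x)" for x z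
    using linear_right[of z, folded module_hom_iff_linear] by (rule module_hom.neg)
  have anti: "x \<odot> y = - (y \<odot> x)" for x y
  proof -
    have "(x + y) \<odot> (x + y) = 0" using alt by blast
    then have "x \<odot> y + y \<odot> x = 0"
      unfolding add_left add_right using alt by (simp add: add.commute)
    then show ?thesis by (simp add: eq_neg_iff_add_eq_0)
  qed
  show "lie_algebra scale bracket"
  proof
    show "x \<odot> x = 0" for x using alt by blast
    show "x \<odot> (y \<odot> z) + y \<odot> (z \<odot> x) + z \<odot> (x \<odot> y) = 0" for x y z
    proof -
      have 1: "y \<odot> (z \<odot> x) = (x \<odot> z) \<odot> y"
        by (metis anti neg_right minus_minus)
      have 2: "z \<odot> (x \<odot> y) = - ((x \<odot> y) \<odot> z)" by (rule anti)
      show ?thesis unfolding 1 2 leibniz[of x y z] by simp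
    qed
  qed
qed

definition lattice_isomorphism ::
  "('f::field \<Rightarrow> 'v::ab_group_add \<Rightarrow> 'v) \<Rightarrow> ('v \<Rightarrow> 'v \<Rightarrow> 'v) \<Rightarrow>
   ('f \<Rightarrow> 'w::ab_group_add \<Rightarrow> 'w) \<Rightarrow> ('w \<Rightarrow> 'w \<Rightarrow> 'w) \<Rightarrow> ('v set \<Rightarrow> 'w set) \<Rightarrow> bool" where
  "lattice_isomorphism scale bracket scale' bracket' \<theta> \<longleftrightarrow>
     bij_betw \<theta> (bilinear_algebra.subalgebras scale bracket)
                (bilinear_algebra.subalgebras scale' bracket') \<and>
     (\<forall>A\<in>bilinear_algebra.subalgebras scale bracket.
      \<forall>B\<in>bilinear_algebra.subalgebras scale bracket.
        \<theta> (bilinear_algebra.generated scale bracket (A \<union> B)) =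
          bilinear_algebra.generated scale' bracket' (\<theta> A \<union> \<theta> B) \<and>
        \<theta> (A \<inter> B) = \<theta> A \<inter> \<theta> B)"

end

theory Submission
  imports Defs
begin

text \<open>
  Write \<open>r B\<close> for the dimension of the subalgebra of \<open>L\<close> corresponding to a subalgebra \<open>B\<close> of
  \<open>L\<^sup>*\<close>. As \<open>L\<close> is supersolvable, \<open>r\<close> increases by one along maximal inclusions, so once \<open>L\<^sup>*\<close> has a
  chain of subalgebras each of which is an ideal of codimension one in the next, \<open>r\<close> is the dimension,
  maximal subalgebras have codimension one, and supersolvability follows as in Barnes' theorem.
  Such a chain is found by induction on non-Lie subalgebras \<open>U\<close> of \<open>L\<^sup>*\<close>. Let \<open>J\<close> be the span of the
  squares. Transporting the chain of ideals of \<open>L\<close> gives subalgebras \<open>R\<close> above \<open>J\<close> whose join with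
  \<open>J + F u\<close> is \<open>R + F u\<close> for generic \<open>u\<close>, by the induction hypothesis; hence \<open>R\<close> acts by scalars on
  \<open>U / R\<close>. At corank two, either the chain can be written down or \<open>R\<close> is an ideal and \<open>U / R\<close> is a
  Lie algebra all of whose proper subalgebras have dimension at most one. The latter is impossible:
  either a Lie ideal complements \<open>R\<close> modulo an ideal of codimension one in \<open>R\<close>, and such a complement
  is unique in \<open>U\<close> but not in \<open>L\<close>; or \<open>U\<close> is perfect, and the squares yield a nondegenerate
  invariant form on \<open>U / R\<close> together with a derivation \<open>D\<close> having \<open>[D, ad x] = -ad x / 2\<close> for some
  \<open>x\<close>, contradicting the invariance of the trace.
\<close>

section \<open>Subspaces, ideals and polycyclic subalgebras\<close>

text \<open>For Lie algebras the corresponding statement fails: over the reals, the cross product in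
  dimension three and the zero product on a plane have isomorphic lattices, consisting of zero,
  continuum many lines and the whole space, and only the second algebra is supersolvable. So a
  quotient of rank two may hide a simple algebra, and only squares can expose it. First, a generic
  element generates with \<open>J\<close> a non-Lie subalgebra, so every proper subalgebra above it
  falls under the induction hypothesis; an infinite field has enough such elements to control all of
  \<open>U\<close>. Secondly, in the perfect case a nonzero square yields a derivation
  \<open>D\<close> and an invariant form \<open>b\<close> with \<open>b (D x) x \<noteq> 0\<close>,
  although derivations of semisimple algebras are inner. The trace argument replaces this theorem:
  \<open>D\<close> is corrected by a single inner derivation. The constant one half arises because
  \<open>b x x\<close> is twice the value of a functional at the square of \<open>x\<close>. The
  induction asks for solvability only, since this already makes rank and dimension agree.\<close>

locale leibniz_fd = leibniz_algebra scale bracket + finite_dimensional_vector_space scale Basis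
  for scale :: "'f::field_char_0 \<Rightarrow> 'v::ab_group_add \<Rightarrow> 'v" (infixr \<open>*s\<close> 75)
    and bracket :: "'v \<Rightarrow> 'v \<Rightarrow> 'v" (infixl \<open>\<odot>\<close> 70)
    and Basis :: "'v set"
begin

lemma bracket_add_left: "(x + y) \<odot> z = x \<odot> z + y \<odot> z"
  using linear_left[of z, folded module_hom_iff_linear] by (rule module_hom.add)
lemma bracket_add_right: "z \<odot> (x + y) = z \<odot> x + z \<odot> y"
  using linear_right[of z, folded module_hom_iff_linear] by (rule module_hom.add)
lemma bracket_scale_left: "(c *s x) \<odot> z = c *s (x \<odot> z)"
  using linear_left[of z, folded module_hom_iff_linear] by (rule module_hom.scale)
lemma bracket_scale_right: "z \<odot> (c *s x) = c *s (z \<odot> x)"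
  using linear_right[of z, folded module_hom_iff_linear] by (rule module_hom.scale)
lemma bracket_zero_left: "0 \<odot> z = 0"
  using linear_left[of z, folded module_hom_iff_linear] by (rule module_hom.zero)
lemma bracket_zero_right: "z \<odot> 0 = 0"
  using linear_right[of z, folded module_hom_iff_linear] by (rule module_hom.zero)
lemma bracket_neg_left: "(- x) \<odot> z = - (x \<odot> z)"
  using linear_left[of z, folded module_hom_iff_linear] by (rule module_hom.neg)
lemma bracket_neg_right: "z \<odot> (- x) = - (z \<odot> x)"
  using linear_right[of z, folded module_hom_iff_linear] by (rule module_hom.neg)
lemma bracket_diff_left: "(x - y) \<odot> z = x \<odot> z - y \<odot> z"
  using linear_left[of z, folded module_hom_iff_linear] by (rule module_hom.diff)
lemma bracket_diff_right: "z \<odot> (x - y) = z \<odot> x - z \<odot> y"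
  using linear_right[of z, folded module_hom_iff_linear] by (rule module_hom.diff)

lemmas bracket_simps = bracket_add_left bracket_add_right bracket_scale_left bracket_scale_right
  bracket_zero_left bracket_zero_right bracket_neg_left bracket_neg_right
  bracket_diff_left bracket_diff_right

text \<open>The Leibniz identity expands \<open>z \<odot> (x \<odot> y)\<close> into an expression
  antisymmetric in \<open>x\<close> and \<open>y\<close>.\<close>

lemma bracket_sym_zero: "z \<odot> (x \<odot> y + y \<odot> x) = 0"
  by (simp add: bracket_simps leibniz)

lemma bracket_square_zero: "z \<odot> (x \<odot> x) = 0"
  by (simp add: leibniz)

lemma ex_max_dim:
  assumes "P C0"
  obtains C where "P C" "\<And>C'. P C' \<Longrightarrow> dim C' \<le> dim C"
proof -
  have "\<exists>C. P C \<and> (\<forall>C'. P C' \<longrightarrow> dim C' \<le> dim C)"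
    using ex_has_greatest_nat[of P C0 dim "Suc dimension"] assms dim_subset_UNIV le_imp_less_Suc by blast
  then show thesis using that by blast
qed

lemma ex_min_dim:
  assumes "P C0"
  obtains C where "P C" "\<And>C'. P C' \<Longrightarrow> dim C \<le> dim C'"
  using ex_has_least_nat[of P C0 dim] assms by blast

lemma dim_psubset_subspace: "subspace A \<Longrightarrow> subspace B \<Longrightarrow> A \<subset> B \<Longrightarrow> dim A < dim B"
  by (metis dim_psubset span_eq_iff)

text \<open>Quotients are never formed. A one-dimensional extension of \<open>A\<close> stands for a
  line of the quotient by \<open>A\<close>, and an eigenvector modulo \<open>A\<close> is expressed
  by \<open>f x - c *s x \<in> A\<close>.\<close>

definition line :: "'v set \<Rightarrow> 'v \<Rightarrow> 'v set"
  where "line A x = span (insert x A)"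

lemma subspace_line: "subspace (line A x)"
  by (simp add: line_def)

lemma mem_line: "subspace A \<Longrightarrow> y \<in> line A x \<longleftrightarrow> (\<exists>k. y - k *s x \<in> A)"
  by (simp add: line_def span_breakdown_eq span_eq_iff[THEN iffD2])

lemma line_self: "x \<in> line A x"
  by (simp add: line_def span_base)

lemma line_superset: "A \<subseteq> line A x"
  by (auto simp: line_def intro: span_base)

lemma line_least: "subspace B \<Longrightarrow> A \<subseteq> B \<Longrightarrow> x \<in> B \<Longrightarrow> line A x \<subseteq> B"
  unfolding line_def by (rule span_minimal) auto

lemma line_mono: "A \<subseteq> B \<Longrightarrow> line A x \<subseteq> line B x"
  unfolding line_def by (rule span_mono) auto

lemma dim_line: "subspace A \<Longrightarrow> x \<notin> A \<Longrightarrow> dim (line A x) = Suc (dim A)"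
  by (simp add: line_def dim_insert span_eq_iff[THEN iffD2])

lemma dim_line_le: "dim (line A x) \<le> Suc (dim A)"
  by (simp add: line_def dim_insert)

lemma line_eqI:
  assumes "subspace A" "subspace B" "A \<subseteq> B" "x \<in> B" "x \<notin> A" "dim B \<le> Suc (dim A)"
  shows "B = line A x"
  using assms line_least[of B A x] dim_line[of A x] subspace_dim_equal[of "line A x" B]
  by (simp add: subspace_line)

lemma line_absorb: "subspace A \<Longrightarrow> x \<in> A \<Longrightarrow> line A x = A"
  by (simp add: line_def insert_absorb span_eq_iff[THEN iffD2])

text \<open>\<open>ideal\<close> refers to the whole algebra; the inductions move through
  subalgebras, so the surrounding subalgebra becomes a parameter.\<close>

definition ideal_in :: "'v set \<Rightarrow> 'v set \<Rightarrow> bool"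
  where "ideal_in I B \<longleftrightarrow> subspace I \<and> I \<subseteq> B \<and> (\<forall>i\<in>I. \<forall>x\<in>B. x \<odot> i \<in> I \<and> i \<odot> x \<in> I)"

lemma ideal_inD:
  assumes "ideal_in I B"
  shows "subspace I" "I \<subseteq> B" "\<And>i x. i \<in> I \<Longrightarrow> x \<in> B \<Longrightarrow> x \<odot> i \<in> I"
    "\<And>i x. i \<in> I \<Longrightarrow> x \<in> B \<Longrightarrow> i \<odot> x \<in> I"
  using assms by (auto simp: ideal_in_def)

lemma subalgebraD:
  assumes "subalgebra A"
  shows "subspace A" "\<And>x y. x \<in> A \<Longrightarrow> y \<in> A \<Longrightarrow> x \<odot> y \<in> A"
  using assms by (auto simp: subalgebra_def)

lemma ideal_in_subalgebra: "ideal_in I B \<Longrightarrow> subalgebra I"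
  by (auto simp: ideal_in_def subalgebra_def)

lemma ideal_in_self: "subalgebra B \<Longrightarrow> ideal_in B B"
  by (auto simp: ideal_in_def subalgebra_def)

lemma ideal_in_zero: "subalgebra B \<Longrightarrow> ideal_in {0} B"
  by (auto simp: ideal_in_def subalgebra_def bracket_simps subspace_0)

lemma ideal_in_Int: "ideal_in I B \<Longrightarrow> ideal_in I' B \<Longrightarrow> ideal_in (I \<inter> I') B"
  by (auto simp: ideal_in_def subspace_inter)

lemma ideal_in_restrict: "ideal_in I B \<Longrightarrow> subalgebra A \<Longrightarrow> A \<subseteq> B \<Longrightarrow> ideal_in (I \<inter> A) A"
  by (auto simp: ideal_in_def subalgebra_def subspace_inter subset_eq)

lemma subalgebra_Int: "subalgebra A \<Longrightarrow> subalgebra B \<Longrightarrow> subalgebra (A \<inter> B)"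
  by (auto simp: subalgebra_def subspace_inter)

lemma subalgebra_zero: "subalgebra {0}"
  by (auto simp: subalgebra_def bracket_simps)

lemma subalgebra_UNIV: "subalgebra UNIV"
  by (auto simp: subalgebra_def)

lemma ideal_in_span:
  assumes B: "subalgebra B" and G: "G \<subseteq> B"
    and "\<And>g x. g \<in> G \<Longrightarrow> x \<in> B \<Longrightarrow> x \<odot> g \<in> span G"
    and "\<And>g x. g \<in> G \<Longrightarrow> x \<in> B \<Longrightarrow> g \<odot> x \<in> span G"
  shows "ideal_in (span G) B"
proof -
  have "x \<odot> i \<in> span G \<and> i \<odot> x \<in> span G" if "i \<in> span G" "x \<in> B" for i x
    using that(1)
  proof (induction rule: span_induct_alt)
    case base then show ?case by (simp add: bracket_simps span_zero)
  next
    case (step c g y)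
    then show ?case using assms(3,4) that(2) by (simp add: bracket_simps span_add span_scale)
  qed
  moreover have "span G \<subseteq> B" using B G by (intro span_minimal) (auto dest: subalgebraD)
  ultimately show ?thesis by (simp add: ideal_in_def)
qed

definition sums :: "'v set \<Rightarrow> 'v set \<Rightarrow> 'v set" (infixl \<open>\<boxplus>\<close> 65)
  where "A \<boxplus> B = {a + b | a b. a \<in> A \<and> b \<in> B}"

lemma subspace_boxplus: "subspace A \<Longrightarrow> subspace B \<Longrightarrow> subspace (A \<boxplus> B)"
  by (simp add: sums_def subspace_sums)

lemma dim_sums: "subspace A \<Longrightarrow> subspace B \<Longrightarrow> dim (A \<boxplus> B) + dim (A \<inter> B) = dim A + dim B"
  by (simp add: sums_def dim_sums_Int)

lemma sums_superset:
  "subspace B \<Longrightarrow> A \<subseteq> A \<boxplus> B" "subspace A \<Longrightarrow> B \<subseteq> A \<boxplus> B"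
  unfolding sums_def using subspace_0 by force+

lemma sums_least: "subspace C \<Longrightarrow> A \<subseteq> C \<Longrightarrow> B \<subseteq> C \<Longrightarrow> A \<boxplus> B \<subseteq> C"
  by (auto simp: sums_def intro: subspace_add)

lemma mem_sums: "x \<in> A \<boxplus> B \<longleftrightarrow> (\<exists>a\<in>A. \<exists>b\<in>B. x = a + b)"
  by (auto simp: sums_def)

lemma sums_mono: "A \<subseteq> A' \<Longrightarrow> B \<subseteq> B' \<Longrightarrow> A \<boxplus> B \<subseteq> A' \<boxplus> B'"
  by (auto simp: sums_def)

lemma ideal_in_sums:
  assumes "ideal_in I B" "ideal_in I' B" "subalgebra B"
  shows "ideal_in (I \<boxplus> I') B"
  unfolding ideal_in_def
proof (intro conjI ballI)
  show "subspace (I \<boxplus> I')" using assms by (simp add: subspace_boxplus ideal_inD)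
  show "I \<boxplus> I' \<subseteq> B" using assms by (intro sums_least) (auto dest: ideal_inD subalgebraD)
  fix u x assume "u \<in> I \<boxplus> I'" "x \<in> B"
  then obtain i j where "i \<in> I" "j \<in> I'" "u = i + j" by (auto simp: mem_sums)
  then have "x \<odot> u = x \<odot> i + x \<odot> j" "u \<odot> x = i \<odot> x + j \<odot> x"
    "x \<odot> i \<in> I" "x \<odot> j \<in> I'" "i \<odot> x \<in> I" "j \<odot> x \<in> I'"
    using assms \<open>x \<in> B\<close> by (auto simp: bracket_simps ideal_inD)
  then show "x \<odot> u \<in> I \<boxplus> I'" "u \<odot> x \<in> I \<boxplus> I'" by (auto simp: mem_sums)
qed

lemma subalgebra_sums:
  assumes "ideal_in I B" "subalgebra A" "A \<subseteq> B"
  shows "subalgebra (I \<boxplus> A)"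
  unfolding subalgebra_def
proof (intro conjI ballI)
  show "subspace (I \<boxplus> A)" using assms by (simp add: subspace_boxplus ideal_inD subalgebraD)
  fix x y assume "x \<in> I \<boxplus> A" "y \<in> I \<boxplus> A"
  then obtain i a j b where *: "i \<in> I" "a \<in> A" "x = i + a" "j \<in> I" "b \<in> A" "y = j + b"
    by (auto simp: mem_sums)
  have "x \<odot> y = (i \<odot> (j + b) + a \<odot> j) + a \<odot> b" by (simp add: * bracket_simps)
  moreover have "i \<odot> (j + b) + a \<odot> j \<in> I"
    using assms * by (auto simp: ideal_in_def bracket_simps intro!: subspace_add)
  moreover have "a \<odot> b \<in> A" using assms(2) * by (auto dest: subalgebraD)
  ultimately show "x \<odot> y \<in> I \<boxplus> A" by (auto simp: mem_sums)
qed

definition brackets :: "'v set \<Rightarrow> 'v set"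
  where "brackets B = span {x \<odot> y | x y. x \<in> B \<and> y \<in> B}"

lemma subspace_brackets: "subspace (brackets B)" by (simp add: brackets_def)

lemma bracket_in_brackets: "x \<in> B \<Longrightarrow> y \<in> B \<Longrightarrow> x \<odot> y \<in> brackets B"
  by (auto simp: brackets_def intro: span_base)

lemma brackets_least:
  "subspace C \<Longrightarrow> (\<And>x y. x \<in> B \<Longrightarrow> y \<in> B \<Longrightarrow> x \<odot> y \<in> C) \<Longrightarrow> brackets B \<subseteq> C"
  unfolding brackets_def by (rule span_minimal) auto

text \<open>By \<open>polycyclic_brackets\<close> each factor of such a chain has zero product, so
  this is solvability, in a form that counts dimensions along the chain. A term need only be an
  ideal of the next one, which separates the notion from supersolvability.\<close>

inductive polycyclic :: "'v set \<Rightarrow> bool" where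
  zero: "polycyclic {0}"
| step: "polycyclic N \<Longrightarrow> subalgebra B \<Longrightarrow> ideal_in N B \<Longrightarrow> dim B = Suc (dim N) \<Longrightarrow> polycyclic B"

lemma polycyclic_subalgebra: "polycyclic B \<Longrightarrow> subalgebra B"
  by (induction rule: polycyclic.induct) (auto simp: subalgebra_zero)

lemma polycyclic_mono: "polycyclic B \<Longrightarrow> subalgebra A \<Longrightarrow> A \<subseteq> B \<Longrightarrow> polycyclic A"
proof (induction arbitrary: A rule: polycyclic.induct)
  case zero
  then have "A = {0}" by (auto dest!: subalgebraD(1) subspace_0)
  then show ?case by (simp add: polycyclic.zero)
next
  case (step N B)
  have 1: "polycyclic (N \<inter> A)"
    using step by (intro step.IH) (auto intro: subalgebra_Int ideal_in_subalgebra)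
  have 2: "ideal_in (N \<inter> A) A" using step by (intro ideal_in_restrict)
  show ?case
  proof (cases "A \<subseteq> N")
    case True then show ?thesis using 1 by (simp add: Int_absorb1)
  next
    case False
    then obtain a where a: "a \<in> A" "a \<notin> N" by blast
    have sN: "subspace N" and sA: "subspace A" and sB: "subspace B" and "N \<subseteq> B"
      using step by (auto dest: ideal_inD subalgebraD)
    have "B = line N a" using a step sN sB by (intro line_eqI) (auto dest: ideal_inD)
    have "A = line (N \<inter> A) a"
    proof
      show "line (N \<inter> A) a \<subseteq> A" using a sA by (intro line_least) auto
      show "A \<subseteq> line (N \<inter> A) a"
      proof
        fix y assume y: "y \<in> A"
        then have "y \<in> line N a" using \<open>B = line N a\<close> step by auto
        then obtain k where "y - k *s a \<in> N" by (auto simp: mem_line sN)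
        moreover have "y - k *s a \<in> A" using y a sA by (simp add: subspace_diff subspace_scale)
        ultimately show "y \<in> line (N \<inter> A) a" by (auto simp: mem_line subspace_inter sN sA)
      qed
    qed
    then have "dim A = Suc (dim (N \<inter> A))"
      using a dim_line[of "N \<inter> A" a] by (simp add: subspace_inter sN sA)
    then show ?thesis using polycyclic.step[OF 1 _ 2] step.prems by blast
  qed
qed

text \<open>A subspace between \<open>A\<close> and \<open>B\<close> contains all products of
  elements of \<open>B\<close>, hence is an ideal of every larger subspace of \<open>B\<close>; a
  largest polycyclic one could be enlarged by any vector outside it.\<close>

lemma polycyclic_above_brackets:
  assumes A: "polycyclic A" and "subalgebra B" "A \<subseteq> B" and br: "\<And>x y. x \<in> B \<Longrightarrow> y \<in> B \<Longrightarrow> x \<odot> y \<in> A"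
  shows "polycyclic B"
proof -
  define P where "P C \<longleftrightarrow> polycyclic C \<and> A \<subseteq> C \<and> C \<subseteq> B" for C
  have "P A" using assms by (simp add: P_def)
  then obtain C where C: "P C" and mx: "\<And>C'. P C' \<Longrightarrow> dim C' \<le> dim C" using ex_max_dim[of P A] by blast
  have sB: "subspace B" and sC: "subspace C"
    using assms C by (auto simp: P_def dest!: polycyclic_subalgebra subalgebraD(1))
  have "C = B"
  proof (rule ccontr)
    assume "C \<noteq> B"
    then obtain b where b: "b \<in> B" "b \<notin> C" using C by (auto simp: P_def)
    have sub: "line C b \<subseteq> B" using b C sB by (intro line_least) (auto simp: P_def)
    have "ideal_in C (line C b)" and "subalgebra (line C b)"
      using sub C br line_superset[of C b] unfolding P_def ideal_in_def subalgebra_def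
      by (auto simp: sC subspace_line subset_eq)
    then have "polycyclic (line C b)"
      using C b dim_line[OF sC b(2)] using polycyclic.step[of C] by (auto simp: P_def)
    then have "P (line C b)" using C sub line_superset[of C b] by (auto simp: P_def)
    then show False using mx dim_line[OF sC b(2)] by fastforce
  qed
  then show ?thesis using C by (simp add: P_def)
qed

text \<open>A one-dimensional Leibniz algebra has zero product: if \<open>b \<odot> b\<close> is
  \<open>c *s b\<close> modulo \<open>N\<close>, left multiplication by \<open>b\<close> gives
  \<open>c *s (b \<odot> b) \<in> N\<close>, because \<open>b \<odot> (b \<odot> b)\<close>
  vanishes.\<close>

lemma polycyclic_brackets:
  assumes N: "ideal_in N B" and B: "subalgebra B" "dim B = Suc (dim N)" and "x \<in> B" "y \<in> B"
  shows "x \<odot> y \<in> N"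
proof -
  have sN: "subspace N" and sB: "subspace B" using assms by (auto dest: ideal_inD subalgebraD)
  have "N \<noteq> B" using B by auto
  then obtain b where b: "b \<in> B" "b \<notin> N" using N by (auto dest: ideal_inD)
  have Bl: "B = line N b" using b N sN sB B by (intro line_eqI) (auto dest: ideal_inD)
  have "b \<odot> b \<in> line N b" using b B Bl by (auto dest: subalgebraD)
  then obtain c where c: "b \<odot> b - c *s b \<in> N" by (auto simp: mem_line sN)
  have "b \<odot> (b \<odot> b - c *s b) \<in> N" using c b N by (auto dest: ideal_inD)
  then have 1: "c *s (b \<odot> b) \<in> N" using subspace_neg[OF sN] by (force simp: bracket_simps bracket_square_zero)
  have bb: "b \<odot> b \<in> N"
  proof (cases "c = 0")
    case True then show ?thesis using c by simp
  next
    case False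
    then show ?thesis using subspace_scale[OF sN 1, of "inverse c"] by simp
  qed
  obtain k n where x: "x = n + k *s b" "n \<in> N"
    using \<open>x \<in> B\<close> Bl mem_line[OF sN] by (metis diff_add_cancel)
  obtain l m where y: "y = m + l *s b" "m \<in> N"
    using \<open>y \<in> B\<close> Bl mem_line[OF sN] by (metis diff_add_cancel)
  have "n \<odot> y \<in> N" "b \<odot> m \<in> N" using N b x y \<open>y \<in> B\<close> by (auto intro: ideal_inD)
  moreover have "x \<odot> y = n \<odot> y + k *s (b \<odot> m) + (k * l) *s (b \<odot> b)"
    by (simp add: x y bracket_simps algebra_simps)
  ultimately show ?thesis using bb by (simp add: subspace_add subspace_scale sN)
qed

end

section \<open>Supersolvability from codimension-one maximal subalgebras\<close>

context leibniz_fd begin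

lemma linear_iff_local: "Vector_Spaces.linear scale scale f \<longleftrightarrow>
    (\<forall>x y. f (x + y) = f x + f y) \<and> (\<forall>c x. f (c *s x) = c *s f x)"
  by (auto simp: Vector_Spaces.linear_def module_hom_def module_hom_axioms_def vector_space_axioms module_axioms)

text \<open>An injective endomorphism of the finite-dimensional quotient \<open>B / A\<close> is
  surjective. Without a quotient type, the images of the powers of \<open>f\<close> serve: where
  they stabilise, \<open>(f ^^ k) (a - f b)\<close> lies in \<open>A\<close> for some
  \<open>b\<close>, and injectivity removes the power.\<close>

lemma surj_mod:
  assumes f: "Vector_Spaces.linear scale scale f" and A: "subspace A" and B: "subspace B"
    and fA: "f ` A \<subseteq> A" and fB: "f ` B \<subseteq> B"
    and inj: "\<And>b. b \<in> B \<Longrightarrow> f b \<in> A \<Longrightarrow> b \<in> A" and a: "a \<in> B"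
  obtains b where "b \<in> B" "a - f b \<in> A"
proof -
  note lin = f[unfolded linear_iff_local]
  have f0: "f (x - y) = f x - f y" for x y
    using lin by (metis add_diff_cancel_right' diff_add_cancel)
  define W where "W k = A \<boxplus> (f ^^ k) ` B" for k
  have lk: "Vector_Spaces.linear scale scale (f ^^ k)" for k
    by (induction k) (use lin in \<open>auto simp: linear_iff_local\<close>)
  have sW: "subspace (W k)" for k
    unfolding W_def using module_hom.subspace_image[OF lk[of k, folded module_hom_iff_linear] B]
    by (intro subspace_boxplus A)
  have fkB: "(f ^^ k) b \<in> B" if "b \<in> B" for k b using that fB by (induction k) auto
  have dec: "W (Suc k) \<subseteq> W k" for k
    unfolding W_def using fB by (intro sums_mono order.refl) (force simp: funpow_swap1)
  have "\<exists>k. W k = W (Suc k)"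
  proof (rule ccontr)
    assume "\<nexists>k. W k = W (Suc k)"
    then have "dim (W (Suc k)) < dim (W k)" for k using dec sW by (intro dim_psubset_subspace) auto
    then have "dim (W k) + k \<le> dim (W 0)" for k
      by (induction k) (auto, metis Suc_leI add_Suc_right add_mono_thms_linordered_semiring(3) le_trans add_Suc)
    from this[of "Suc (dim (W 0))"] show False by simp
  qed
  then obtain k where k: "W k = W (Suc k)" by blast
  have "(f ^^ k) a \<in> W k" unfolding W_def using sums_superset(2)[OF A] a by blast
  then have "(f ^^ k) a \<in> W (Suc k)" using k by simp
  then obtain c b where *: "c \<in> A" "b \<in> B" "(f ^^ k) a = c + (f ^^ Suc k) b"
    unfolding W_def mem_sums by blast
  have kd: "(f ^^ k) (x - y) = (f ^^ k) x - (f ^^ k) y" for x y by (induction k) (auto simp: f0)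
  have "(f ^^ k) (a - f b) \<in> A" using * by (simp add: kd funpow_swap1)
  moreover have "a - f b \<in> B" using a *(2) fB B by (auto intro: subspace_diff)
  moreover have "(f ^^ k) c \<in> A \<Longrightarrow> c \<in> B \<Longrightarrow> c \<in> A" for k c
    by (induction k) (use inj fkB in auto)
  ultimately show thesis using that *(2) by blast
qed

text \<open>The invariance lemma from the proof of Lie's theorem, for right multiplications.
  Applying \<open>x\<close> repeatedly to the weight vector \<open>v\<close> gives vectors on which
  \<open>n\<close> acts triangularly, with \<open>of_nat k * lam (x \<odot> n)\<close> next to the
  diagonal. A positive multiple of \<open>lam (x \<odot> n)\<close> is forced to vanish, which is
  where characteristic zero enters.\<close>

lemma weight_bracket_zero:
  assumes A: "subspace A" and Ax: "\<And>a. a \<in> A \<Longrightarrow> a \<odot> x \<in> A"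
    and An: "\<And>a n. a \<in> A \<Longrightarrow> n \<in> N \<Longrightarrow> a \<odot> n \<in> A"
    and xN: "\<And>n. n \<in> N \<Longrightarrow> x \<odot> n \<in> N"
    and v: "v \<notin> A" and lam: "\<And>n. n \<in> N \<Longrightarrow> v \<odot> n - lam n *s v \<in> A"
    and n: "n \<in> N"
  shows "lam (x \<odot> n) = 0"
proof -
  define w where "w k = ((\<lambda>y. y \<odot> x) ^^ k) v" for k
  define U where "U k = span (A \<union> w ` {..<k})" for k
  have w0: "w 0 = v" and wS: "w (Suc k) = w k \<odot> x" for k by (simp_all add: w_def)
  have sU: "subspace (U k)" for k by (simp add: U_def)
  have U0: "U 0 = A" using A by (simp add: U_def span_eq_iff[THEN iffD2])
  have Umono: "i \<le> j \<Longrightarrow> U i \<subseteq> U j" for i j unfolding U_def by (intro span_mono) auto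
  have AU: "A \<subseteq> U k" for k using Umono[of 0 k] U0 by simp
  have wU: "i < k \<Longrightarrow> w i \<in> U k" for i k unfolding U_def by (intro span_base) auto
  have Ux: "u \<odot> x \<in> U (Suc k)" if "u \<in> U k" for u k
    using that unfolding U_def[of k]
  proof (induction rule: span_induct_alt)
    case base then show ?case by (simp add: bracket_simps subspace_0 sU)
  next
    case (step c g y)
    then have "g \<odot> x \<in> U (Suc k)"
      using Ax AU[of "Suc k"] wU[of _ "Suc k"] by (auto simp: wS[symmetric])
    then show ?case using step by (simp add: bracket_simps subspace_add subspace_scale sU)
  qed
  \<comment> \<open>At \<open>k = 0\<close> the truncated subtraction is harmless: the coefficient
    \<open>of_nat k\<close> vanishes and \<open>U 0\<close> is \<open>A\<close>.\<close>
  have S: "\<forall>n\<in>N. w k \<odot> n - lam n *s w k - (of_nat k * lam (x \<odot> n)) *s w (k - 1) \<in> U (k - 1)" for k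
  proof (induction k)
    case 0 then show ?case using lam by (simp add: w0 U0)
  next
    case (Suc k)
    show ?case
    proof
      fix n assume n: "n \<in> N"
      let ?e = "w k \<odot> n - lam n *s w k - (of_nat k * lam (x \<odot> n)) *s w (k - 1)"
      let ?d = "w k \<odot> (x \<odot> n) - lam (x \<odot> n) *s w k - (of_nat k * lam (x \<odot> (x \<odot> n))) *s w (k - 1)"
      have e: "?e \<in> U (k - 1)" and d: "?d \<in> U (k - 1)" using Suc n xN by blast+
      have ex: "?e \<odot> x \<in> U k" using Ux[OF e] e Ax U0 by (cases k) auto
      have cx: "(of_nat k * lam (x \<odot> n)) *s (w (k - 1) \<odot> x) = (of_nat k * lam (x \<odot> n)) *s w k"
        by (cases k) (auto simp: wS)
      have ex': "(w k \<odot> n) \<odot> x - lam n *s w (Suc k) - (of_nat k * lam (x \<odot> n)) *s w k \<in> U k"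
        using ex unfolding bracket_diff_left bracket_scale_left wS cx .
      have d2: "(of_nat k * lam (x \<odot> (x \<odot> n))) *s w (k - 1) \<in> U k"
        using wU[of "k - 1" k] by (cases k) (auto simp: subspace_0 subspace_scale sU)
      have "?d \<in> U k" using d Umono[of "k - 1" k] by auto
      from subspace_add[OF sU this d2]
      have d': "w k \<odot> (x \<odot> n) - lam (x \<odot> n) *s w k \<in> U k" by simp
      have "w (Suc k) \<odot> n - lam n *s w (Suc k) - (of_nat (Suc k) * lam (x \<odot> n)) *s w k
        = ((w k \<odot> n) \<odot> x - lam n *s w (Suc k) - (of_nat k * lam (x \<odot> n)) *s w k)
          + (w k \<odot> (x \<odot> n) - lam (x \<odot> n) *s w k)"
        by (simp add: wS leibniz algebra_simps)
      also have "\<dots> \<in> U k" using ex' d' by (rule subspace_add[OF sU])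
      finally show "w (Suc k) \<odot> n - lam n *s w (Suc k) - (of_nat (Suc k) * lam (x \<odot> n)) *s w (Suc k - 1)
        \<in> U (Suc k - 1)" by simp
    qed
  qed
  have UL: "u \<odot> n - lam n *s u \<in> U (k - 1)" if "u \<in> U k" for u k
    using that unfolding U_def[of k]
  proof (induction rule: span_induct_alt)
    case base then show ?case by (simp add: bracket_simps subspace_0 sU)
  next
    case (step c g y)
    have "g \<odot> n - lam n *s g \<in> U (k - 1)"
    proof (cases "g \<in> A")
      case True
      then have "g \<odot> n - lam n *s g \<in> A" using An n A by (simp add: subspace_diff subspace_scale)
      then show ?thesis using AU by blast
    next
      case False
      then obtain i where i: "i < k" "g = w i" using step by auto
      let ?e = "w i \<odot> n - lam n *s w i - (of_nat i * lam (x \<odot> n)) *s w (i - 1)"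
      have "(of_nat i * lam (x \<odot> n)) *s w (i - 1) \<in> U (k - 1)"
        using wU[of "i - 1" "k - 1"] i by (cases i) (auto simp: subspace_0 subspace_scale sU)
      moreover have "?e \<in> U (k - 1)" using S[of i] n Umono[of "i - 1" "k - 1"] i
        by (metis diff_le_mono less_imp_le subsetD)
      ultimately have "?e + (of_nat i * lam (x \<odot> n)) *s w (i - 1) \<in> U (k - 1)"
        by (intro subspace_add sU)
      then show ?thesis using i by simp
    qed
    then have "c *s (g \<odot> n - lam n *s g) + (y \<odot> n - lam n *s y) \<in> U (k - 1)"
      using step by (intro subspace_add subspace_scale sU)
    then show ?case by (simp add: bracket_simps algebra_simps)
  qed
  have "\<exists>k. w k \<in> U k"
  proof (rule ccontr)
    assume no: "\<nexists>k. w k \<in> U k"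
    have "k \<le> dim (U k)" for k
    proof (induction k)
      case (Suc k)
      have "line (U k) (w k) \<subseteq> U (Suc k)"
        using Umono[of k "Suc k"] wU[of k "Suc k"] sU by (intro line_least) auto
      then have "dim (line (U k) (w k)) \<le> dim (U (Suc k))" by (rule dim_subset)
      then show ?case using Suc no dim_line[OF sU, of "w k" k] by auto
    qed simp
    from this[of "Suc dimension"] show False using dim_subset_UNIV[of "U (Suc dimension)"] by simp
  qed
  then obtain r where r: "w r \<in> U r" "\<And>i. i < r \<Longrightarrow> w i \<notin> U i"
    using exists_least_iff[of "\<lambda>k. w k \<in> U k"] by blast
  then have r0: "r \<noteq> 0" using v w0 U0 by (cases r) auto
  \<comment> \<open>At the first \<open>r\<close> with \<open>w r \<in> U r\<close> both
    \<open>S\<close> and \<open>UL\<close> describe \<open>w r \<odot> n\<close>; their difference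
    leaves only a multiple of \<open>w (r - 1)\<close>, which lies outside
    \<open>U (r - 1)\<close>.\<close>
  have "(w r \<odot> n - lam n *s w r) - (w r \<odot> n - lam n *s w r - (of_nat r * lam (x \<odot> n)) *s w (r - 1)) \<in> U (r - 1)"
    by (rule subspace_diff[OF sU UL[OF r(1)] bspec[OF S n]])
  then have *: "(of_nat r * lam (x \<odot> n)) *s w (r - 1) \<in> U (r - 1)" by simp
  show ?thesis
  proof (rule ccontr)
    assume "lam (x \<odot> n) \<noteq> 0"
    then have "of_nat r * lam (x \<odot> n) \<noteq> 0" using r0 by simp
    then have "w (r - 1) \<in> U (r - 1)"
      using subspace_scale[OF sU *, of "inverse (of_nat r * lam (x \<odot> n))"]
      by (simp add: field_simps)
    then show False using r r0 by simp
  qed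
qed

text \<open>On a minimal ideal factor, left multiplication is either minus right multiplication or
  zero. The symmetrised products generate, together with \<open>A\<close>, an ideal between
  \<open>A\<close> and \<open>A'\<close>: if it is \<open>A\<close> the first case holds, if it is
  \<open>A'\<close> the second, since left multiplications kill symmetrised products.\<close>

lemma right_invariant_ideal:
  assumes B: "subalgebra B" and A: "ideal_in A B" and A': "ideal_in A' B" and AA': "A \<subseteq> A'"
    and min: "\<And>C. ideal_in C B \<Longrightarrow> A \<subseteq> C \<Longrightarrow> C \<subseteq> A' \<Longrightarrow> C = A \<or> C = A'"
    and W: "subspace W" "A \<subseteq> W" "W \<subseteq> A'" and inv: "\<And>w x. w \<in> W \<Longrightarrow> x \<in> B \<Longrightarrow> w \<odot> x \<in> W"
  shows "ideal_in W B"
proof -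
  define G where "G = A \<union> {x \<odot> a + a \<odot> x | x a. x \<in> B \<and> a \<in> A'}"
  have GA': "G \<subseteq> A'"
    using AA' ideal_inD[OF A'] by (auto simp: G_def intro!: subspace_add)
  have "ideal_in (span G) B"
  proof (rule ideal_in_span[OF B])
    show "G \<subseteq> B" using GA' ideal_inD(2)[OF A'] by blast
    fix g x assume g: "g \<in> G" and x: "x \<in> B"
    show "x \<odot> g \<in> span G"
    proof (cases "g \<in> A")
      case True then show ?thesis using x ideal_inD[OF A] by (auto simp: G_def intro!: span_base)
    next
      case False then show ?thesis using g by (auto simp: G_def bracket_sym_zero span_zero)
    qed
    show "g \<odot> x \<in> span G"
    proof (cases "g \<in> A")
      case True then show ?thesis using x ideal_inD[OF A] by (auto simp: G_def intro!: span_base)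
    next
      case False
      then obtain y a where y: "y \<in> B" "a \<in> A'" "g = y \<odot> a + a \<odot> y" using g by (auto simp: G_def)
      \<comment> \<open>Right multiplication by \<open>x\<close> is a derivation, so it sends a
        symmetrised product to a sum of two such products.\<close>
      have "g \<odot> x = ((y \<odot> x) \<odot> a + a \<odot> (y \<odot> x)) + (y \<odot> (a \<odot> x) + (a \<odot> x) \<odot> y)"
        by (simp add: y(3) bracket_simps leibniz)
      moreover have "(y \<odot> x) \<odot> a + a \<odot> (y \<odot> x) \<in> span G" "y \<odot> (a \<odot> x) + (a \<odot> x) \<odot> y \<in> span G"
        using x y B ideal_inD[OF A'] by (auto simp: G_def intro!: span_base dest: subalgebraD; blast)+
      ultimately show ?thesis by (simp add: span_add)
    qed
  qed
  moreover have "A \<subseteq> span G" by (auto simp: G_def intro: span_base)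
  moreover have "span G \<subseteq> A'" using GA' ideal_inD(1)[OF A'] by (rule span_minimal)
  ultimately have "span G = A \<or> span G = A'" by (rule min)
  then have "x \<odot> w \<in> W" if w: "w \<in> W" and x: "x \<in> B" for x w
  proof
    assume "span G = A"
    moreover have "x \<odot> w + w \<odot> x \<in> span G" using w x W by (auto simp: G_def intro!: span_base)
    ultimately have "(x \<odot> w + w \<odot> x) - w \<odot> x \<in> W"
      using W inv[OF w x] by (intro subspace_diff) auto
    then show ?thesis by simp
  next
    assume eq: "span G = A'"
    have "x \<odot> z \<in> A" if "z \<in> span G" for z
      using that
    proof (induction rule: span_induct_alt)
      case base then show ?case using ideal_inD[OF A] by (simp add: bracket_simps subspace_0)
    next
      case (step c g y)
      have "x \<odot> g \<in> A" using step x ideal_inD[OF A] by (auto simp: G_def bracket_sym_zero subspace_0)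
      then show ?case using step ideal_inD[OF A] by (simp add: bracket_simps subspace_add subspace_scale)
    qed
    then show ?thesis using w W eq by blast
  qed
  then show ?thesis using W inv ideal_inD(2)[OF A'] by (auto simp: ideal_in_def)
qed

text \<open>All chief factors have dimension one. Demanding this above every proper ideal, not along
  a single chain, allows any ideal at hand to be enlarged by one dimension.\<close>

definition supersolvable_on :: "'v set \<Rightarrow> bool"
  where "supersolvable_on B \<longleftrightarrow>
    (\<forall>A. ideal_in A B \<and> A \<noteq> B \<longrightarrow> (\<exists>A'. ideal_in A' B \<and> A \<subset> A' \<and> dim A' = Suc (dim A)))"

lemma dim_Int_codim_one:
  assumes "subspace N" "subspace B" "N \<subseteq> B" "dim B = Suc (dim N)" "subspace A" "A \<subseteq> B"
  shows "dim A \<le> Suc (dim (A \<inter> N))"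
proof -
  have "dim (A \<boxplus> N) \<le> dim B" using assms by (intro dim_subset sums_least)
  then show ?thesis using dim_sums[of A N] assms by simp
qed

text \<open>Take an ideal \<open>E\<close> as large as possible with
  \<open>E \<inter> A' \<subseteq> A\<close>. The next ideal, one dimension larger, meets
  \<open>A'\<close> in some \<open>v\<close> outside \<open>A\<close>; the eigenvector equation of
  \<open>v\<close> modulo \<open>E\<close> then holds modulo \<open>E \<inter> A'\<close>, hence
  modulo \<open>A\<close>.\<close>

lemma supersolvable_on_weight:
  assumes N: "subalgebra N" "supersolvable_on N" and A: "ideal_in A N" and A': "ideal_in A' N" "\<not> A' \<subseteq> A"
  obtains v lam where "v \<in> A'" "v \<notin> A" "\<And>n. n \<in> N \<Longrightarrow> v \<odot> n - lam n *s v \<in> A"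
proof -
  define P where "P E \<longleftrightarrow> ideal_in E N \<and> E \<inter> A' \<subseteq> A" for E
  have "P {0}" using ideal_inD[OF A] by (auto simp: P_def ideal_in_zero N subspace_0)
  then obtain E where E: "P E" and mx: "\<And>C. P C \<Longrightarrow> dim C \<le> dim E" using ex_max_dim[of P] by blast
  have "E \<noteq> N" using E A' ideal_inD(2)[OF A'(1)] by (auto simp: P_def)
  then obtain E' where E': "ideal_in E' N" "E \<subset> E'" "dim E' = Suc (dim E)"
    using N(2) E \<open>E \<noteq> N\<close> unfolding supersolvable_on_def P_def by meson
  then obtain v where v: "v \<in> E'" "v \<in> A'" "v \<notin> A" using mx[of E'] by (auto simp: P_def)
  have vE: "v \<notin> E" using E v by (auto simp: P_def)
  have sE: "subspace E" "subspace E'" "subspace A'" using E E' A' by (auto simp: P_def dest: ideal_inD)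
  have line: "E' = line E v" using sE E' v vE by (intro line_eqI) auto
  have "\<exists>k. v \<odot> n - k *s v \<in> A" if n: "n \<in> N" for n
  proof -
    have "v \<odot> n \<in> line E v" using line v n ideal_inD[OF E'(1)] by auto
    then obtain k where "v \<odot> n - k *s v \<in> E" using sE by (auto simp: mem_line)
    moreover have "v \<odot> n - k *s v \<in> A'"
      using v n ideal_inD[OF A'(1)] by (auto intro!: subspace_diff subspace_scale)
    ultimately show ?thesis using E by (auto simp: P_def)
  qed
  then obtain lam where "\<And>n. n \<in> N \<Longrightarrow> v \<odot> n - lam n *s v \<in> A" by metis
  then show thesis using that v by blast
qed

text \<open>\<open>Y\<close> is the sum of the generalized eigenspaces, for eigenvalues in the
  field, of right multiplication by \<open>x\<close> modulo \<open>A\<close>. The lack of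
  eigenvectors on \<open>A' / A\<close> gives \<open>Y \<inter> A' = A\<close>. On
  \<open>B / A'\<close> the ideals from \<open>IH\<close> put all eigenvalues into the field, so
  \<open>Y\<close> covers that quotient.\<close>

lemma split_complement:
  assumes B: "subalgebra B" and A: "ideal_in A B" and A': "ideal_in A' B" and AA': "A \<subset> A'" and x: "x \<in> B"
    and ab: "\<And>a a'. a \<in> A' \<Longrightarrow> a' \<in> A' \<Longrightarrow> a \<odot> a' \<in> A"
    and noeig: "\<And>w c. w \<in> A' \<Longrightarrow> w \<odot> x - c *s w \<in> A \<Longrightarrow> w \<in> A"
    and IH: "\<And>C. ideal_in C B \<Longrightarrow> A' \<subseteq> C \<Longrightarrow> C \<noteq> B \<Longrightarrow>
      \<exists>C'. ideal_in C' B \<and> C \<subset> C' \<and> dim C' = Suc (dim C)"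
  obtains Y where "subalgebra Y" "Y \<inter> A' = A" "B = Y \<boxplus> A'"
proof -
  define f where "f c y = y \<odot> x - c *s y" for c y
  define Y where "Y = {y\<in>B. \<exists>cs. fold f cs y \<in> A}"
  note sB = subalgebraD(1)[OF B] and sA = ideal_inD(1)[OF A] and sA' = ideal_inD(1)[OF A']
  note AB = ideal_inD(2)[OF A] and A'B = ideal_inD(2)[OF A']
  have lin: "Vector_Spaces.linear scale scale (f c)" for c
    by (auto simp: f_def linear_iff_local bracket_simps algebra_simps)
  have f_add: "f c (y + z) = f c y + f c z" for c y z using lin by (simp add: linear_iff_local)
  have f_scale: "f c (k *s z) = k *s f c z" for c k z using lin by (simp add: linear_iff_local)
  have f_comm: "f c (f d y) = f d (f c y)" for c d y by (simp add: f_def bracket_simps algebra_simps)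
  have fold_comm: "fold f cs (f d y) = f d (fold f cs y)" for cs d y
    by (induction cs arbitrary: y) (simp_all, metis f_comm)
  have fold_comm2: "fold f cs (fold f ds y) = fold f ds (fold f cs y)" for cs ds y
    by (induction ds arbitrary: y) (auto simp: fold_comm)
  have fold_add: "fold f cs (y + z) = fold f cs y + fold f cs z" for cs y z
    by (induction cs arbitrary: y z) (auto simp: f_add)
  have fold_scale: "fold f cs (k *s z) = k *s fold f cs z" for cs k z
    by (induction cs arbitrary: z) (auto simp: f_scale)
  have f_ideal: "f c y \<in> C" if "y \<in> C" "ideal_in C B" for c y C
    using that x by (auto simp: f_def ideal_in_def intro!: subspace_diff subspace_scale)
  have fold_ideal: "fold f cs y \<in> C" if "y \<in> C" "ideal_in C B" for cs y C
    using that(1) by (induction cs arbitrary: y) (use f_ideal that(2) in auto)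
  have AY: "A \<subseteq> Y" using AB by (auto simp: Y_def intro: exI[of _ "[]"])
  have YB: "Y \<subseteq> B" by (auto simp: Y_def)
  have Yf: "y \<in> Y" if "y \<in> B" "f c y \<in> Y" for y c
    using that unfolding Y_def by (auto intro: exI[of _ "c # _"])
  have Yadd: "y + z \<in> Y" if yz: "y \<in> Y" "z \<in> Y" for y z
  proof -
    obtain cs ds where "fold f cs y \<in> A" "fold f ds z \<in> A" using yz by (auto simp: Y_def)
    then have "fold f ds (fold f cs y) \<in> A" "fold f cs (fold f ds z) \<in> A"
      using fold_ideal A by blast+
    then have "fold f (cs @ ds) (y + z) \<in> A"
      using fold_comm2[of cs ds z] sA by (simp add: fold_add subspace_add)
    then show ?thesis using yz sB unfolding Y_def by (blast intro: subspace_add)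
  qed
  have sY: "subspace Y"
  proof (rule subspaceI)
    show "0 \<in> Y" using AY sA subspace_0 by blast
    show "c *s y \<in> Y" if "y \<in> Y" for c y
      using that sB sA by (auto simp: Y_def fold_scale intro!: subspace_scale)
  qed (rule Yadd)
  have prod: "y \<odot> z \<in> Y" if "y \<in> B" "z \<in> B" "fold f cs y \<in> A" "fold f ds z \<in> A" for y z cs ds
    using that
  proof (induction "length cs + length ds" arbitrary: y z cs ds rule: less_induct)
    case less
    show ?case
    proof (cases cs)
      case Nil
      then have "y \<odot> z \<in> A" using less ideal_inD[OF A] by auto
      then show ?thesis using AY by blast
    next
      case (Cons c cs')
      show ?thesis
      proof (cases ds)
        case Nil
        then have "y \<odot> z \<in> A" using less ideal_inD[OF A] by auto
        then show ?thesis using AY by blast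
      next
        case C2: (Cons d ds')
        have fB: "f c y \<in> B" "f d z \<in> B" using f_ideal[OF _ ideal_in_self[OF B]] less by auto
        have "f c y \<odot> z \<in> Y" using less.hyps[of cs' ds "f c y" z] less.prems fB Cons by auto
        moreover have "y \<odot> f d z \<in> Y" using less.hyps[of cs ds' y "f d z"] less.prems fB C2 by auto
        \<comment> \<open>Right multiplication by \<open>x\<close> is a derivation, so eigenvalues
          add under products; each summand has one factor fewer, which drives the induction.\<close>
        moreover have "f (c + d) (y \<odot> z) = f c y \<odot> z + y \<odot> f d z"
          by (simp add: f_def bracket_simps leibniz algebra_simps)
        ultimately have "f (c + d) (y \<odot> z) \<in> Y" using Yadd by simp
        then show ?thesis using Yf less.prems B by (auto dest: subalgebraD)
      qed
    qed
  qed
  have "subalgebra Y"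
    unfolding subalgebra_def using sY prod by (auto simp: Y_def)
  have YA': "Y \<inter> A' = A"
  proof
    have "y \<in> A" if "y \<in> A'" "fold f cs y \<in> A" for y cs
      using that
    proof (induction cs arbitrary: y)
      case (Cons c cs)
      then have "f c y \<in> A" using f_ideal[OF _ A'] by auto
      then show ?case using noeig Cons by (auto simp: f_def)
    qed auto
    then show "Y \<inter> A' \<subseteq> A" by (auto simp: Y_def)
    show "A \<subseteq> Y \<inter> A'" using AY AA' by blast
  qed
  define P where "P C \<longleftrightarrow> ideal_in C B \<and> A' \<subseteq> C \<and> C \<subseteq> Y \<boxplus> A'" for C
  have sYA: "subspace (Y \<boxplus> A')" by (intro subspace_boxplus sY sA')
  have "P A'" using A' sums_superset(2)[OF sY] by (auto simp: P_def)
  then obtain C where C: "P C" and mx: "\<And>C'. P C' \<Longrightarrow> dim C' \<le> dim C" using ex_max_dim[of P] by blast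
  have "C = B"
  proof (rule ccontr)
    assume "C \<noteq> B"
    then obtain C' where C': "ideal_in C' B" "C \<subset> C'" "dim C' = Suc (dim C)"
      using IH[of C] C unfolding P_def by blast
    then obtain c where c: "c \<in> C'" "c \<notin> C" by blast
    have sC: "subspace C" "subspace C'" using C C' by (auto simp: P_def dest: ideal_inD)
    have line: "C' = line C c" using sC C' c by (intro line_eqI) auto
    have "c \<odot> x \<in> line C c" using line c x ideal_inD[OF C'(1)] by auto
    then obtain k where "f k c \<in> C" using sC by (auto simp: mem_line f_def)
    then obtain y a where ya: "y \<in> Y" "a \<in> A'" "f k c = y + a"
      using C by (force simp: P_def mem_sums)
    \<comment> \<open>\<open>f k\<close> is injective, hence surjective, on \<open>A' / A\<close>;
      subtracting the preimage \<open>a2\<close> moves \<open>c\<close> into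
      \<open>Y\<close>.\<close>
    obtain a2 where a2: "a2 \<in> A'" "a - f k a2 \<in> A"
    proof (rule surj_mod[OF lin sA sA' _ _ _ ya(2)])
      show "f k ` A \<subseteq> A" "f k ` A' \<subseteq> A'" using f_ideal A A' by auto
      show "b \<in> A" if "b \<in> A'" "f k b \<in> A" for b using that noeig by (auto simp: f_def)
    qed
    have "f k (c - a2) = y + (a - f k a2)"
      using ya(3) f_add[of k "c - a2" a2] by (simp add: eq_diff_eq add_diff_eq)
    also have "\<dots> \<in> Y" using ya a2 AY Yadd by blast
    finally have "c - a2 \<in> Y"
      using Yf c a2 C' A'B sB by (meson ideal_inD(2) subset_eq subspace_diff)
    then have "c \<in> Y \<boxplus> A'" using a2 unfolding mem_sums by (intro bexI[of _ "c - a2"] bexI[of _ a2]) auto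
    then have "P C'" using C C' line line_least[OF sYA] by (auto simp: P_def)
    then show False using mx[of C'] C' by simp
  qed
  then have "B \<subseteq> Y \<boxplus> A'" using C by (auto simp: P_def)
  moreover have "Y \<boxplus> A' \<subseteq> B" by (intro sums_least sB YB A'B)
  ultimately show thesis using that \<open>subalgebra Y\<close> YA' by blast
qed

text \<open>Let \<open>A' / A\<close> be a minimal ideal factor. If
  \<open>A' \<inter> N \<subseteq> A\<close>, its dimension is one because \<open>N\<close> has
  codimension one. Otherwise \<open>N\<close> acts on the factor by scalars and the factor has zero
  product. An eigenvector of \<open>x\<close> then spans it; without one,
  \<open>split_complement\<close> yields a maximal subalgebra, whose codimension is the dimension of
  the factor and equals one by \<open>H\<close>.\<close>

lemma supersolvable_on_step:
  assumes B: "subalgebra B" and N: "ideal_in N B" and dimB: "dim B = Suc (dim N)"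
    and ssN: "supersolvable_on N"
    and H: "\<And>M. subalgebra M \<Longrightarrow> M \<subset> B \<Longrightarrow>
      (\<And>M'. subalgebra M' \<Longrightarrow> M \<subset> M' \<Longrightarrow> M' \<subseteq> B \<Longrightarrow> M' = B) \<Longrightarrow> dim B = Suc (dim M)"
  shows "supersolvable_on B"
proof -
  have sB: "subspace B" and sN: "subspace N" and NB: "N \<subseteq> B"
    using B N by (auto dest: subalgebraD ideal_inD)
  obtain x where x: "x \<in> B" "x \<notin> N" using NB dimB by (metis n_not_Suc_n subsetI subset_antisym)
  have line: "B = line N x" using x sN sB NB dimB by (intro line_eqI) auto
  have "\<exists>A'. ideal_in A' B \<and> A \<subset> A' \<and> dim A' = Suc (dim A)" if "ideal_in A B" "A \<noteq> B" for A
    using that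
  proof (induction "dim B - dim A" arbitrary: A rule: less_induct)
    case less
    note A = \<open>ideal_in A B\<close>
    note sA = ideal_inD(1)[OF A] and AB = ideal_inD(2)[OF A]
    define P where "P C \<longleftrightarrow> ideal_in C B \<and> A \<subset> C" for C
    have "P B" using A less.prems ideal_in_self[OF B] by (auto simp: P_def dest: ideal_inD)
    then obtain A' where PA': "P A'" and mn: "\<And>C. P C \<Longrightarrow> dim A' \<le> dim C" using ex_min_dim[of P] by blast
    then have A': "ideal_in A' B" and AA': "A \<subset> A'" by (auto simp: P_def)
    note sA' = ideal_inD(1)[OF A'] and A'B = ideal_inD(2)[OF A']
    have dimlt: "dim A < dim A'" using sA sA' AA' by (rule dim_psubset_subspace)
    have min: "C = A \<or> C = A'" if "ideal_in C B" "A \<subseteq> C" "C \<subseteq> A'" for C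
    proof (rule ccontr)
      assume "\<not> ?thesis"
      then have "P C" "C \<subset> A'" using that by (auto simp: P_def)
      then show False using mn dim_psubset_subspace[of C A'] that(1) sA'
        by (meson ideal_inD(1) not_less)
    qed
    have "dim A' = Suc (dim A)"
    proof (cases "A' \<inter> N \<subseteq> A")
      case True
      have "dim A' \<le> Suc (dim (A' \<inter> N))" using sN sB NB dimB sA' A'B by (rule dim_Int_codim_one)
      also have "\<dots> \<le> Suc (dim A)" using dim_subset[OF True] by simp
      finally show ?thesis using dimlt by simp
    next
      case False
      have "A \<boxplus> (A' \<inter> N) = A \<or> A \<boxplus> (A' \<inter> N) = A'"
        using A A' N B AA' sA sA' sN
        by (intro min ideal_in_sums ideal_in_Int sums_superset sums_least subspace_inter) auto
      moreover have "A' \<inter> N \<subseteq> A \<boxplus> (A' \<inter> N)" using sA by (rule sums_superset)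
      ultimately have sumA': "A' = A \<boxplus> (A' \<inter> N)" using False by auto
      have subN: "subalgebra N" using N by (rule ideal_in_subalgebra)
      obtain v lam where v: "v \<in> A' \<inter> N" "v \<notin> A \<inter> N" and lam': "\<And>n. n \<in> N \<Longrightarrow> v \<odot> n - lam n *s v \<in> A \<inter> N"
      proof (rule supersolvable_on_weight[OF subN ssN])
        show "ideal_in (A \<inter> N) N" "ideal_in (A' \<inter> N) N"
          using A A' subN NB by (auto intro: ideal_in_restrict)
        show "\<not> A' \<inter> N \<subseteq> A \<inter> N" using False by auto
      qed blast
      have vA: "v \<notin> A" and lam: "\<And>n. n \<in> N \<Longrightarrow> v \<odot> n - lam n *s v \<in> A" using v lam' by auto
      have lam0: "lam (x \<odot> n) = 0" if "n \<in> N" for n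
        using weight_bracket_zero[OF sA _ _ _ vA lam that, of x] x that ideal_inD[OF A] ideal_inD[OF N] NB
        by blast
      \<comment> \<open>The weight space of \<open>lam\<close> on \<open>A' / A\<close>. It is
        stable under \<open>x\<close> because \<open>lam\<close> vanishes on the products
        \<open>x \<odot> n\<close>; so it is an ideal, and minimality makes it all of
        \<open>A'\<close>.\<close>
      define L where "L = {a\<in>A'. \<forall>n\<in>N. a \<odot> n - lam n *s a \<in> A}"
      have sL: "subspace L"
      proof (rule subspaceI)
        show "0 \<in> L" by (simp add: L_def bracket_simps subspace_0 sA sA')
        fix a b c assume a: "a \<in> L" and b: "b \<in> L"
        have "(a + b) \<odot> n - lam n *s (a + b) = (a \<odot> n - lam n *s a) + (b \<odot> n - lam n *s b)" for n
          by (simp add: bracket_simps algebra_simps)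
        then show "a + b \<in> L" using a b by (auto simp: L_def intro!: subspace_add sA sA')
        have "(c *s a) \<odot> n - lam n *s (c *s a) = c *s (a \<odot> n - lam n *s a)" for n
          by (simp add: bracket_simps algebra_simps)
        then show "c *s a \<in> L" using a by (auto simp: L_def intro!: subspace_scale sA sA')
      qed
      have AL: "A \<subseteq> L" using AA' sA ideal_inD[OF A] NB
        by (auto simp: L_def intro!: subspace_diff subspace_scale)
      have Lx: "a \<odot> x \<in> L" if a: "a \<in> L" for a
      proof -
        have "(a \<odot> x) \<odot> n - lam n *s (a \<odot> x) \<in> A" if n: "n \<in> N" for n
        proof -
          have "x \<odot> n \<in> N" using n x ideal_inD[OF N] by auto
          then have "a \<odot> (x \<odot> n) \<in> A" using a lam0[OF n] by (force simp: L_def)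
          moreover have "(a \<odot> n - lam n *s a) \<odot> x \<in> A" using a n x ideal_inD[OF A] by (auto simp: L_def)
          ultimately have "a \<odot> (x \<odot> n) + (a \<odot> n - lam n *s a) \<odot> x \<in> A" by (rule subspace_add[OF sA])
          then show ?thesis by (simp add: bracket_simps leibniz algebra_simps)
        qed
        then show ?thesis using a x ideal_inD[OF A'] by (auto simp: L_def)
      qed
      have Ln: "a \<odot> n \<in> L" if a: "a \<in> L" and n: "n \<in> N" for a n
      proof -
        have "a \<odot> n - lam n *s a \<in> L" using a n AL by (auto simp: L_def)
        then have "(a \<odot> n - lam n *s a) + lam n *s a \<in> L" using a sL by (intro subspace_add subspace_scale)
        then show ?thesis by simp
      qed
      have dec: "\<exists>n k. n \<in> N \<and> y = n + k *s x" if "y \<in> B" for y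
        using that line mem_line[OF sN] by (metis diff_add_cancel)
      have LB: "a \<odot> y \<in> L" if "a \<in> L" "y \<in> B" for a y
        using dec[OF that(2)] that Lx Ln sL by (auto simp: bracket_simps intro!: subspace_add subspace_scale)
      have "ideal_in L B"
        using LB AL by (intro right_invariant_ideal[OF B A A' _ min sL]) (use AA' in \<open>auto simp: L_def\<close>)
      then have "L = A \<or> L = A'" using AL by (intro min) (auto simp: L_def)
      moreover have "v \<in> L" using v lam by (auto simp: L_def)
      ultimately have "L = A'" using vA by blast
      then have scal: "a \<odot> n - lam n *s a \<in> A" if "a \<in> A'" "n \<in> N" for a n using that by (auto simp: L_def)
      \<comment> \<open>For \<open>a \<in> A\<close> the product \<open>v \<odot> a\<close> is in
        \<open>A\<close> and the weight vanishes at once. Otherwise \<open>a\<close> is an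
        eigenvector of its own right multiplication, and \<open>a \<odot> (a \<odot> a) = 0\<close>
        forces \<open>lam a * lam a = 0\<close>.\<close>
      have lamA: "lam a = 0" if a: "a \<in> A' \<inter> N" for a
      proof (rule ccontr)
        assume nz: "lam a \<noteq> 0"
        have aB: "a \<in> B" using a NB by auto
        show False
        proof (cases "a \<in> A")
          case True
          then have "v \<odot> a \<in> A" using v NB ideal_inD[OF A] by auto
          then have "v \<odot> a - (v \<odot> a - lam a *s v) \<in> A" using a by (intro subspace_diff[OF sA] lam) auto
          then have "lam a *s v \<in> A" by simp
          then show False using vA nz subspace_scale[OF sA, of "lam a *s v" "inverse (lam a)"] by simp
        next
          case False
          have s: "a \<odot> a - lam a *s a \<in> A" using scal a by auto
          then have "a \<odot> (a \<odot> a - lam a *s a) \<in> A" using aB ideal_inD[OF A] by auto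
          then have 1: "- (lam a *s (a \<odot> a)) \<in> A" by (simp add: bracket_simps bracket_square_zero)
          have "lam a *s (a \<odot> a - lam a *s a) + - (lam a *s (a \<odot> a)) \<in> A"
            using s 1 by (intro subspace_add subspace_scale sA)
          then have "- ((lam a * lam a) *s a) \<in> A" by (simp add: algebra_simps)
          from subspace_scale[OF sA this, of "- inverse (lam a * lam a)"]
          show False using False nz by (simp add: field_simps)
        qed
      qed
      have ab: "a \<odot> a' \<in> A" if a: "a \<in> A'" "a' \<in> A'" for a a'
      proof -
        obtain c n where cn: "c \<in> A" "n \<in> A' \<inter> N" "a' = c + n"
          using a(2) sumA' by (metis mem_sums)
        have "a \<odot> n \<in> A" using scal[of a n] a cn lamA[of n] by auto
        moreover have "a \<odot> c \<in> A" using a cn A'B ideal_inD[OF A] by auto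
        ultimately show ?thesis using cn sA by (simp add: bracket_simps subspace_add)
      qed
      show ?thesis
      proof (cases "\<exists>w c. w \<in> A' \<and> w \<notin> A \<and> w \<odot> x - c *s w \<in> A")
        case True
        then obtain w c where w: "w \<in> A'" "w \<notin> A" "w \<odot> x - c *s w \<in> A" by blast
        have "ideal_in (line A w) B"
        proof (rule right_invariant_ideal[OF B A A' _ min subspace_line])
          show "A \<subseteq> A'" "A \<subseteq> line A w" "line A w \<subseteq> A'"
            using AA' w line_superset line_least[OF sA'] by auto
          have wl: "w \<in> line A w" by (rule line_self)
          have red: "w \<odot> u \<in> line A w" if "w \<odot> u - k *s w \<in> A" for u k
            using that by (auto simp: mem_line[OF sA])
          have wy: "w \<odot> y \<in> line A w" if "y \<in> B" for y
          proof -
            obtain n k where nk: "n \<in> N" "y = n + k *s x" using dec[OF \<open>y \<in> B\<close>] by blast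
            have "w \<odot> n \<in> line A w" using scal w(1) nk red by blast
            moreover have "w \<odot> x \<in> line A w" using w red by blast
            ultimately show ?thesis using nk by (simp add: bracket_simps subspace_add subspace_scale subspace_line)
          qed
          fix u y assume u: "u \<in> line A w" and y: "y \<in> B"
          then obtain k where k: "u - k *s w \<in> A" by (auto simp: mem_line[OF sA])
          have "(u - k *s w) \<odot> y \<in> line A w" using k y ideal_inD[OF A] line_superset by blast
          then have "(u - k *s w) \<odot> y + k *s (w \<odot> y) \<in> line A w"
            using wy[OF y] by (intro subspace_add subspace_scale subspace_line)
          then show "u \<odot> y \<in> line A w" by (simp add: bracket_simps)
        qed
        then have "line A w = A \<or> line A w = A'"
          using w AA' line_superset line_least[OF sA'] by (intro min) auto
        then have "A' = line A w" using w line_self by blast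
        then show ?thesis using dim_line[OF sA w(2)] by simp
      next
        case False
        obtain Y where Y: "subalgebra Y" "Y \<inter> A' = A" "B = Y \<boxplus> A'"
        proof (rule split_complement[OF B A A' AA' x(1) ab])
          show "w \<in> A" if "w \<in> A'" "w \<odot> x - c *s w \<in> A" for w c using False that by blast
          show "\<exists>C'. ideal_in C' B \<and> C \<subset> C' \<and> dim C' = Suc (dim C)"
            if "ideal_in C B" "A' \<subseteq> C" "C \<noteq> B" for C
          proof (rule less.hyps[OF _ that(1,3)])
            have "dim A' \<le> dim C" using that(2) by (rule dim_subset)
            moreover have "dim C < dim B" using that sB by (intro dim_psubset_subspace) (auto dest: ideal_inD)
            ultimately show "dim B - dim C < dim B - dim A" using dimlt by simp
          qed
        qed
        note sY = subalgebraD(1)[OF Y(1)]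
        have YB: "Y \<subseteq> B" using sums_superset(1)[OF sA'] Y by blast
        \<comment> \<open>\<open>Y\<close> is maximal: for a larger \<open>M\<close>, the set
          \<open>M \<inter> A'\<close> is an ideal of \<open>B\<close> since \<open>A'\<close>
          multiplies itself into \<open>A\<close> and \<open>Y\<close> lies in \<open>M\<close>;
          minimality of the factor leaves only \<open>A' \<subseteq> M\<close>, so
          \<open>M = B\<close>.\<close>
        have "dim B = Suc (dim Y)"
        proof (rule H[OF Y(1)])
          show "Y \<subset> B" using YB Y AA' A'B by blast
          fix M assume M: "subalgebra M" "Y \<subset> M" "M \<subseteq> B"
          note sM = subalgebraD(1)[OF M(1)]
          have "ideal_in (M \<inter> A') B"
            unfolding ideal_in_def
          proof (intro conjI ballI)
            show "subspace (M \<inter> A')" by (intro subspace_inter sM sA')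
            show "M \<inter> A' \<subseteq> B" using M by auto
            fix m y assume m: "m \<in> M \<inter> A'" and y: "y \<in> B"
            obtain u a where ua: "u \<in> Y" "a \<in> A'" "y = u + a" using y Y by (auto simp: mem_sums)
            have "m \<odot> a \<in> M \<inter> A'" "a \<odot> m \<in> M \<inter> A'" using ab m ua Y M by blast+
            moreover have "m \<odot> u \<in> M \<inter> A'" "u \<odot> m \<in> M \<inter> A'"
              using m ua M YB ideal_inD[OF A'] subalgebraD(2)[OF M(1)] by blast+
            ultimately show "y \<odot> m \<in> M \<inter> A'" "m \<odot> y \<in> M \<inter> A'"
              using ua by (auto simp: bracket_simps intro!: subspace_add sM sA')
          qed
          then have "M \<inter> A' = A \<or> M \<inter> A' = A'" using Y M by (intro min) auto
          moreover have "M \<inter> A' \<noteq> A"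
          proof
            assume eq: "M \<inter> A' = A"
            obtain m where m: "m \<in> M" "m \<notin> Y" using M by blast
            then obtain u a where ua: "u \<in> Y" "a \<in> A'" "m = u + a" using M Y by (force simp: mem_sums)
            then have "m - u \<in> M" using m M sM by (intro subspace_diff) auto
            then have "a \<in> M \<inter> A'" using ua by simp
            then have "a \<in> Y" using eq Y by blast
            then show False using m ua sY by (simp add: subspace_add)
          qed
          ultimately have "A' \<subseteq> M" by blast
          then have "B \<subseteq> M" using Y M sM by (metis psubset_imp_subset sums_least)
          then show "M = B" using M by blast
        qed
        then show ?thesis using dim_sums[OF sY sA'] Y by simp
      qed
    qed
    then show ?case using A' AA' by blast
  qed
  then show ?thesis by (auto simp: supersolvable_on_def)
qed

text \<open>Codimension one is asked of the maximal inclusions between all subalgebras of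
  \<open>B\<close>, so that the terms of the chain inherit the hypothesis.\<close>

lemma polycyclic_supersolvable_on:
  assumes "polycyclic B"
    and "\<And>M M'. subalgebra M \<Longrightarrow> subalgebra M' \<Longrightarrow> M \<subset> M' \<Longrightarrow> M' \<subseteq> B \<Longrightarrow>
      (\<And>C. subalgebra C \<Longrightarrow> M \<subset> C \<Longrightarrow> C \<subseteq> M' \<Longrightarrow> C = M') \<Longrightarrow> dim M' = Suc (dim M)"
  shows "supersolvable_on B"
  using assms
proof (induction rule: polycyclic.induct)
  case zero
  have "A = {0}" if "ideal_in A {0}" for A
    using ideal_inD(1,2)[OF that] subspace_0 by blast
  then show ?case unfolding supersolvable_on_def by blast
next
  case (step N B)
  have NB: "N \<subseteq> B" using step by (auto dest: ideal_inD)
  have "supersolvable_on N" using step.IH step.prems NB by (metis subset_trans)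
  then show ?case
    using supersolvable_on_step[OF step(2,3,4)] step.prems step(2) by blast
qed

lemma supersolvable_on_UNIV:
  assumes "supersolvable_on UNIV"
  shows "supersolvable"
proof -
  let ?n = "dim UNIV"
  have "\<exists>C :: nat \<Rightarrow> 'v set. C 0 = {0} \<and> (\<forall>i<k. C i \<subset> C (Suc i)) \<and> (\<forall>i\<le>k. ideal_in (C i) UNIV \<and> dim (C i) = i)"
    if "k \<le> ?n" for k
    using that
  proof (induction k)
    case 0
    then show ?case
      by (intro exI[of _ "\<lambda>_. {0}"]) (auto simp: ideal_in_zero subalgebra_UNIV)
  next
    case (Suc k)
    then obtain C where C: "C 0 = {0}" "\<forall>i<k. C i \<subset> C (Suc i)" "\<forall>i\<le>k. ideal_in (C i) UNIV \<and> dim (C i) = i"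
      by auto
    then have "C k \<noteq> UNIV" using Suc.prems by auto
    then obtain A where A: "ideal_in A UNIV" "C k \<subset> A" "dim A = Suc k"
      using assms C unfolding supersolvable_on_def by (metis order_refl)
    define C' where "C' = C(Suc k := A)"
    have C'S: "C' (Suc k) = A" and C'i: "\<And>i. i \<le> k \<Longrightarrow> C' i = C i" by (auto simp: C'_def)
    have "C' i \<subset> C' (Suc i)" if "i < Suc k" for i
      using that A C(2) C'S C'i[of i] C'i[of "Suc i"] by (cases "i = k") auto
    moreover have "ideal_in (C' i) UNIV \<and> dim (C' i) = i" if "i \<le> Suc k" for i
      using that A C(3) C'S C'i[of i] by (cases "i = Suc k") auto
    moreover have "C' 0 = {0}" using C(1) C'i[of 0] by simp
    ultimately show ?case by (intro exI[of _ C'] conjI allI impI) simp_all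
  qed
  from this[OF order_refl] obtain C :: "nat \<Rightarrow> 'v set" where C: "C 0 = {0}" "\<forall>i<?n. C i \<subset> C (Suc i)"
    "\<forall>i\<le>?n. ideal_in (C i) UNIV \<and> dim (C i) = i" by (elim exE conjE)
  have "C ?n = UNIV" using C(3) by (intro subspace_dim_equal) (auto dest: ideal_inD)
  then show ?thesis unfolding supersolvable_def
    using C \<open>C ?n = UNIV\<close> unfolding ideal_in_def ideal_def
    by (intro exI[of _ ?n] exI[of _ C]) (simp add: Ball_def)
qed

end

section \<open>Rank functions on the subalgebra lattice\<close>

text \<open>Vanishing squares characterise Lie algebras among Leibniz algebras by
  \<open>lie_algebra_iff\<close>; this is the version relative to a subalgebra.\<close>

definition (in bilinear_algebra) lie_on :: "'v set \<Rightarrow> bool"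
  where "lie_on B \<longleftrightarrow> (\<forall>x\<in>B. x \<odot> x = 0)"

text \<open>Modulo \<open>V\<close>, the plane \<open>X\<close> contains the three distinct lines \<open>S\<close>, \<open>T\<close> and \<open>C\<close>.\<close>

definition (in bilinear_algebra) crossed :: "('v set \<Rightarrow> nat) \<Rightarrow> 'v set \<Rightarrow> 'v set \<Rightarrow> 'v set \<Rightarrow> 'v set \<Rightarrow> bool"
  where "crossed rk V S N T \<longleftrightarrow> subalgebra T \<and> V \<subseteq> T \<and> T \<subseteq> N \<and> rk T = Suc (rk V) \<and>
    (\<exists>C X. subalgebra C \<and> V \<subseteq> C \<and> C \<subseteq> X \<and> rk C = Suc (rk V) \<and> C \<noteq> S \<and> C \<noteq> T \<and>
      subalgebra X \<and> S \<subseteq> X \<and> T \<subseteq> X \<and> rk X \<le> rk V + 2)"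

text \<open>The assumptions are what the chain of ideals of a supersolvable algebra says in terms of its
  lattice of subalgebras; they hold there for the dimension and pass to isomorphic lattices. The last
  one provides a second complement of the line \<open>S\<close> between \<open>V\<close> and \<open>U\<close>.\<close>

locale subalgebra_rank = leibniz_fd +
  fixes rk :: "'b set \<Rightarrow> nat"
  assumes rk_zero: "rk {0} = 0"
    and rk_strict: "subalgebra A \<Longrightarrow> subalgebra B \<Longrightarrow> A \<subset> B \<Longrightarrow> rk A < rk B"
    and rk_cover: "subalgebra A \<Longrightarrow> subalgebra B \<Longrightarrow> A \<subset> B \<Longrightarrow>
      (\<And>C. subalgebra C \<Longrightarrow> A \<subset> C \<Longrightarrow> C \<subseteq> B \<Longrightarrow> C = B) \<Longrightarrow> rk B = Suc (rk A)"
    and rk_chain: "subalgebra A \<Longrightarrow> subalgebra U \<Longrightarrow> A \<subseteq> U \<Longrightarrow>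
      \<exists>(R :: nat \<Rightarrow> 'b set) k. R 0 = A \<and> R k = U \<and>
        (\<forall>i<k. R i \<subseteq> R (Suc i) \<and> rk (R (Suc i)) \<le> Suc (rk (R i))) \<and>
        (\<forall>i\<le>k. subalgebra (R i) \<and> (\<forall>B. subalgebra B \<and> A \<subseteq> B \<and> B \<subseteq> U \<longrightarrow>
          (\<exists>X. subalgebra X \<and> R i \<subseteq> X \<and> B \<subseteq> X \<and> X \<subseteq> U \<and> rk X + rk A \<le> rk (R i) + rk B)))"
    and rk_three: "subalgebra U \<Longrightarrow> subalgebra V \<Longrightarrow> V \<subseteq> U \<Longrightarrow> rk U = rk V + 3 \<Longrightarrow>
      \<exists>S. subalgebra S \<and> V \<subseteq> S \<and> S \<subseteq> U \<and> rk S = Suc (rk V) \<and>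
        (\<forall>B. subalgebra B \<and> V \<subseteq> B \<and> B \<subseteq> U \<longrightarrow>
          (\<exists>X. subalgebra X \<and> S \<subseteq> X \<and> B \<subseteq> X \<and> X \<subseteq> U \<and> rk X \<le> Suc (rk B))) \<and>
        (\<forall>N T1 T2. subalgebra N \<and> V \<subseteq> N \<and> N \<subseteq> U \<and> rk N = rk V + 2 \<and> lie_on N \<and> \<not> S \<subseteq> N \<and>
          T1 \<noteq> T2 \<and> crossed rk V S N T1 \<and> crossed rk V S N T2 \<longrightarrow>
          (\<exists>A. subalgebra A \<and> V \<subseteq> A \<and> A \<subseteq> U \<and> rk A = rk V + 2 \<and> A \<noteq> N \<and> \<not> S \<subseteq> A))"
begin

lemma rk_mono: "subalgebra A \<Longrightarrow> subalgebra B \<Longrightarrow> A \<subseteq> B \<Longrightarrow> rk A \<le> rk B"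
  by (metis less_imp_le order_refl psubsetI rk_strict)

lemma rk_eqI: "subalgebra A \<Longrightarrow> subalgebra B \<Longrightarrow> A \<subseteq> B \<Longrightarrow> rk B \<le> rk A \<Longrightarrow> A = B"
  by (metis leD psubsetI rk_strict)

text \<open>Along a maximal chain of subalgebras each step raises the rank by exactly one and the
  dimension by at least one. Excluding strict inequality for non-Lie subalgebras is the purpose of
  the later sections.\<close>

lemma rk_diff_le_dim_diff:
  assumes "subalgebra A" "subalgebra B" "A \<subseteq> B"
  shows "rk B + dim A \<le> rk A + dim B"
  using assms(2,3)
proof (induction "dim B" arbitrary: B rule: less_induct)
  case less
  show ?case
  proof (cases "A = B")
    case False
    define P where "P M \<longleftrightarrow> subalgebra M \<and> A \<subseteq> M \<and> M \<subset> B" for M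
    have "P A" using assms False less by (auto simp: P_def)
    then obtain M where M: "P M" and mx: "\<And>C. P C \<Longrightarrow> dim C \<le> dim M" using ex_max_dim[of P] by blast
    have "rk B = Suc (rk M)"
    proof (rule rk_cover)
      show "subalgebra M" "subalgebra B" "M \<subset> B" using M less by (auto simp: P_def)
      fix C assume C: "subalgebra C" "M \<subset> C" "C \<subseteq> B"
      show "C = B"
      proof (rule ccontr)
        assume "C \<noteq> B"
        then have "P C" using C M by (auto simp: P_def)
        then show False using mx[of C] dim_psubset_subspace[of M C] C M
          by (auto simp: P_def dest!: subalgebraD(1))
      qed
    qed
    moreover have d: "dim M < dim B"
      using M less by (intro dim_psubset_subspace) (auto simp: P_def dest!: subalgebraD(1))
    moreover have "rk M + dim A \<le> rk A + dim M" using less.hyps[OF d] M by (auto simp: P_def)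
    ultimately show ?thesis by linarith
  qed simp
qed

lemma rk_codim_one:
  assumes "subalgebra A" "subalgebra B" "A \<subseteq> B" "dim B = Suc (dim A)"
  shows "rk B = Suc (rk A)"
proof -
  have "A \<subset> B" using assms by auto
  then have "rk A < rk B" using assms by (intro rk_strict)
  then show ?thesis using rk_diff_le_dim_diff[OF assms(1,2,3)] assms(4) by linarith
qed

lemma polycyclic_rk: "polycyclic B \<Longrightarrow> rk B = dim B"
proof (induction rule: polycyclic.induct)
  case (step N B)
  then show ?case using rk_codim_one[of N B] by (auto dest: ideal_inD ideal_in_subalgebra)
qed (simp add: rk_zero)

lemma polycyclic_imp_supersolvable_on: "polycyclic B \<Longrightarrow> supersolvable_on B"
proof (rule polycyclic_supersolvable_on)
  fix M M'
  assume B: "polycyclic B" and M: "subalgebra M" "subalgebra M'" "M \<subset> M'" "M' \<subseteq> B"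
    and mx: "\<And>C. subalgebra C \<Longrightarrow> M \<subset> C \<Longrightarrow> C \<subseteq> M' \<Longrightarrow> C = M'"
  have "polycyclic M" "polycyclic M'" using polycyclic_mono[OF B] M by auto
  then show "dim M' = Suc (dim M)" using rk_cover[OF M(1,2,3) mx] polycyclic_rk by auto
qed

end

text \<open>Divided differences: three distinct roots would force \<open>d = 0\<close>, then
  \<open>b = 0\<close>, then \<open>a = 0\<close>.\<close>

lemma (in leibniz_fd) finite_quadratic_roots:
  assumes "a \<noteq> 0"
  shows "finite {c. a + c *s b + (c * c) *s d = 0}"
proof (rule ccontr)
  let ?S = "{c. a + c *s b + (c * c) *s d = 0}"
  assume inf: "infinite ?S"
  obtain c where c: "c \<in> ?S" using infinite_imp_nonempty[OF inf] by blast
  have inf1: "infinite (?S - {c})" using inf by (rule infinite_remove)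
  obtain e where e: "e \<in> ?S - {c}" using infinite_imp_nonempty[OF inf1] by blast
  obtain f where f: "f \<in> ?S - {c} - {e}"
    using infinite_imp_nonempty[OF infinite_remove[OF inf1]] by blast
  have two: "b = - ((c + x) *s d)" if x: "x \<in> ?S" "x \<noteq> c" for x
  proof -
    have "(c - x) *s (b + (c + x) *s d) = (a + c *s b + (c * c) *s d) - (a + x *s b + (x * x) *s d)"
      by (simp add: algebra_simps)
    also have "\<dots> = 0" using c x by simp
    finally have "b + (c + x) *s d = 0" using x by simp
    then show ?thesis by (simp add: eq_neg_iff_add_eq_0)
  qed
  have "- ((c + e) *s d) = - ((c + f) *s d)" using two[of e] two[of f] e f by auto
  then have "(c + e) *s d = (c + f) *s d" by simp
  then have "d = 0" using f by (auto simp: scale_cancel_right)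
  then have "b = 0" using two[of e] e by auto
  then show False using c \<open>d = 0\<close> assms by simp
qed

lemma (in leibniz_fd) lie_on_anti:
  assumes "lie_on B" "subspace B" "x \<in> B" "y \<in> B"
  shows "x \<odot> y = - (y \<odot> x)"
proof -
  have "(x + y) \<odot> (x + y) = 0" "x \<odot> x = 0" "y \<odot> y = 0"
    using assms by (auto simp: lie_on_def subspace_add)
  then show ?thesis by (simp add: bracket_simps eq_neg_iff_add_eq_0 add.commute)
qed

lemma (in leibniz_fd) mem_scaleD: "subspace A \<Longrightarrow> k *s x \<in> A \<Longrightarrow> k \<noteq> 0 \<Longrightarrow> x \<in> A"
  using subspace_scale[of A "k *s x" "inverse k"] by simp

lemma (in leibniz_fd) mem_divide_coeff:
  assumes "subspace A" "k *s x - l *s u \<in> A" "k \<noteq> 0"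
  shows "x - (l / k) *s u \<in> A"
proof (rule mem_scaleD[OF assms(1)])
  show "k *s (x - (l / k) *s u) \<in> A" using assms by (simp add: scale_right_diff_distrib)
qed (rule assms)

text \<open>Three pairwise independent eigenvectors in a plane share their eigenvalue; the plane is
  spanned by \<open>u\<close> and \<open>x\<close> modulo \<open>A\<close>. Two eigenvectors would
  not suffice, which is why \<open>NL_dense\<close> supplies two new points besides
  \<open>u\<close>.\<close>

lemma (in leibniz_fd) scalar_mod:
  assumes A: "subspace A" and f: "Vector_Spaces.linear scale scale f" and fA: "f ` A \<subseteq> A" and u: "u \<notin> A"
    and e: "f u - a *s u \<in> A"
    and e1: "f (u + c1 *s x) - a1 *s (u + c1 *s x) \<in> A"
    and e2: "f (u + c2 *s x) - a2 *s (u + c2 *s x) \<in> A"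
    and c: "c1 \<noteq> c2" "c1 \<noteq> 0" "c2 \<noteq> 0"
  shows "f x - a *s x \<in> A"
proof -
  have lin: "f (y + z) = f y + f z" "f (k *s y) = k *s f y" for y z k
    using f by (auto simp: linear_iff_local)
  show ?thesis
  proof (cases "\<exists>k. x - k *s u \<in> A")
    case True
    then obtain k where k: "x - k *s u \<in> A" by blast
    have fx: "f x = f (x - k *s u) + k *s f u" using lin(1)[of "x - k *s u" "k *s u"] lin(2) by simp
    have "f (x - k *s u) - a *s (x - k *s u) + k *s (f u - a *s u) \<in> A"
      using k fA by (intro subspace_add[OF A subspace_diff[OF A _ subspace_scale[OF A k]] subspace_scale[OF A e]]) auto
    then show ?thesis by (simp add: fx algebra_simps)
  next
    case False
    have g1: "c1 *s f x - (a1 - a) *s u - (a1 * c1) *s x \<in> A"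
      using subspace_diff[OF A e1 e] by (simp add: lin algebra_simps)
    have g2: "c2 *s f x - (a2 - a) *s u - (a2 * c2) *s x \<in> A"
      using subspace_diff[OF A e2 e] by (simp add: lin algebra_simps)
    \<comment> \<open>Eliminating \<open>f x\<close> leaves a relation between \<open>x\<close> and
      \<open>u\<close>, which are independent modulo \<open>A\<close>, so its coefficients
      vanish.\<close>
    have h: "(c1 * c2 * (a2 - a1)) *s x - (c2 * (a1 - a) - c1 * (a2 - a)) *s u \<in> A"
      using subspace_diff[OF A subspace_scale[OF A g1, of c2] subspace_scale[OF A g2, of c1]]
      by (simp add: algebra_simps)
    have a12: "a1 = a2"
    proof (rule ccontr)
      assume "a1 \<noteq> a2"
      then have "c1 * c2 * (a2 - a1) \<noteq> 0" using c by simp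
      then have "x - ((c2 * (a1 - a) - c1 * (a2 - a)) / (c1 * c2 * (a2 - a1))) *s u \<in> A"
        using mem_divide_coeff[OF A h] by simp
      then show False using False by blast
    qed
    have "((c2 - c1) * (a1 - a)) *s u \<in> A"
      using subspace_neg[OF A h] a12 by (simp add: algebra_simps)
    then have "a1 = a"
      using u c mem_scaleD[OF A, of "(c2 - c1) * (a1 - a)" u] by (cases "(c2 - c1) * (a1 - a) = 0") auto
    then have "c1 *s (f x - a *s x) \<in> A" using g1 by (simp add: algebra_simps)
    from subspace_scale[OF A this, of "inverse c1"] show ?thesis using c by simp
  qed
qed

section \<open>The induction step: a non-Lie subalgebra and its Leibniz kernel\<close>

locale nonlie_step = subalgebra_rank +
  fixes U
  assumes U: "subalgebra U" and nonlie: "\<not> lie_on U"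
    and IH: "subalgebra V \<Longrightarrow> V \<subset> U \<Longrightarrow> \<not> lie_on V \<Longrightarrow> polycyclic V"
begin

text \<open>The Leibniz kernel: left multiplications annihilate it (\<open>J_null\<close>), and
  products anticommute modulo it (\<open>sym_J\<close>).\<close>

definition J where "J = span {x \<odot> x | x. x \<in> U}"

lemma sU: "subspace U" using U by (rule subalgebraD)

lemma UU: "x \<in> U \<Longrightarrow> y \<in> U \<Longrightarrow> x \<odot> y \<in> U" using U by (rule subalgebraD)

lemma sJ: "subspace J" by (simp add: J_def)

lemma square_J: "x \<in> U \<Longrightarrow> x \<odot> x \<in> J"
  unfolding J_def by (rule span_base) auto

lemma sym_J: "x \<in> U \<Longrightarrow> y \<in> U \<Longrightarrow> x \<odot> y + y \<odot> x \<in> J"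
proof -
  assume x: "x \<in> U" "y \<in> U"
  have "(x + y) \<odot> (x + y) - x \<odot> x - y \<odot> y \<in> J"
    using x by (intro subspace_diff sJ square_J subspace_add sU)
  then show ?thesis by (simp add: bracket_simps algebra_simps)
qed

lemma J_null: "j \<in> J \<Longrightarrow> x \<odot> j = 0"
  unfolding J_def
  by (induction rule: span_induct_alt) (auto simp: bracket_simps bracket_square_zero)

lemma J_ideal: "ideal_in J U"
  unfolding J_def
proof (rule ideal_in_span[OF U])
  show "{x \<odot> x |x. x \<in> U} \<subseteq> U" using UU by auto
  fix g x assume "g \<in> {x \<odot> x |x. x \<in> U}" and x: "x \<in> U"
  then obtain y where y: "g = y \<odot> y" "y \<in> U" by blast
  show "x \<odot> g \<in> span {x \<odot> x |x. x \<in> U}" by (simp add: y bracket_square_zero span_zero)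
  have "g \<odot> x = (y \<odot> x) \<odot> y + y \<odot> (y \<odot> x)" by (simp add: y leibniz)
  then show "g \<odot> x \<in> span {x \<odot> x |x. x \<in> U}"
    using sym_J[of "y \<odot> x" y] UU x y by (simp add: J_def)
qed

lemma JU: "J \<subseteq> U" using J_ideal by (rule ideal_inD)

lemma J_subalgebra: "subalgebra J" using J_ideal by (rule ideal_in_subalgebra)

lemma J_ne_U: "J \<noteq> U" using J_null nonlie by (auto simp: lie_on_def)

lemma J_polycyclic: "polycyclic J"
  using polycyclic_above_brackets[OF polycyclic.zero J_subalgebra] J_null sJ subspace_0 by auto

text \<open>Products anticommute modulo \<open>J\<close>, so stability on one side implies stability
  on the other for subspaces above \<open>J\<close>.\<close>

lemma ideal_aboveI:
  assumes "subspace W" "J \<subseteq> W" "W \<subseteq> U" "\<And>w x. w \<in> W \<Longrightarrow> x \<in> U \<Longrightarrow> w \<odot> x \<in> W"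
  shows "ideal_in W U"
proof -
  have "x \<odot> w \<in> W" if "w \<in> W" "x \<in> U" for w x
  proof -
    have "(x \<odot> w + w \<odot> x) - w \<odot> x \<in> W"
      using sym_J[of x w] assms that by (intro subspace_diff) auto
    then show ?thesis by simp
  qed
  then show ?thesis using assms by (auto simp: ideal_in_def)
qed

lemma ideal_aboveI':
  assumes "subspace W" "J \<subseteq> W" "W \<subseteq> U" "\<And>w x. w \<in> W \<Longrightarrow> x \<in> U \<Longrightarrow> x \<odot> w \<in> W"
  shows "ideal_in W U"
proof -
  have "w \<odot> x \<in> W" if "w \<in> W" "x \<in> U" for w x
  proof -
    have "(x \<odot> w + w \<odot> x) - x \<odot> w \<in> W"
      using sym_J[of x w] assms that by (intro subspace_diff) auto
    then show ?thesis by simp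
  qed
  then show ?thesis using assms by (auto simp: ideal_in_def)
qed

lemma line_subalgebra:
  assumes A: "subalgebra A" "J \<subseteq> A" "A \<subseteq> U" and x: "x \<in> U"
    and xa: "\<And>a. a \<in> A \<Longrightarrow> x \<odot> a \<in> line A x"
  shows "subalgebra (line A x)"
  unfolding subalgebra_def
proof (intro conjI ballI subspace_line)
  note sA = subalgebraD(1)[OF A(1)] and sL = subspace_line[of A x]
  fix u v assume "u \<in> line A x" "v \<in> line A x"
  then obtain k l where k: "u - k *s x \<in> A" and l: "v - l *s x \<in> A" by (auto simp: mem_line sA)
  let ?a = "u - k *s x" and ?b = "v - l *s x"
  have ax: "?a \<odot> x \<in> line A x"
  proof -
    have "(?a \<odot> x + x \<odot> ?a) - x \<odot> ?a \<in> line A x"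
      using sym_J[of ?a x] k x A xa[OF k] line_superset[of A x] by (intro subspace_diff sL) auto
    then show ?thesis by simp
  qed
  have xx: "x \<odot> x \<in> line A x" using square_J[OF x] A line_superset by blast
  have ab: "?a \<odot> ?b \<in> line A x" using subalgebraD(2)[OF A(1) k l] line_superset by blast
  have "u \<odot> v = ?a \<odot> ?b + l *s (?a \<odot> x) + k *s (x \<odot> ?b) + (k * l) *s (x \<odot> x)"
    by (simp add: bracket_simps algebra_simps)
  then show "u \<odot> v \<in> line A x" using ab ax xa[OF l] xx sL by (simp only: subspace_add subspace_scale)
qed

lemma line_ideal_subalgebra: "ideal_in A U \<Longrightarrow> J \<subseteq> A \<Longrightarrow> x \<in> U \<Longrightarrow> subalgebra (line A x)"
  using line_superset[of A x] by (intro line_subalgebra) (auto intro: ideal_in_subalgebra dest: ideal_inD)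

text \<open>These are the \<open>u\<close> for which \<open>J + F u\<close> is not Lie, because the
  square of \<open>j + c *s u\<close> is
  \<open>c *s (j \<odot> u) + (c * c) *s (u \<odot> u)\<close>. A proper subalgebra containing
  \<open>J\<close> and such a \<open>u\<close> is polycyclic by \<open>IH\<close>.\<close>

definition NL where "NL = {u\<in>U. (\<exists>j\<in>J. j \<odot> u \<noteq> 0) \<or> u \<odot> u \<noteq> 0}"

text \<open>On an affine line through \<open>u\<close>, violating the condition that
  \<open>u\<close> satisfies is an equation of degree at most two in the parameter with nonzero
  constant term, so almost all points of the line remain in \<open>NL\<close>.\<close>

lemma NL_dense:
  assumes "u \<in> NL" "x \<in> U"
  obtains c1 c2 where "c1 \<noteq> c2" "c1 \<noteq> 0" "c2 \<noteq> 0" "u + c1 *s x \<in> NL" "u + c2 *s x \<in> NL"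
proof -
  have uU: "u \<in> U" using assms by (auto simp: NL_def)
  let ?bad = "{c. u + c *s x \<notin> NL}"
  have "finite ?bad"
  proof (cases "\<exists>j\<in>J. j \<odot> u \<noteq> 0")
    case True
    then obtain j where j: "j \<in> J" "j \<odot> u \<noteq> 0" by blast
    have "?bad \<subseteq> {c. j \<odot> u + c *s (j \<odot> x) + (c * c) *s 0 = 0}"
      using j uU assms sU by (auto simp: NL_def bracket_simps subspace_add subspace_scale)
    then show ?thesis using finite_quadratic_roots[OF j(2)] finite_subset by blast
  next
    case False
    then have uu: "u \<odot> u \<noteq> 0" using assms by (auto simp: NL_def)
    have "?bad \<subseteq> {c. u \<odot> u + c *s (u \<odot> x + x \<odot> u) + (c * c) *s (x \<odot> x) = 0}"
    proof
      fix c assume "c \<in> ?bad"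
      then have "(u + c *s x) \<odot> (u + c *s x) = 0"
        using uU assms sU by (auto simp: NL_def subspace_add subspace_scale)
      then show "c \<in> {c. u \<odot> u + c *s (u \<odot> x + x \<odot> u) + (c * c) *s (x \<odot> x) = 0}"
        by (simp add: bracket_simps algebra_simps)
    qed
    then show ?thesis using finite_quadratic_roots[OF uu] finite_subset by blast
  qed
  then have inf: "infinite (UNIV - (?bad \<union> {0}))" by (simp add: infinite_UNIV_char_0 Diff_infinite_finite)
  obtain c1 where c1: "c1 \<in> UNIV - (?bad \<union> {0})" using infinite_imp_nonempty[OF inf] by blast
  obtain c2 where "c2 \<in> UNIV - (?bad \<union> {0}) - {c1}"
    using infinite_imp_nonempty[OF infinite_remove[OF inf]] by blast
  then show thesis using that[of c1 c2] c1 by auto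
qed

lemma NL_nonempty: "\<exists>u. u \<in> NL" using nonlie by (auto simp: NL_def lie_on_def)

lemma NL_not_J: "u \<in> NL \<Longrightarrow> u \<notin> J" using J_null by (auto simp: NL_def)

lemma nonlie_of_NL:
  assumes "subspace X" "J \<subseteq> X" "u \<in> X" "u \<in> NL"
  shows "\<not> lie_on X"
proof
  assume lie: "lie_on X"
  then have "u \<odot> u = 0" using assms by (auto simp: lie_on_def)
  moreover have "j \<odot> u = 0" if "j \<in> J" for j
    using lie_on_anti[OF lie assms(1), of j u] J_null[of j u] that assms by auto
  ultimately show False using assms by (auto simp: NL_def)
qed

lemma polycyclic_of_rk_Suc:
  assumes "rk U = Suc (rk J)"
  shows "polycyclic U"
proof -
  obtain u where u: "u \<in> U" "u \<notin> J" using JU J_ne_U by blast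
  have sub: "subalgebra (line J u)" using line_ideal_subalgebra[OF J_ideal] u by blast
  have le: "line J u \<subseteq> U" using u JU sU by (intro line_least)
  have "rk (line J u) = Suc (rk J)"
    using dim_line[OF sJ u(2)] by (intro rk_codim_one J_subalgebra sub line_superset)
  then have "line J u = U" using sub U le assms by (intro rk_eqI) auto
  then show ?thesis using dim_line[OF sJ u(2)] polycyclic.step[OF J_polycyclic U J_ideal] by simp
qed

text \<open>By \<open>big\<close> the classes of \<open>x\<close> and \<open>y\<close> span the Lie
  algebra \<open>U / R\<close>, whose derived algebra is therefore spanned by the class of
  \<open>y \<odot> x\<close>. Products of \<open>U\<close> fall into
  \<open>R + F (y \<odot> x)\<close>, and products of the latter into \<open>R\<close>.\<close>

lemma polycyclic_of_plane:
  assumes R: "ideal_in R U" "J \<subseteq> R" "polycyclic R"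
    and x: "x \<in> U" and y: "y \<in> U" and yx: "y \<odot> x \<in> line (line R x) y"
    and big: "\<And>B. subalgebra B \<Longrightarrow> line R x \<subseteq> B \<Longrightarrow> y \<in> B \<Longrightarrow> B \<subseteq> U \<Longrightarrow> B = U"
  shows "polycyclic U"
proof -
  note sR = ideal_inD(1)[OF R(1)] and RU = ideal_inD(2)[OF R(1)]
  let ?L = "line R x"
  note sL = subspace_line[of R x]
  have RL: "R \<subseteq> ?L" by (rule line_superset)
  have LU: "?L \<subseteq> U" using x RU sU by (intro line_least)
  have "subalgebra (line ?L y)"
  proof (rule line_subalgebra)
    show "subalgebra ?L" using line_ideal_subalgebra R x by blast
    show "J \<subseteq> ?L" "?L \<subseteq> U" using R RL LU by auto
    fix a assume "a \<in> ?L"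
    then obtain k where k: "a - k *s x \<in> R" by (auto simp: mem_line sR)
    have "y \<odot> (a - k *s x) \<in> line ?L y" using k y ideal_inD[OF R(1)] RL line_superset[of ?L y] by blast
    then have "y \<odot> (a - k *s x) + k *s (y \<odot> x) \<in> line ?L y"
      using yx by (intro subspace_add subspace_scale subspace_line)
    then show "y \<odot> a \<in> line ?L y" by (simp add: bracket_simps)
  qed (rule y)
  then have eq: "line ?L y = U"
    using big[OF _ line_superset line_self line_least[OF sU LU y]] by blast
  let ?w = "y \<odot> x"
  have wU: "?w \<in> U" using x y UU by blast
  have "polycyclic (line R ?w)"
  proof (rule polycyclic_above_brackets[OF R(3)])
    show "subalgebra (line R ?w)" using line_ideal_subalgebra R wU by blast
    show "R \<subseteq> line R ?w" by (rule line_superset)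
    fix u v assume "u \<in> line R ?w" "v \<in> line R ?w"
    then obtain k l where k: "u - k *s ?w \<in> R" and l: "v - l *s ?w \<in> R" by (auto simp: mem_line sR)
    have vU: "v \<in> U" using \<open>v \<in> line R ?w\<close> line_least[OF sU RU wU] by blast
    have "u \<odot> v = (u - k *s ?w) \<odot> v + k *s (?w \<odot> (v - l *s ?w)) + (k * l) *s (?w \<odot> ?w)"
      by (simp add: bracket_simps algebra_simps)
    moreover have "(u - k *s ?w) \<odot> v \<in> R" using ideal_inD(4)[OF R(1) k vU] .
    moreover have "?w \<odot> (v - l *s ?w) \<in> R" using ideal_inD(3)[OF R(1) l wU] .
    moreover have "?w \<odot> ?w \<in> R" using square_J[OF wU] R(2) by blast
    ultimately show "u \<odot> v \<in> R" using sR by (simp add: subspace_add subspace_scale)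
  qed
  then show ?thesis
  proof (rule polycyclic_above_brackets[OF _ U])
    show "line R ?w \<subseteq> U" using line_least[OF sU RU wU] .
    note sW = subspace_line[of R ?w] and RW = line_superset[of R ?w]
    have dec: "\<exists>r k l. r \<in> R \<and> u = r + k *s x + l *s y" if "u \<in> U" for u
    proof -
      obtain l where "u - l *s y \<in> ?L" using \<open>u \<in> U\<close> eq mem_line[OF sL, of u y] by blast
      then obtain k where "u - l *s y - k *s x \<in> R" by (auto simp: mem_line sR)
      then show ?thesis by (intro exI[of _ "u - l *s y - k *s x"] exI[of _ k] exI[of _ l]) simp
    qed
    fix u v assume u: "u \<in> U" and v: "v \<in> U"
    obtain r k l where u': "r \<in> R" "u = r + k *s x + l *s y" using dec[OF u] by blast
    obtain r' k' l' where v': "r' \<in> R" "v = r' + k' *s x + l' *s y" using dec[OF v] by blast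
    have "u \<odot> v = r \<odot> v + (k *s (x \<odot> r') + l *s (y \<odot> r'))
        + ((k * k') *s (x \<odot> x) + (l * l') *s (y \<odot> y)) + ((k * l') *s (x \<odot> y) + (l * k') *s ?w)"
      by (simp add: u' v' bracket_simps algebra_simps)
    moreover have "r \<odot> v \<in> line R ?w" using ideal_inD(4)[OF R(1) u'(1) v] RW by blast
    moreover have "x \<odot> r' \<in> line R ?w" using ideal_inD(3)[OF R(1) v'(1) x] RW by blast
    moreover have "y \<odot> r' \<in> line R ?w" using ideal_inD(3)[OF R(1) v'(1) y] RW by blast
    moreover have "x \<odot> x \<in> line R ?w" "y \<odot> y \<in> line R ?w"
      using square_J[OF x] square_J[OF y] R(2) RW by auto
    moreover have "?w \<in> line R ?w" by (rule line_self)
    moreover have "x \<odot> y \<in> line R ?w"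
    proof -
      have "(x \<odot> y + ?w) - ?w \<in> line R ?w"
        using sym_J[OF x y] R(2) RW line_self by (intro subspace_diff sW) auto
      then show ?thesis by simp
    qed
    ultimately show "u \<odot> v \<in> line R ?w" using sW by (simp add: subspace_add subspace_scale)
  qed
qed

text \<open>\<open>R\<close> acts on \<open>U / R\<close> by scalars, and a nonzero one occurs.
  Normalising it to one gives \<open>q\<close>. With \<open>K\<close> the kernel of the action and
  \<open>N\<close> the eigenspace of \<open>q\<close> modulo \<open>K\<close> for eigenvalue one,
  \<open>U = N + F q\<close> and the products of \<open>N\<close> lie in \<open>K\<close>, which
  yields the chain.\<close>

lemma polycyclic_of_scalar:
  assumes R: "subalgebra R" "J \<subseteq> R" "R \<subseteq> U" "polycyclic R"
    and sc: "\<And>q. q \<in> R \<Longrightarrow> \<exists>a. \<forall>x\<in>U. x \<odot> q - a *s x \<in> R"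
    and big: "\<And>x. x \<in> U \<Longrightarrow> line R x \<noteq> U"
    and p: "p \<in> R" "\<And>x. x \<in> U \<Longrightarrow> x \<odot> p - b *s x \<in> R" "b \<noteq> 0"
  shows "polycyclic U"
proof -
  note sR = subalgebraD(1)[OF R(1)]
  obtain a where a: "\<And>q x. q \<in> R \<Longrightarrow> x \<in> U \<Longrightarrow> x \<odot> q - a q *s x \<in> R" using sc by metis
  define K where "K = {q\<in>R. \<forall>x\<in>U. x \<odot> q \<in> R}"
  define q where "q = inverse b *s p"
  have qR: "q \<in> R" using p sR by (simp add: q_def subspace_scale)
  have q1: "x \<odot> q - x \<in> R" if "x \<in> U" for x
    using subspace_scale[OF sR p(2)[OF that], of "inverse b"] p(3)
    by (simp add: q_def bracket_simps algebra_simps)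
  have qU: "q \<in> U" using qR R by blast
  have sK: "subspace K"
    by (rule subspaceI) (use sR in \<open>auto simp: K_def bracket_simps subspace_0 subspace_add subspace_scale\<close>)
  have JK: "J \<subseteq> K" using R J_null subspace_0[OF sR] by (auto simp: K_def)
  have KR: "K \<subseteq> R" by (auto simp: K_def)
  have ex_out: "\<exists>y\<in>U. y \<notin> line R x" if "x \<in> U" for x
    using big[OF that] line_least[OF sU R(3) that] by blast
  have R_ne: "\<exists>y\<in>U. y \<notin> R" using ex_out[of 0] line_absorb[OF sR] subspace_0 sR sU by metis
  have aK: "w \<in> K" if "w \<in> R" "a w = 0" for w using a[OF that(1)] that by (auto simp: K_def)
  have K_ideal: "ideal_in K U"
  proof (rule ideal_aboveI'[OF sK JK])
    show "K \<subseteq> U" using KR R by blast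
    fix k x assume k: "k \<in> K" and x: "x \<in> U"
    let ?w = "x \<odot> k"
    have wR: "?w \<in> R" using k x by (auto simp: K_def)
    \<comment> \<open>If \<open>x \<odot> k\<close> acted by a nonzero scalar, the Leibniz identity
      for \<open>y \<odot> (x \<odot> k)\<close> would express \<open>y\<close> through
      \<open>x\<close> modulo \<open>R\<close>; \<open>big\<close> supplies a \<open>y\<close> for
      which this is false.\<close>
    have "a ?w = 0"
    proof (rule ccontr)
      assume nz: "a ?w \<noteq> 0"
      obtain y where y: "y \<in> U" "y \<notin> line R x" using ex_out[OF x] by blast
      let ?r = "y \<odot> k"
      have rR: "?r \<in> R" using k y by (auto simp: K_def)
      have e1: "y \<odot> ?w = (y \<odot> x) \<odot> k - ?r \<odot> x" by (rule leibniz)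
      have f1: "(y \<odot> x) \<odot> k \<in> R" using k UU[OF y(1) x] by (auto simp: K_def)
      have f2: "?r \<odot> x + x \<odot> ?r \<in> R" using sym_J[of ?r x] rR x R by blast
      have "((y \<odot> x) \<odot> k - (?r \<odot> x + x \<odot> ?r)) + (x \<odot> ?r - a ?r *s x) - (y \<odot> ?w - a ?w *s y) \<in> R"
        by (rule subspace_diff[OF sR subspace_add[OF sR subspace_diff[OF sR f1 f2] a[OF rR x]] a[OF wR y(1)]])
      then have "a ?w *s y - a ?r *s x \<in> R" unfolding e1 by (simp add: algebra_simps)
      then have "y - (a ?r / a ?w) *s x \<in> R" using nz by (rule mem_divide_coeff[OF sR])
      then show False using y by (auto simp: mem_line[OF sR])
    qed
    then show "x \<odot> k \<in> K" using wR aK by blast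
  qed
  have Rq: "r - a r *s q \<in> K" if r: "r \<in> R" for r
  proof -
    have "x \<odot> (r - a r *s q) \<in> R" if x: "x \<in> U" for x
    proof -
      have "(x \<odot> r - a r *s x) - a r *s (x \<odot> q - x) \<in> R"
        by (rule subspace_diff[OF sR a[OF r x] subspace_scale[OF sR q1[OF x]]])
      then show ?thesis by (simp add: bracket_simps algebra_simps)
    qed
    then show ?thesis using r qR sR by (auto simp: K_def intro: subspace_diff subspace_scale)
  qed
  have qq: "q \<odot> q \<in> K" using square_J[OF qU] JK by blast
  have q_nK: "q \<notin> K"
  proof
    assume "q \<in> K"
    obtain y where y: "y \<in> U" "y \<notin> R" using R_ne by blast
    have "y \<odot> q - (y \<odot> q - y) \<in> R" using \<open>q \<in> K\<close> y by (intro subspace_diff[OF sR _ q1[OF y(1)]]) (auto simp: K_def)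
    then show False using y by simp
  qed
  define N where "N = {x\<in>U. x \<odot> q - x \<in> K}"
  have sN: "subspace N"
  proof (rule subspaceI)
    fix x y c assume x: "x \<in> N" and y: "y \<in> N"
    have "(x + y) \<odot> q - (x + y) = (x \<odot> q - x) + (y \<odot> q - y)" by (simp add: bracket_simps)
    also have "\<dots> \<in> K" using x y by (intro subspace_add sK) (auto simp: N_def)
    finally show "x + y \<in> N" using x y sU by (simp add: N_def subspace_add)
    have "(c *s x) \<odot> q - (c *s x) = c *s (x \<odot> q - x)" by (simp add: bracket_simps algebra_simps)
    also have "\<dots> \<in> K" using x by (intro subspace_scale sK) (auto simp: N_def)
    finally show "c *s x \<in> N" using x sU by (simp add: N_def subspace_scale)
  qed (use sU sK in \<open>auto simp: N_def bracket_simps subspace_0\<close>)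
  have KN: "K \<subseteq> N" using K_ideal qU sK by (auto simp: N_def ideal_in_def intro!: subspace_diff)
  have NU: "N \<subseteq> U" by (auto simp: N_def)
  have q_nN: "q \<notin> N"
  proof
    assume "q \<in> N"
    then have "q \<odot> q - q \<in> K" by (simp add: N_def)
    from subspace_diff[OF sK qq this] show False using q_nK by simp
  qed
  have U_line: "U = line N q"
  proof
    show "line N q \<subseteq> U" using NU qU sU by (intro line_least)
    show "U \<subseteq> line N q"
    proof
      fix x assume x: "x \<in> U"
      let ?b = "a (x \<odot> q - x)"
      have "(x \<odot> q - x - ?b *s q) + ?b *s (q \<odot> q) \<in> K"
        by (rule subspace_add[OF sK Rq[OF q1[OF x]] subspace_scale[OF sK qq]])
      then have "(x - (- ?b) *s q) \<odot> q - (x - (- ?b) *s q) \<in> K" by (simp add: bracket_simps algebra_simps)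
      then have "x - (- ?b) *s q \<in> N" using x qU sU unfolding N_def by (auto intro: subspace_add subspace_scale)
      then show "x \<in> line N q" using mem_line[OF sN, of x q] by blast
    qed
  qed
  \<comment> \<open>A product of two eigenvectors has eigenvalue two modulo \<open>K\<close>, yet
    every vector of \<open>U\<close> has eigenvalue one modulo \<open>R\<close>. So the product lies
    in \<open>R\<close>, where \<open>q\<close> acts by zero modulo \<open>K\<close>, and twice the
    product lies in \<open>K\<close>.\<close>
  have NN: "x \<odot> y \<in> K" if x: "x \<in> N" and y: "y \<in> N" for x y
  proof -
    let ?z = "x \<odot> y"
    have xU: "x \<in> U" "y \<in> U" using x y NU by auto
    have zU: "?z \<in> U" using xU UU by blast
    have "(x \<odot> q - x) \<odot> y + x \<odot> (y \<odot> q - y) \<in> K"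
      using x y xU K_ideal by (auto simp: N_def ideal_in_def intro!: subspace_add sK)
    then have 1: "?z \<odot> q - 2 *s ?z \<in> K"
      using scale_left_distrib[of 1 1 ?z] by (simp add: bracket_simps leibniz algebra_simps)
    have "(?z \<odot> q - ?z) - (?z \<odot> q - 2 *s ?z) \<in> R"
      using 1 KR by (intro subspace_diff[OF sR q1[OF zU]]) auto
    then have zR: "?z \<in> R" using scale_left_distrib[of 1 1 ?z] by (simp add: algebra_simps)
    have "(?z - a ?z *s q) \<odot> q + a ?z *s (q \<odot> q) \<in> K"
      using Rq[OF zR] qq qU K_ideal by (auto simp: ideal_in_def intro!: subspace_add subspace_scale sK)
    then have "?z \<odot> q \<in> K" by (simp add: bracket_simps)
    then have "?z \<odot> q - (?z \<odot> q - 2 *s ?z) \<in> K" using 1 by (rule subspace_diff[OF sK])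
    then have "2 *s ?z \<in> K" by simp
    then show ?thesis by (rule mem_scaleD[OF sK]) simp
  qed
  have N_ideal: "ideal_in N U"
  proof (rule ideal_aboveI[OF sN _ NU])
    show "J \<subseteq> N" using JK KN by blast
    fix n x assume n: "n \<in> N" and x: "x \<in> U"
    obtain k where k: "x - k *s q \<in> N" using x U_line mem_line[OF sN, of x q] by auto
    have "n \<odot> (x - k *s q) + k *s ((n \<odot> q - n) + n) \<in> N"
      using NN[OF n k] n KN by (intro subspace_add subspace_scale sN) (auto simp: N_def)
    then show "n \<odot> x \<in> N" by (simp add: bracket_simps)
  qed
  have "polycyclic K" using polycyclic_mono[OF R(4) ideal_in_subalgebra[OF K_ideal] KR] .
  then have "polycyclic N"
    using polycyclic_above_brackets[of K N] ideal_in_subalgebra[OF N_ideal] KN NN by blast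
  then show ?thesis using polycyclic.step[OF _ U N_ideal] U_line dim_line[OF sN q_nN] by metis
qed

end

section \<open>Generic elements force scalar actions\<close>

context nonlie_step begin

text \<open>The join of \<open>R\<close> with \<open>J + F u\<close> exceeds \<open>R\<close> by at
  most one in rank, so it is proper; containing \<open>J\<close> and \<open>u\<close> it is not Lie,
  and \<open>IH\<close> makes it polycyclic. Rank is then dimension, so for
  \<open>u \<notin> R\<close> the join is just \<open>R + F u\<close>.\<close>

lemma chain_line:
  assumes R: "subalgebra R" "J \<subseteq> R" "R \<subseteq> U" and rkR: "rk R + 2 \<le> rk U"
    and join: "\<And>B. subalgebra B \<Longrightarrow> J \<subseteq> B \<Longrightarrow> B \<subseteq> U \<Longrightarrow>
      \<exists>X. subalgebra X \<and> R \<subseteq> X \<and> B \<subseteq> X \<and> X \<subseteq> U \<and> rk X + rk J \<le> rk R + rk B"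
    and u: "u \<in> NL"
  shows "polycyclic R" and "q \<in> R \<Longrightarrow> u \<odot> q \<in> line R u"
proof -
  have uU: "u \<in> U" using u by (simp add: NL_def)
  have uJ: "u \<notin> J" using u by (rule NL_not_J)
  note sR = subalgebraD(1)[OF R(1)]
  let ?B = "line J u"
  have B: "subalgebra ?B" using line_ideal_subalgebra[OF J_ideal] uU by blast
  have "rk ?B = Suc (rk J)"
    using dim_line[OF sJ uJ] by (intro rk_codim_one J_subalgebra B line_superset)
  moreover have "?B \<subseteq> U" using uU JU sU by (intro line_least)
  ultimately obtain X where X: "subalgebra X" "R \<subseteq> X" "?B \<subseteq> X" "X \<subseteq> U" "rk X \<le> Suc (rk R)"
    using join[OF B line_superset] by auto
  have uX: "u \<in> X" using X(3) line_self by blast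
  have "\<not> lie_on X"
    using X line_superset[of J u] uX u by (intro nonlie_of_NL subalgebraD(1)) auto
  moreover have "X \<noteq> U" using X(5) rkR by auto
  ultimately have pX: "polycyclic X" using X by (intro IH) auto
  then show pR: "polycyclic R" using polycyclic_mono R(1) X(2) by blast
  assume q: "q \<in> R"
  show "u \<odot> q \<in> line R u"
  proof (cases "u \<in> R")
    case True
    then show ?thesis using q subalgebraD(2)[OF R(1)] line_superset by blast
  next
    case False
    have "dim X \<le> Suc (dim R)" using X(5) polycyclic_rk[OF pX] polycyclic_rk[OF pR] by simp
    then have "X = line R u" using False X uX sR by (intro line_eqI) (auto dest: subalgebraD)
    then show ?thesis using q X uX subalgebraD(2)[OF X(1)] by blast
  qed
qed

lemma linear_right_mult: "Vector_Spaces.linear scale scale (\<lambda>x. x \<odot> q)"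
  by (auto simp: linear_iff_local bracket_simps)

text \<open>Every generic element is an eigenvector of right multiplication by \<open>q\<close>
  modulo \<open>R\<close>; for each \<open>x\<close>, three generic points on a line in direction
  \<open>x\<close> bring \<open>x\<close> within reach of \<open>scalar_mod\<close>.\<close>

lemma chain_scalar:
  assumes R: "subalgebra R" "J \<subseteq> R" "R \<subset> U"
    and ln: "\<And>u q. u \<in> NL \<Longrightarrow> q \<in> R \<Longrightarrow> u \<odot> q \<in> line R u" and q: "q \<in> R"
  shows "\<exists>a. \<forall>x\<in>U. x \<odot> q - a *s x \<in> R"
proof -
  note sR = subalgebraD(1)[OF R(1)]
  have eig: "\<exists>a. u \<odot> q - a *s u \<in> R" if "u \<in> NL" for u
    using ln[OF that q] by (simp add: mem_line[OF sR])
  obtain u where u: "u \<in> NL" "u \<notin> R"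
  proof -
    obtain u where u: "u \<in> NL" using NL_nonempty by blast
    obtain x where x: "x \<in> U" "x \<notin> R" using R by blast
    show thesis
    proof (cases "u \<in> R")
      case True
      obtain c1 c2 where c: "c1 \<noteq> 0" "u + c1 *s x \<in> NL" using NL_dense[OF u x(1)] by metis
      have "u + c1 *s x \<notin> R"
      proof
        assume "u + c1 *s x \<in> R"
        from subspace_diff[OF sR this True] have "c1 *s x \<in> R" by simp
        then show False using x c mem_scaleD[OF sR] by blast
      qed
      then show thesis using that c by blast
    qed (use that u in blast)
  qed
  obtain a where a: "u \<odot> q - a *s u \<in> R" using eig u by blast
  have "x \<odot> q - a *s x \<in> R" if x: "x \<in> U" for x
  proof -
    obtain c1 c2 where c: "c1 \<noteq> c2" "c1 \<noteq> 0" "c2 \<noteq> 0" "u + c1 *s x \<in> NL" "u + c2 *s x \<in> NL"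
      using NL_dense[OF u(1) x] .
    obtain a1 a2 where "(u + c1 *s x) \<odot> q - a1 *s (u + c1 *s x) \<in> R"
      "(u + c2 *s x) \<odot> q - a2 *s (u + c2 *s x) \<in> R" using eig c by metis
    moreover have "(\<lambda>x. x \<odot> q) ` R \<subseteq> R" using q subalgebraD(2)[OF R(1)] by blast
    ultimately show ?thesis using scalar_mod[OF sR linear_right_mult _ u(2) a] c by blast
  qed
  then show ?thesis by blast
qed

text \<open>In the second case no two independent elements of \<open>U / R k\<close> span a
  subalgebra, as for the cross product. The whole chain is retained, not only \<open>R k\<close>,
  because a perfect ideal acts trivially on its one-dimensional factors.\<close>

lemma polycyclic_or_strange:
  obtains "polycyclic U"
  | R :: "nat \<Rightarrow> 'b set" and k where "R 0 = J" "\<And>i. i \<le> k \<Longrightarrow> ideal_in (R i) U"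
    "\<And>i. i < k \<Longrightarrow> R i \<subseteq> R (Suc i) \<and> dim (R (Suc i)) \<le> Suc (dim (R i))" "J \<subseteq> R k"
    "rk (R k) + 2 = rk U"
    "\<And>x y. x \<in> U \<Longrightarrow> x \<notin> R k \<Longrightarrow> y \<in> U \<Longrightarrow> y \<notin> line (R k) x \<Longrightarrow> y \<odot> x \<notin> line (line (R k) x) y"
proof -
  obtain R :: "nat \<Rightarrow> 'b set" and K where R0: "R 0 = J" and RK: "R K = U"
    and Rs: "\<And>i. i < K \<Longrightarrow> R i \<subseteq> R (Suc i)" "\<And>i. i < K \<Longrightarrow> rk (R (Suc i)) \<le> Suc (rk (R i))"
    and Rsub: "\<And>i. i \<le> K \<Longrightarrow> subalgebra (R i)"
    and Rj: "\<And>i B. i \<le> K \<Longrightarrow> subalgebra B \<Longrightarrow> J \<subseteq> B \<Longrightarrow> B \<subseteq> U \<Longrightarrow>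
      \<exists>X. subalgebra X \<and> R i \<subseteq> X \<and> B \<subseteq> X \<and> X \<subseteq> U \<and> rk X + rk J \<le> rk (R i) + rk B"
    using rk_chain[OF J_subalgebra U JU] by metis
  have mono: "R i \<subseteq> R j" if "i \<le> j" "j \<le> K" for i j
    using that
  proof (induction j rule: dec_induct)
    case (step n) then show ?case using Rs(1)[of n] by auto
  qed simp
  have JR: "J \<subseteq> R i" "R i \<subseteq> U" if "i \<le> K" for i
    using mono[of 0 i] mono[of i K] that R0 RK by auto
  have rkJ: "rk J < rk U" using J_ne_U JU J_subalgebra U by (intro rk_strict) auto
  show thesis
  proof (cases "rk U = Suc (rk J)")
    case True then show thesis using that(1) polycyclic_of_rk_Suc by blast
  next
    case False
    \<comment> \<open>The last index of corank at least two is wanted; as ranks grow by at most one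
      along the chain, the corank there is exactly two.\<close>
    define P where "P i \<longleftrightarrow> i \<le> K \<and> rk (R i) + 2 \<le> rk U" for i
    have "P 0" using False rkJ R0 by (simp add: P_def)
    moreover have "\<forall>i. P i \<longrightarrow> i < Suc K" by (simp add: P_def)
    ultimately obtain k where k: "P k" and mx: "\<And>i. P i \<Longrightarrow> i \<le> k"
      using ex_has_greatest_nat[of P 0 id "Suc K"] by auto
    have "k \<noteq> K" using k RK by (auto simp: P_def)
    then have kK: "k < K" using k by (auto simp: P_def)
    then have rkR: "rk (R k) + 2 = rk U"
      using mx[of "Suc k"] k kK Rs(2)[OF kK] unfolding P_def by linarith
    have Pi: "P i" if "i \<le> k" for i
    proof -
      have "rk (R i) \<le> rk (R k)" using mono[OF that] Rsub that kK by (intro rk_mono) auto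
      then show ?thesis using that kK rkR by (auto simp: P_def)
    qed
    have iK: "i \<le> K" if "i \<le> k" for i using that kK by simp
    obtain u0 where u0: "u0 \<in> NL" using NL_nonempty by blast
    have pol: "polycyclic (R i)" and ln: "\<And>u q. u \<in> NL \<Longrightarrow> q \<in> R i \<Longrightarrow> u \<odot> q \<in> line (R i) u" if "i \<le> k" for i
      using chain_line[OF Rsub JR _ Rj] Pi[OF that] iK[OF that] u0 unfolding P_def by blast+
    have RneU: "R i \<subset> U" if "i \<le> k" for i
      using Pi[OF that] JR(2)[OF iK[OF that]] by (auto simp: P_def)
    have sc: "\<exists>a. \<forall>x\<in>U. x \<odot> q - a *s x \<in> R i" if "i \<le> k" "q \<in> R i" for i q
      using chain_scalar[OF Rsub[OF iK] JR(1)[OF iK] RneU ln] that by blast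
    have sR: "subspace (R i)" if "i \<le> k" for i using Rsub[OF iK[OF that]] by (rule subalgebraD)
    have big: "line (R k) x \<noteq> U" if x: "x \<in> U" for x
    proof
      assume eq: "line (R k) x = U"
      then have "x \<notin> R k" using RneU[of k] sR[of k] by (auto simp: line_absorb)
      then have "rk U = Suc (rk (R k))"
        using dim_line[OF sR[OF order_refl], of x] eq U Rsub[of k] JR(2)[of k] kK by (intro rk_codim_one) auto
      then show False using rkR by simp
    qed
    show thesis
    proof (cases "\<exists>p\<in>R k. \<exists>b. b \<noteq> 0 \<and> (\<forall>x\<in>U. x \<odot> p - b *s x \<in> R k)")
      case True
      then obtain p b where p: "p \<in> R k" "b \<noteq> 0" "\<And>x. x \<in> U \<Longrightarrow> x \<odot> p - b *s x \<in> R k" by blast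
      have "k \<le> K" using kK by simp
      then have "polycyclic U"
        using polycyclic_of_scalar[OF Rsub JR pol[OF order_refl] sc[OF order_refl] big p(1,3,2)] by blast
      then show thesis by (rule that(1))
    next
      case False
      have Uq: "x \<odot> q \<in> R k" if "q \<in> R k" "x \<in> U" for q x
      proof -
        obtain a where a: "\<forall>x\<in>U. x \<odot> q - a *s x \<in> R k" using sc[OF order_refl \<open>q \<in> R k\<close>] by blast
        then have "a = 0" using False \<open>q \<in> R k\<close> by blast
        then show ?thesis using a that by auto
      qed
      \<comment> \<open>The scalar by which \<open>q\<close> acts on \<open>U / R i\<close> is also
        its scalar on the quotient \<open>U / R k\<close>, where all scalars vanish.\<close>
      have Ri: "ideal_in (R i) U" if i: "i \<le> k" for i
      proof (rule ideal_aboveI'[OF sR[OF i] JR[OF iK[OF i]]])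
        fix q x assume q: "q \<in> R i" and x: "x \<in> U"
        obtain a where a: "\<forall>x\<in>U. x \<odot> q - a *s x \<in> R i" using sc[OF i q] by blast
        obtain y where y: "y \<in> U" "y \<notin> R k" using RneU[of k] by blast
        have ik: "R i \<subseteq> R k" using mono i kK by simp
        have "y \<odot> q - (y \<odot> q - a *s y) \<in> R k"
        proof (rule subspace_diff[OF sR[OF order_refl]])
          show "y \<odot> q \<in> R k" using q ik Uq y by blast
          show "y \<odot> q - a *s y \<in> R k" using a y ik by blast
        qed
        then have "a *s y \<in> R k" by simp
        then have "a = 0" using y mem_scaleD[OF sR[OF order_refl]] by blast
        then show "x \<odot> q \<in> R i" using a x by auto
      qed
      show thesis
      proof (cases "\<exists>x\<in>U. \<exists>y\<in>U. x \<notin> R k \<and> y \<notin> line (R k) x \<and> y \<odot> x \<in> line (line (R k) x) y")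
        case True
        then obtain x y where xy: "x \<in> U" "y \<in> U" "x \<notin> R k" "y \<notin> line (R k) x" "y \<odot> x \<in> line (line (R k) x) y"
          by blast
        have subL: "subalgebra (line (R k) x)"
          using line_ideal_subalgebra[OF Ri[OF order_refl] JR(1) xy(1)] kK by simp
        have "polycyclic U"
        proof (rule polycyclic_of_plane[OF Ri[OF order_refl] _ pol xy(1,2,5)])
          show "J \<subseteq> R k" using JR kK by simp
          fix B assume B: "subalgebra B" "line (R k) x \<subseteq> B" "y \<in> B" "B \<subseteq> U"
          have "rk (line (R k) x) = Suc (rk (R k))"
            using dim_line[OF sR xy(3)] Rsub[of k] kK subL by (intro rk_codim_one line_superset) auto
          moreover have "rk (line (R k) x) < rk B" using B xy subL by (intro rk_strict) auto
          ultimately show "B = U" using rkR B U by (intro rk_eqI) auto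
        qed simp
        then show thesis by (rule that(1))
      next
        case False
        have "dim (R (Suc i)) \<le> Suc (dim (R i))" if "i < k" for i
          using Rs(2)[of i] pol[of i] pol[of "Suc i"] that kK by (simp add: polycyclic_rk)
        then show thesis
          using that(2)[OF R0 Ri _ JR(1) rkR] False Rs(1) kK by auto
      qed
    qed
  qed
qed

end

section \<open>Almost simple quotients of rank two\<close>

context leibniz_fd begin

lemma brackets_ideal:
  assumes U: "subalgebra U" and N: "ideal_in N U"
  shows "ideal_in (brackets N) U"
  unfolding brackets_def
proof (rule ideal_in_span[OF U])
  let ?G = "{x \<odot> y |x y. x \<in> N \<and> y \<in> N}"
  have NU: "N \<subseteq> U" using N by (rule ideal_inD)
  have sp: "x \<odot> y \<in> span ?G" if "x \<in> N" "y \<in> N" for x y using that by (intro span_base) blast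
  show "?G \<subseteq> U" using NU subalgebraD(2)[OF U] by blast
  fix g z assume "g \<in> ?G" and z: "z \<in> U"
  then obtain x y where xy: "x \<in> N" "y \<in> N" "g = x \<odot> y" by blast
  have N': "z \<odot> x \<in> N" "z \<odot> y \<in> N" "x \<odot> z \<in> N" "y \<odot> z \<in> N" using ideal_inD[OF N] xy z by blast+
  have "z \<odot> g = (z \<odot> x) \<odot> y - (z \<odot> y) \<odot> x" by (simp add: xy leibniz)
  also have "\<dots> \<in> span ?G" using N' xy by (intro span_diff sp)
  finally show "z \<odot> g \<in> span ?G" .
  have "g \<odot> z = (x \<odot> z) \<odot> y + x \<odot> (y \<odot> z)" by (simp add: xy leibniz)
  also have "\<dots> \<in> span ?G" using N' xy by (intro span_add sp)
  finally show "g \<odot> z \<in> span ?G" .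
qed

lemma brackets_subset: "subalgebra N \<Longrightarrow> brackets N \<subseteq> N"
  by (rule brackets_least) (auto dest: subalgebraD)

end

locale strange_step = nonlie_step +
  fixes R :: "nat \<Rightarrow> 'b set" and k :: nat
  assumes R0: "R 0 = J" and R_ideal: "i \<le> k \<Longrightarrow> ideal_in (R i) U"
    and R_step: "i < k \<Longrightarrow> R i \<subseteq> R (Suc i) \<and> dim (R (Suc i)) \<le> Suc (dim (R i))"
    and J_R: "J \<subseteq> R k" and rk_R: "rk (R k) + 2 = rk U"
    and strange: "x \<in> U \<Longrightarrow> x \<notin> R k \<Longrightarrow> y \<in> U \<Longrightarrow> y \<notin> line (R k) x \<Longrightarrow>
      y \<odot> x \<notin> line (line (R k) x) y"
begin

definition rad where "rad = R k"

lemma rad_ideal: "ideal_in rad U" using R_ideal by (simp add: rad_def)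
lemma s_rad: "subspace rad" using rad_ideal by (rule ideal_inD)
lemma rad_U: "rad \<subseteq> U" using rad_ideal by (rule ideal_inD)
lemma J_rad: "J \<subseteq> rad" using J_R by (simp add: rad_def)
lemma rk_rad: "rk rad + 2 = rk U" using rk_R by (simp add: rad_def)
lemma rad_subalgebra: "subalgebra rad" using rad_ideal by (rule ideal_in_subalgebra)

lemma no_plane: "x \<in> U \<Longrightarrow> x \<notin> rad \<Longrightarrow> y \<in> U \<Longrightarrow> y \<notin> line rad x \<Longrightarrow> y \<odot> x \<notin> line (line rad x) y"
  using strange by (simp add: rad_def)

lemma rk_line_rad: "x \<in> U \<Longrightarrow> x \<notin> rad \<Longrightarrow> rk (line rad x) = Suc (rk rad)"
  using dim_line[OF s_rad] line_ideal_subalgebra[OF rad_ideal J_rad]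
  by (intro rk_codim_one rad_subalgebra line_superset) auto

lemma line_rad_ne: "x \<in> U \<Longrightarrow> line rad x \<noteq> U"
  using rk_line_rad[of x] rk_rad line_absorb[OF s_rad, of x] by (cases "x \<in> rad") auto

lemma ex_outside_line: "x \<in> U \<Longrightarrow> \<exists>y\<in>U. y \<notin> line rad x"
  using line_rad_ne line_least[OF sU rad_U] by blast

lemma rad_ne_U: "rad \<noteq> U" using rk_rad by auto

lemma between:
  assumes "subalgebra B" "rad \<subseteq> B" "B \<subseteq> U" "B \<noteq> U" "x \<in> B" "x \<notin> rad"
  shows "B = line rad x"
proof -
  have sub: "subalgebra (line rad x)" using line_ideal_subalgebra[OF rad_ideal J_rad] assms by blast
  have "rk B < rk U" using assms U by (intro rk_strict) auto
  then have "line rad x = B"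
    using rk_line_rad[of x] rk_rad assms sub
    by (intro rk_eqI line_least) (auto dest: subalgebraD)
  then show ?thesis ..
qed

text \<open>By rank, a proper ideal strictly above \<open>rad\<close> would be
  \<open>rad + F x\<close>; with any further \<open>y\<close> it would give a plane modulo
  \<open>rad\<close> containing \<open>y \<odot> x\<close>, against \<open>no_plane\<close>. So
  \<open>U / rad\<close> is simple.\<close>

lemma ideal_above_rad:
  assumes B: "ideal_in B U" "rad \<subseteq> B" "B \<noteq> rad"
  shows "B = U"
proof (rule ccontr)
  assume ne: "B \<noteq> U"
  note BU = ideal_inD(2)[OF B(1)]
  obtain x where x: "x \<in> B" "x \<notin> rad" using B by blast
  have xU: "x \<in> U" using x BU by blast
  have eq: "B = line rad x" using between[OF ideal_in_subalgebra[OF B(1)] B(2) BU ne x] .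
  obtain y where y: "y \<in> U" "y \<notin> line rad x" using ex_outside_line[OF xU] by blast
  have "y \<odot> x \<in> line rad x" using ideal_inD(3)[OF B(1) x(1) y(1)] eq by simp
  then show False using no_plane[OF xU x(2) y] line_superset by blast
qed

lemma ideal_supplement:
  assumes "ideal_in B U" "\<not> B \<subseteq> rad"
  shows "B \<boxplus> rad = U"
  using assms sums_superset[OF s_rad, of B] sums_superset(2)[of B rad] ideal_inD(1)[OF assms(1)]
  by (intro ideal_above_rad ideal_in_sums rad_ideal U) auto

lemma brackets_supplement: "brackets U \<boxplus> rad = U"
proof (rule ideal_supplement[OF brackets_ideal[OF U ideal_in_self[OF U]]])
  obtain x where x: "x \<in> U" "x \<notin> rad" using rad_U rad_ne_U by blast
  obtain y where y: "y \<in> U" "y \<notin> line rad x" using ex_outside_line[OF x(1)] by blast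
  have "y \<odot> x \<notin> rad" using no_plane[OF x y] line_superset by blast
  then show "\<not> brackets U \<subseteq> rad" using bracket_in_brackets[OF y(1) x(1)] by blast
qed

text \<open>\<open>U / rad\<close> is perfect, so if \<open>B\<close> covers it, the products of
  \<open>B\<close> still do. Hence a polycyclic subalgebra cannot cover it: all terms of its chain
  would, down to zero.\<close>

lemma supplement_brackets:
  assumes BR: "B \<boxplus> rad = U" and B: "B \<subseteq> U" and N: "subspace N" "N \<subseteq> U"
    and BN: "\<And>x y. x \<in> B \<Longrightarrow> y \<in> B \<Longrightarrow> x \<odot> y \<in> N"
  shows "N \<boxplus> rad = U"
proof
  show "N \<boxplus> rad \<subseteq> U" by (intro sums_least sU N rad_U)
  note sNR = subspace_boxplus[OF N(1) s_rad]
  have "brackets U \<subseteq> N \<boxplus> rad"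
  proof (rule brackets_least[OF sNR])
    fix x y assume x: "x \<in> U" and y: "y \<in> U"
    obtain b r where br: "b \<in> B" "r \<in> rad" "x = b + r" using x BR[symmetric] by (auto simp: mem_sums)
    obtain c s where cs: "c \<in> B" "s \<in> rad" "y = c + s" using y BR[symmetric] by (auto simp: mem_sums)
    have "x \<odot> y = b \<odot> c + (b \<odot> s + r \<odot> y)" by (simp add: br cs bracket_simps)
    moreover have "b \<odot> s + r \<odot> y \<in> rad"
      using br cs B y ideal_inD[OF rad_ideal] by (intro subspace_add s_rad) auto
    ultimately show "x \<odot> y \<in> N \<boxplus> rad" using BN br cs unfolding mem_sums by blast
  qed
  then have "brackets U \<boxplus> rad \<subseteq> N \<boxplus> rad"
    using sums_superset(2)[OF N(1)] by (intro sums_least sNR)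
  then show "U \<subseteq> N \<boxplus> rad" by (simp add: brackets_supplement)
qed

lemma polycyclic_not_supplement: "polycyclic B \<Longrightarrow> B \<subseteq> U \<Longrightarrow> B \<boxplus> rad \<noteq> U"
proof (induction rule: polycyclic.induct)
  case zero
  have "{0} \<boxplus> rad \<subseteq> rad" by (intro sums_least s_rad) (auto simp: subspace_0 s_rad)
  then show ?case using rad_ne_U rad_U by blast
next
  case (step N B)
  have NU: "N \<subseteq> U" using step ideal_inD(2)[OF step(3)] by blast
  show ?case
  proof
    assume "B \<boxplus> rad = U"
    then have "N \<boxplus> rad = U"
      using supplement_brackets[OF _ step.prems ideal_inD(1)[OF step(3)] NU]
        polycyclic_brackets[OF step(3,2,4)] by blast
    then show False using step.IH NU by blast
  qed
qed

lemma supplement_lie: "subalgebra B \<Longrightarrow> B \<subset> U \<Longrightarrow> B \<boxplus> rad = U \<Longrightarrow> lie_on B"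
  using IH polycyclic_not_supplement by blast

text \<open>\<open>N + F r\<close> covers \<open>U / rad\<close> and is not Lie, as it contains
  \<open>J\<close> and the generic \<open>r\<close>; by \<open>supplement_lie\<close> it cannot be
  proper.\<close>

lemma lie_ideal_of_supplement:
  assumes N: "ideal_in N U" "J \<subseteq> N" "N \<boxplus> rad = U" and r: "r \<in> rad" "r \<in> NL"
  shows "line N r = U"
proof (rule ccontr)
  assume ne: "line N r \<noteq> U"
  have rU: "r \<in> U" using r rad_U by blast
  have sub: "subalgebra (line N r)" using line_ideal_subalgebra[OF N(1,2) rU] .
  have le: "line N r \<subseteq> U" using line_least[OF sU ideal_inD(2)[OF N(1)] rU] .
  have "N \<boxplus> rad \<subseteq> line N r \<boxplus> rad" using line_superset by (intro sums_mono) auto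
  moreover have "line N r \<boxplus> rad \<subseteq> U" by (intro sums_least sU le rad_U)
  ultimately have "line N r \<boxplus> rad = U" using N by blast
  then have "lie_on (line N r)" using supplement_lie[OF sub] le ne by blast
  moreover have "\<not> lie_on (line N r)"
    using nonlie_of_NL[OF subspace_line _ line_self r(2)] N(2) line_superset by blast
  ultimately show False by blast
qed

text \<open>The kernel of the action of \<open>U\<close> on \<open>J\<close> by right
  multiplication.\<close>

definition cent where "cent = {x\<in>U. \<forall>j\<in>J. j \<odot> x = 0}"

lemma cent_ideal: "ideal_in cent U"
proof (rule ideal_aboveI)
  show "subspace cent"
    by (rule subspaceI) (use sU in \<open>auto simp: cent_def bracket_simps subspace_0 subspace_add subspace_scale\<close>)
  show "J \<subseteq> cent" using JU J_null by (auto simp: cent_def)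
  show "cent \<subseteq> U" by (auto simp: cent_def)
  show "c \<odot> x \<in> cent" if "c \<in> cent" "x \<in> U" for c x
    using that UU ideal_inD(4)[OF J_ideal] by (auto simp: cent_def leibniz bracket_simps)
qed

text \<open>Left multiplications vanish on \<open>J\<close>, so inside it a common eigenvector of
  the right multiplications modulo \<open>A\<close> already spans an ideal over
  \<open>A\<close>.\<close>

lemma refine_line_J:
  assumes B: "subalgebra B" "supersolvable_on B" and A: "ideal_in A B" and A': "ideal_in A' B" "A \<subset> A'"
    and J: "A' \<subseteq> J"
  obtains v where "v \<in> A'" "v \<notin> A" "ideal_in (line A v) B" "\<And>x. x \<in> B \<Longrightarrow> \<exists>c. v \<odot> x - c *s v \<in> A"
proof -
  obtain v lam where v: "v \<in> A'" "v \<notin> A" "\<And>n. n \<in> B \<Longrightarrow> v \<odot> n - lam n *s v \<in> A"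
    using supersolvable_on_weight[OF B A A'(1)] A'(2) by blast
  note sA = ideal_inD(1)[OF A]
  have lA': "line A v \<subseteq> A'" using A' v by (intro line_least) (auto dest: ideal_inD)
  have "ideal_in (line A v) B"
    unfolding ideal_in_def
  proof (intro conjI ballI subspace_line)
    show "line A v \<subseteq> B" using lA' ideal_inD(2)[OF A'(1)] by blast
    fix i x assume i: "i \<in> line A v" and x: "x \<in> B"
    show "x \<odot> i \<in> line A v" using i lA' J J_null[of i x] subspace_0[OF subspace_line] by auto
    obtain c where c: "i - c *s v \<in> A" using i by (auto simp: mem_line[OF sA])
    have "(i - c *s v) \<odot> x + c *s (v \<odot> x - lam x *s v) \<in> A"
      using ideal_inD(4)[OF A c x] v(3)[OF x] by (intro subspace_add subspace_scale sA)
    then have "i \<odot> x - (c * lam x) *s v \<in> A" by (simp add: bracket_simps algebra_simps)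
    then show "i \<odot> x \<in> line A v" unfolding mem_line[OF sA] by blast
  qed
  then show thesis using that v by blast
qed

text \<open>Otherwise the kernel of the action on \<open>J\<close> is small. An element
  \<open>u\<close> outside \<open>rad\<close> acts on \<open>J\<close> with all eigenvalues in the
  field, since \<open>J + F u\<close> is supersolvable. Their differences are the eigenvalues of
  \<open>u\<close> on operators of \<open>J\<close>, so \<open>u\<close> would have an eigenvector
  on \<open>U\<close> modulo \<open>rad + F u\<close>, against \<open>no_plane\<close>. The minimal
  \<open>E\<close> and the maximal \<open>G\<close> isolate one matrix entry that exhibits
  it.\<close>

lemma cent_not_rad: "\<not> cent \<subseteq> rad"
proof
  assume cr: "cent \<subseteq> rad"
  obtain u where u: "u \<in> U" "u \<notin> rad" using rad_U rad_ne_U by blast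
  have uJ: "u \<notin> J" using u J_rad by blast
  let ?B = "line J u" and ?L = "line rad u"
  have subB: "subalgebra ?B" using line_ideal_subalgebra[OF J_ideal order_refl u(1)] .
  have uB: "u \<in> ?B" by (rule line_self)
  have BU: "?B \<subseteq> U" using line_least[OF sU JU u(1)] .
  have JB: "ideal_in J ?B" using J_ideal BU line_superset[of J u] by (auto simp: ideal_in_def)
  have "polycyclic ?B" using polycyclic.step[OF J_polycyclic subB JB dim_line[OF sJ uJ]] .
  then have ss: "supersolvable_on ?B" by (rule polycyclic_imp_supersolvable_on)
  have sL: "subspace ?L" by (rule subspace_line)
  have noeig: "x \<in> ?L" if "x \<in> U" "x \<odot> u - c *s x \<in> ?L" for x c
    using no_plane[OF u that(1)] that(2) by (auto simp: mem_line[OF sL])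
  define P where "P E \<longleftrightarrow> ideal_in E ?B \<and> E \<subseteq> J \<and> {x\<in>U. \<forall>e\<in>E. e \<odot> x = 0} \<subseteq> ?L" for E
  have "P J" using JB cr line_superset[of rad u] by (auto simp: P_def cent_def)
  then obtain E where E: "P E" and mn: "\<And>C. P C \<Longrightarrow> dim E \<le> dim C" using ex_min_dim[of P] by blast
  have sE: "subspace E" using E by (auto simp: P_def dest: ideal_inD)
  have "E \<noteq> {0}"
  proof
    assume "E = {0}"
    then have "U \<subseteq> ?L" using E by (auto simp: P_def bracket_simps)
    then show False using line_rad_ne[OF u(1)] line_least[OF sU rad_U u(1)] by blast
  qed
  define Q where "Q F \<longleftrightarrow> ideal_in F ?B \<and> F \<subset> E" for F
  have "Q {0}" using ideal_in_zero[OF subB] \<open>E \<noteq> {0}\<close> subspace_0[OF sE] by (auto simp: Q_def)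
  then obtain F where F: "Q F" and mx: "\<And>C. Q C \<Longrightarrow> dim C \<le> dim F" using ex_max_dim[of Q] by blast
  have sF: "subspace F" and FB: "ideal_in F ?B" using F by (auto simp: Q_def dest: ideal_inD)
  obtain v where v: "v \<in> E" "v \<notin> F" "ideal_in (line F v) ?B" "\<exists>c. v \<odot> u - c *s v \<in> F"
  proof (rule refine_line_J[OF subB ss FB])
    show "ideal_in E ?B" "F \<subset> E" "E \<subseteq> J" using E F by (auto simp: P_def Q_def)
  qed (use that uB in blast)
  then obtain a where a: "v \<odot> u - a *s v \<in> F" by blast
  have lE: "line F v \<subseteq> E" using line_least[OF sE _ v(1)] F by (auto simp: Q_def)
  have Eeq: "E = line F v"
  proof (rule ccontr)
    assume "E \<noteq> line F v"
    then have "Q (line F v)" using lE v by (auto simp: Q_def)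
    then show False using mx[of "line F v"] dim_line[OF sF v(2)] by simp
  qed
  \<comment> \<open>Elements killing \<open>F\<close> act on \<open>E = line F v\<close> through the
    image of \<open>v\<close> alone; \<open>T G\<close> consists of those for which this image lies
    in \<open>G\<close>.\<close>
  define T where "T G = {x\<in>U. (\<forall>e\<in>F. e \<odot> x = 0) \<and> v \<odot> x \<in> G}" for G
  have "\<not> P F" using mn[of F] dim_line[OF sF v(2)] Eeq by auto
  then have TJ: "\<not> T J \<subseteq> ?L"
    using F E v(1) ideal_inD(4)[OF J_ideal] unfolding P_def Q_def T_def by blast
  have T0: "T {0} \<subseteq> ?L"
  proof
    fix x assume x: "x \<in> T {0}"
    have "e \<odot> x = 0" if "e \<in> E" for e
    proof -
      have "e \<in> line F v" using that Eeq by simp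
      then obtain c where "e - c *s v \<in> F" unfolding mem_line[OF sF] by blast
      then have "(e - c *s v) \<odot> x = 0" "v \<odot> x = 0" using x by (auto simp: T_def)
      then show ?thesis by (simp add: bracket_simps)
    qed
    then show "x \<in> ?L" using x E by (auto simp: P_def T_def)
  qed
  define S where "S G \<longleftrightarrow> ideal_in G ?B \<and> G \<subseteq> J \<and> T G \<subseteq> ?L" for G
  have "S {0}" using ideal_in_zero[OF subB] T0 subspace_0[OF sJ] by (auto simp: S_def)
  then obtain G where G: "S G" and mxG: "\<And>C. S C \<Longrightarrow> dim C \<le> dim G" using ex_max_dim[of S] by blast
  have sG: "subspace G" and GB: "ideal_in G ?B" using G by (auto simp: S_def dest: ideal_inD)
  have "G \<subset> J" using G TJ by (auto simp: S_def)
  obtain w where w: "w \<in> J" "w \<notin> G" "ideal_in (line G w) ?B" "\<exists>c. w \<odot> u - c *s w \<in> G"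
  proof (rule refine_line_J[OF subB ss GB JB \<open>G \<subset> J\<close> order_refl], goal_cases)
    case (1 v) then show ?case using that uB by blast
  qed
  then obtain b where b: "w \<odot> u - b *s w \<in> G" by blast
  have "\<not> S (line G w)" using mxG[of "line G w"] dim_line[OF sG w(2)] by auto
  then have "\<not> T (line G w) \<subseteq> ?L" using w G line_least[OF sJ _ w(1), of G] by (auto simp: S_def)
  then obtain x where x: "x \<in> T (line G w)" "x \<notin> ?L" by blast
  have xU: "x \<in> U" using x by (simp add: T_def)
  \<comment> \<open>Since \<open>u\<close> has eigenvalue \<open>a\<close> on \<open>v\<close> and
    \<open>b\<close> on \<open>w\<close>, it has eigenvalue \<open>b - a\<close> on an operator
    sending \<open>v\<close> to a multiple of \<open>w\<close>.\<close>
  let ?x = "x \<odot> u - (b - a) *s x"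
  have "?x \<in> T G"
    unfolding T_def
  proof (intro CollectI conjI ballI)
    show "?x \<in> U" using xU u sU UU by (intro subspace_diff subspace_scale) auto
    fix e assume e: "e \<in> F"
    then have "e \<odot> u \<in> F" using ideal_inD(4)[OF FB] uB by blast
    then show "e \<odot> ?x = 0" using e x by (auto simp: T_def bracket_simps leibniz)
  next
    have "(v \<odot> u - a *s v) \<odot> x = 0" using a x by (auto simp: T_def)
    then have vu: "(v \<odot> u) \<odot> x = a *s (v \<odot> x)" by (simp add: bracket_simps)
    obtain c where c: "v \<odot> x - c *s w \<in> G" using x by (auto simp: T_def mem_line[OF sG])
    have "((v \<odot> x - c *s w) \<odot> u - b *s (v \<odot> x - c *s w)) + c *s (w \<odot> u - b *s w) \<in> G"
      using c b ideal_inD(4)[OF GB c uB] by (intro subspace_add[OF sG subspace_diff[OF sG _ subspace_scale[OF sG]] subspace_scale[OF sG]])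
    then have "(v \<odot> x) \<odot> u - b *s (v \<odot> x) \<in> G" by (simp add: bracket_simps algebra_simps)
    then show "v \<odot> ?x \<in> G" by (simp add: bracket_simps leibniz vu algebra_simps)
  qed
  then have "?x \<in> ?L" using G by (auto simp: S_def)
  then show False using noeig[OF xU] x(2) by blast
qed

text \<open>\<open>cent\<close> covers the simple quotient, hence is Lie when proper. Some
  \<open>r \<in> rad\<close> lies outside it, so it acts nontrivially on \<open>J\<close> and is
  generic.\<close>

lemma lie_complement_of_cent:
  assumes "cent \<noteq> U"
  obtains N r where "ideal_in N U" "lie_on N" "J \<subseteq> N" "r \<in> rad" "r \<notin> N" "line N r = U"
proof -
  have sup: "cent \<boxplus> rad = U" using ideal_supplement[OF cent_ideal cent_not_rad] .
  have cU: "cent \<subset> U" using assms ideal_inD(2)[OF cent_ideal] by blast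
  have lie: "lie_on cent" using supplement_lie[OF ideal_in_subalgebra[OF cent_ideal] cU sup] .
  have Jc: "J \<subseteq> cent" using JU J_null by (auto simp: cent_def)
  have "\<not> rad \<subseteq> cent"
  proof
    assume "rad \<subseteq> cent"
    then have "cent \<boxplus> rad \<subseteq> cent" using ideal_inD(1)[OF cent_ideal] by (intro sums_least) auto
    then show False using sup cU by blast
  qed
  then obtain r where r: "r \<in> rad" "r \<notin> cent" by blast
  then have "r \<in> NL" using rad_U by (auto simp: NL_def cent_def)
  then have "line cent r = U" using lie_ideal_of_supplement[OF cent_ideal Jc sup r(1)] by blast
  then show thesis using that[OF cent_ideal lie Jc r] by blast
qed

text \<open>A smallest ideal \<open>N\<close> covering \<open>U / rad\<close> is perfect, hence acts
  trivially on the factors of the chain \<open>R\<close>, and its symmetrised products with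
  \<open>rad\<close> vanish. Either \<open>N = U\<close>, or \<open>N + J\<close> is Lie and an
  element of \<open>rad\<close> with nonzero square serves as \<open>r\<close>.\<close>

lemma lie_complement_or_perfect:
  assumes c: "cent = U"
  obtains N r where "ideal_in N U" "lie_on N" "J \<subseteq> N" "r \<in> rad" "r \<notin> N" "line N r = U"
  | "brackets U = U" "\<And>r t. r \<in> rad \<Longrightarrow> t \<in> U \<Longrightarrow> r \<odot> t + t \<odot> r = 0"
    "\<And>i r t. i < k \<Longrightarrow> r \<in> R (Suc i) \<Longrightarrow> t \<in> U \<Longrightarrow> r \<odot> t \<in> R i"
proof -
  have JU0: "j \<odot> x = 0" if "j \<in> J" "x \<in> U" for j x using c that by (auto simp: cent_def)
  define P where "P N \<longleftrightarrow> ideal_in N U \<and> N \<boxplus> rad = U" for N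
  have "U \<boxplus> rad = U" using sums_superset(1)[OF s_rad, of U] sums_least[OF sU order_refl rad_U] by blast
  then have "P U" using ideal_in_self[OF U] by (simp add: P_def)
  then obtain N where N: "P N" and mn: "\<And>C. P C \<Longrightarrow> dim N \<le> dim C" using ex_min_dim[of P] by blast
  have NI: "ideal_in N U" and Nsup: "N \<boxplus> rad = U" using N by (auto simp: P_def)
  note sN = ideal_inD(1)[OF NI] and NU = ideal_inD(2)[OF NI]
  have subN: "subalgebra N" using NI by (rule ideal_in_subalgebra)
  have BI: "ideal_in (brackets N) U" by (rule brackets_ideal[OF U NI])
  have "brackets N \<boxplus> rad = U"
    using supplement_brackets[OF Nsup NU ideal_inD(1,2)[OF BI]] bracket_in_brackets by blast
  then have "dim N \<le> dim (brackets N)" using mn BI by (simp add: P_def)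
  then have perf: "brackets N = N"
    using brackets_subset[OF subN] sN by (intro subspace_dim_equal subspace_brackets)
  \<comment> \<open>On a one-dimensional factor the action is by scalars, which commute, so products
    of elements of \<open>N\<close> act by zero, and these span \<open>N\<close>.\<close>
  have act: "r \<odot> s \<in> R i" if i: "i < k" and r: "r \<in> R (Suc i)" and s: "s \<in> N" for i r s
  proof (cases "r \<in> R i")
    case True
    then show ?thesis using ideal_inD(4)[OF R_ideal, of i r s] i s NU by auto
  next
    case False
    have Ri: "ideal_in (R i) U" "ideal_in (R (Suc i)) U" using R_ideal i by auto
    note sRi = ideal_inD(1)[OF Ri(1)]
    have eq: "R (Suc i) = line (R i) r"
      using R_step[OF i] r False ideal_inD(1)[OF Ri(1)] ideal_inD(1)[OF Ri(2)] by (intro line_eqI) auto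
    have "brackets N \<subseteq> {s\<in>U. r \<odot> s \<in> R i}"
    proof (rule brackets_least)
      show "subspace {s\<in>U. r \<odot> s \<in> R i}"
        by (rule subspaceI)
          (use sU sRi in \<open>auto simp: bracket_simps subspace_0 subspace_add subspace_scale\<close>)
      fix x y assume "x \<in> N" "y \<in> N"
      then have xy: "x \<in> U" "y \<in> U" using NU by auto
      have ex: "\<exists>c. r \<odot> z - c *s r \<in> R i" if "z \<in> U" for z
        using ideal_inD(4)[OF Ri(2) r that] eq mem_line[OF sRi] by blast
      obtain a where a: "r \<odot> x - a *s r \<in> R i" using ex[OF xy(1)] by blast
      obtain b where b: "r \<odot> y - b *s r \<in> R i" using ex[OF xy(2)] by blast
      have 1: "(r \<odot> x - a *s r) \<odot> y + a *s (r \<odot> y - b *s r) \<in> R i"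
        using ideal_inD(4)[OF Ri(1) a xy(2)] b by (intro subspace_add[OF sRi _ subspace_scale[OF sRi]])
      have 2: "(r \<odot> y - b *s r) \<odot> x + b *s (r \<odot> x - a *s r) \<in> R i"
        using ideal_inD(4)[OF Ri(1) b xy(1)] a by (intro subspace_add[OF sRi _ subspace_scale[OF sRi]])
      have "r \<odot> (x \<odot> y) \<in> R i"
        using subspace_diff[OF sRi 1 2] by (simp add: bracket_simps leibniz algebra_simps)
      then show "x \<odot> y \<in> {s\<in>U. r \<odot> s \<in> R i}" using UU xy by blast
    qed
    then show ?thesis using s perf by blast
  qed
  \<comment> \<open>By the Leibniz identity the symmetrised product of \<open>r\<close> with
    \<open>x \<odot> y\<close> is minus that of \<open>r \<odot> y\<close> with \<open>x\<close>,
    and \<open>r \<odot> y\<close> lies one step lower in the chain.\<close>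
  have b0: "r \<odot> t + t \<odot> r = 0" if "i \<le> k" "r \<in> R i" "t \<in> N" for i r t
    using that
  proof (induction i arbitrary: r t)
    case 0
    then show ?case using JU0[of r t] J_null[of r t] R0 NU by auto
  next
    case (Suc i)
    have "r \<in> U" using Suc ideal_inD(2)[OF R_ideal] by blast
    have "brackets N \<subseteq> {t. r \<odot> t + t \<odot> r = 0}"
    proof (rule brackets_least)
      show "subspace {t. r \<odot> t + t \<odot> r = 0}"
      proof (rule subspaceI)
        fix x y c assume x: "x \<in> {t. r \<odot> t + t \<odot> r = 0}" and y: "y \<in> {t. r \<odot> t + t \<odot> r = 0}"
        have "r \<odot> (x + y) + (x + y) \<odot> r = (r \<odot> x + x \<odot> r) + (r \<odot> y + y \<odot> r)"
          by (simp add: bracket_simps)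
        then show "x + y \<in> {t. r \<odot> t + t \<odot> r = 0}" using x y by simp
        have "r \<odot> (c *s x) + (c *s x) \<odot> r = c *s (r \<odot> x + x \<odot> r)" by (simp add: bracket_simps algebra_simps)
        then show "c *s x \<in> {t. r \<odot> t + t \<odot> r = 0}" using x by simp
      qed (simp add: bracket_simps)
      fix x y assume x: "x \<in> N" and y: "y \<in> N"
      have "r \<odot> y \<in> R i" using act[of i r y] Suc y by auto
      then have 1: "(r \<odot> y) \<odot> x + x \<odot> (r \<odot> y) = 0" using Suc x by auto
      have "(r \<odot> x + x \<odot> r) \<odot> y = 0" using JU0 sym_J[OF \<open>r \<in> U\<close>, of x] x y NU by auto
      then have "((r \<odot> y) \<odot> x + x \<odot> (r \<odot> y)) + (r \<odot> (x \<odot> y) + (x \<odot> y) \<odot> r) = 0"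
        by (simp add: bracket_simps leibniz algebra_simps)
      then show "x \<odot> y \<in> {t. r \<odot> t + t \<odot> r = 0}" unfolding 1 by simp
    qed
    then show ?case using Suc perf by blast
  qed
  show thesis
  proof (cases "N = U")
    case True
    show thesis using that(2) perf b0[of k] act unfolding True rad_def by blast
  next
    case False
    then have lieN: "lie_on N" using supplement_lie[OF subN _ Nsup] NU by blast
    let ?N = "N \<boxplus> J"
    have NI': "ideal_in ?N U" by (intro ideal_in_sums NI J_ideal U)
    have JN: "J \<subseteq> ?N" by (rule sums_superset(2)[OF sN])
    have "N \<boxplus> rad \<subseteq> ?N \<boxplus> rad" using sums_superset(1)[OF sJ] by (intro sums_mono) auto
    moreover have "?N \<boxplus> rad \<subseteq> U" using sums_least[OF sU ideal_inD(2)[OF NI'] rad_U] .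
    ultimately have sup': "?N \<boxplus> rad = U" using Nsup by blast
    have lie': "lie_on ?N"
      unfolding lie_on_def
    proof
      fix x assume "x \<in> ?N"
      then obtain t j where tj: "t \<in> N" "j \<in> J" "x = t + j" by (auto simp: mem_sums)
      then have "t \<odot> t = 0" "j \<odot> t = 0" "j \<odot> j = 0" "t \<odot> j = 0"
        using lieN JU0 J_null NU JU by (auto simp: lie_on_def)
      then show "x \<odot> x = 0" by (simp add: tj bracket_simps)
    qed
    have "\<exists>r\<in>rad. r \<odot> r \<noteq> 0"
    proof (rule ccontr)
      assume no: "\<not> (\<exists>r\<in>rad. r \<odot> r \<noteq> 0)"
      have "x \<odot> x = 0" if x: "x \<in> U" for x
      proof -
        obtain t r where tr: "t \<in> N" "r \<in> rad" "x = t + r" using x Nsup[symmetric] by (auto simp: mem_sums)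
        have "x \<odot> x = t \<odot> t + (r \<odot> t + t \<odot> r) + r \<odot> r" by (simp add: tr bracket_simps)
        then show ?thesis using b0[of k r t] tr lieN no by (auto simp: rad_def lie_on_def)
      qed
      then show False using nonlie by (auto simp: lie_on_def)
    qed
    then obtain r where r: "r \<in> rad" "r \<odot> r \<noteq> 0" by blast
    then have rNL: "r \<in> NL" using rad_U by (auto simp: NL_def)
    have rN: "r \<notin> ?N" using r lie' by (auto simp: lie_on_def)
    show thesis using that(1)[OF NI' lie' JN r(1) rN] lie_ideal_of_supplement[OF NI' JN sup' r(1) rNL] by blast
  qed
qed

end

section \<open>Coordinates and traces modulo a subspace\<close>

context leibniz_fd begin

text \<open>\<open>C\<close> is a basis of \<open>U\<close> modulo \<open>P\<close>, and
  \<open>co\<close> gives coordinates. They come from a basis of the whole space, which makes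
  \<open>co\<close> linear without side conditions.\<close>

lemma coordinates_mod:
  assumes P: "subspace P" and U: "subspace U" and PU: "P \<subseteq> U"
  obtains C :: "'v set" and co :: "'v \<Rightarrow> 'v \<Rightarrow> 'f" where "finite C" "C \<subseteq> U"
    "\<And>x y c. co (x + y) c = co x c + co y c" "\<And>k x c. co (k *s x) c = k * co x c"
    "\<And>p c. p \<in> P \<Longrightarrow> c \<in> C \<Longrightarrow> co p c = 0" "\<And>c d. c \<in> C \<Longrightarrow> co c d = (if d = c then 1 else 0)"
    "\<And>u. u \<in> U \<Longrightarrow> u - (\<Sum>c\<in>C. co u c *s c) \<in> P"
proof -
  obtain E where E: "E \<subseteq> P" "independent E" "P \<subseteq> span E" "card E = dim P" by (rule basis_exists)
  obtain G where G: "E \<subseteq> G" "G \<subseteq> U" "independent G" "U \<subseteq> span G"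
    by (rule maximal_independent_subset_extend[OF subset_trans[OF E(1) PU] E(2)])
  define H where "H = extend_basis G"
  have H: "G \<subseteq> H" "independent H" "span H = UNIV"
    using extend_basis_superset[OF G(3)] independent_extend_basis[OF G(3)] span_extend_basis[OF G(3)]
    by (auto simp: H_def)
  define co where "co = representation H"
  define C where "C = G - E"
  have finG: "finite G" by (rule finiteI_independent[OF G(3)])
  have coG: "co u = representation G u" if "u \<in> U" for u
    unfolding co_def using representation_extend[OF H(2) _ H(1)] G(4) that by blast
  have coE: "co p c = 0" if "p \<in> P" "c \<in> C" for p c
  proof -
    have "co p = representation E p"
      unfolding co_def using representation_extend[OF H(2)] E(3) G(1) H(1) that(1) by blast
    then show ?thesis using representation_ne_zero[of E p c] that by (auto simp: C_def)
  qed
  have sumG: "(\<Sum>c\<in>G. co u c *s c) = u" if "u \<in> U" for u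
    using sum_representation_eq[OF G(3) _ finG order_refl, of u] G(4) that coG[OF that] by auto
  show thesis
  proof (rule that[of C co])
    show "finite C" "C \<subseteq> U" using finG G by (auto simp: C_def)
    show "co (x + y) c = co x c + co y c" "co (k *s x) c = k * co x c" for x y c k
      using H by (auto simp: co_def representation_add representation_scale)
    show "co c d = (if d = c then 1 else 0)" if "c \<in> C" for c d
      using representation_basis[OF H(2), of c] that G(1) H(1) by (auto simp: co_def C_def)
    show "co p c = 0" if "p \<in> P" "c \<in> C" for p c using coE that .
    fix u assume u: "u \<in> U"
    have "u = (\<Sum>c\<in>C. co u c *s c) + (\<Sum>c\<in>E. co u c *s c)"
      using sumG[OF u] sum.subset_diff[OF G(1) finG, of "\<lambda>c. co u c *s c"] by (simp add: C_def)
    moreover have "(\<Sum>c\<in>E. co u c *s c) \<in> P"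
      using E P by (intro subspace_sum subspace_scale) auto
    ultimately show "u - (\<Sum>c\<in>C. co u c *s c) \<in> P" by (metis add_diff_cancel_left')
  qed
qed

lemma linear_sum_scale:
  assumes "Vector_Spaces.linear scale scale f"
  shows "f (\<Sum>c\<in>C. k c *s g c) = (\<Sum>c\<in>C. k c *s f (g c))"
proof -
  have lin: "f (x + y) = f x + f y" "f (a *s x) = a *s f x" for x y a using assms by (auto simp: linear_iff_local)
  have "f 0 = 0" using lin(2)[of 0 0] by simp
  then show ?thesis by (induction C rule: infinite_finite_induct) (auto simp: lin)
qed

lemma linear_combination_linear:
  assumes "\<And>x y c. co (x + y) c = co x c + co y c" "\<And>k x c. co (k *s x) c = k * co x c"
  shows "Vector_Spaces.linear scale scale (\<lambda>v. \<Sum>c\<in>C. co v c *s e c)"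
  by (auto simp: linear_iff_local assms scale_left_distrib sum.distrib scale_sum_right)

text \<open>Taking traces on \<open>U / P\<close> of \<open>D - X D X\<^sup>-\<^sup>1 = c\<close> kills \<open>c\<close> in characteristic zero.\<close>

lemma commutator_scalar_zero:
  assumes P: "subspace P" and U: "subspace U" and PU: "P \<subset> U"
    and X: "Vector_Spaces.linear scale scale X" "X ` P \<subseteq> P" "X ` U \<subseteq> U"
    and D: "Vector_Spaces.linear scale scale D" "D ` P \<subseteq> P" "D ` U \<subseteq> U"
    and inj: "\<And>u. u \<in> U \<Longrightarrow> X u \<in> P \<Longrightarrow> u \<in> P"
    and comm: "\<And>u. u \<in> U \<Longrightarrow> D (X u) - X (D u) - c *s X u \<in> P"
  shows "c = 0"
proof -
  have PU': "P \<subseteq> U" using PU by blast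
  obtain C and co :: "'v \<Rightarrow> 'v \<Rightarrow> 'f" where C: "finite C" "C \<subseteq> U"
    and add: "\<And>x y c. co (x + y) c = co x c + co y c" and scl: "\<And>k x c. co (k *s x) c = k * co x c"
    and co0: "\<And>p c. p \<in> P \<Longrightarrow> c \<in> C \<Longrightarrow> co p c = 0"
    and coC: "\<And>c d. c \<in> C \<Longrightarrow> co c d = (if d = c then 1 else 0)"
    and cosum: "\<And>u. u \<in> U \<Longrightarrow> u - (\<Sum>c\<in>C. co u c *s c) \<in> P"
    using coordinates_mod[OF P U PU'] by blast
  have dif: "co (x - y) c = co x c - co y c" for x y c
    using add[of "x - y" y c] by simp
  have co_eq: "co x d = co y d" if "x - y \<in> P" "d \<in> C" for x y d
    using co0[OF that] by (simp add: dif)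
  have Xd: "X (x - y) = X x - X y" and Dd: "D (x - y) = D x - D y" for x y
    using X(1) D(1) by (auto simp: linear_iff_local) (metis add_diff_cancel_right' diff_add_cancel)+
  have cosum': "co (\<Sum>e\<in>C. k e *s g e) d = (\<Sum>e\<in>C. k e * co (g e) d)" for k g d
    using C(1)
  proof (induction rule: finite_induct)
    case empty then show ?case using scl[of 0 0 d] by simp
  next
    case insert then show ?case by (simp add: add scl)
  qed
  have mat: "co (O' u) d = (\<Sum>e\<in>C. co u e * co (O' e) d)"
    if O': "Vector_Spaces.linear scale scale O'" "O' ` P \<subseteq> P" and u: "u \<in> U" and d: "d \<in> C" for O' u d
  proof -
    let ?s = "\<Sum>e\<in>C. co u e *s e"
    have "O' (u - ?s) \<in> P" using cosum[OF u] O'(2) by blast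
    moreover have "O' u = O' (u - ?s) + O' ?s"
      using O'(1) by (metis diff_add_cancel linear_iff_local)
    ultimately have "co (O' u) d = co (O' ?s) d" using co0 d by (simp add: add)
    then show ?thesis by (simp add: linear_sum_scale[OF O'(1)] cosum')
  qed
  have tr: "(\<Sum>e\<in>C. co (A (B e)) e) = (\<Sum>e\<in>C. co (B (A e)) e)"
    if A: "Vector_Spaces.linear scale scale A" "A ` P \<subseteq> P" "A ` U \<subseteq> U"
      and B: "Vector_Spaces.linear scale scale B" "B ` P \<subseteq> P" "B ` U \<subseteq> U" for A B
  proof -
    have "(\<Sum>e\<in>C. co (A (B e)) e) = (\<Sum>e\<in>C. \<Sum>d\<in>C. co (B e) d * co (A d) e)"
      using C(2) B(3) by (intro sum.cong refl mat A) auto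
    also have "\<dots> = (\<Sum>d\<in>C. \<Sum>e\<in>C. co (A d) e * co (B e) d)"
      by (subst sum.swap) (simp add: mult.commute)
    also have "\<dots> = (\<Sum>d\<in>C. co (B (A d)) d)"
      using C(2) A(3) by (intro sum.cong refl mat[symmetric] B) auto
    finally show ?thesis .
  qed
  have "\<exists>w\<in>U. e - X w \<in> P" if "e \<in> C" for e
    using surj_mod[OF X(1) P U X(2,3) inj, of e] that C(2) by blast
  then obtain w where w: "\<And>e. e \<in> C \<Longrightarrow> w e \<in> U" "\<And>e. e \<in> C \<Longrightarrow> e - X (w e) \<in> P" by metis
  \<comment> \<open>\<open>Y\<close> inverts \<open>X\<close> modulo \<open>P\<close>: surjectivity
    provides the preimages \<open>w\<close>, and injectivity turns the right inverse into a left
    inverse.\<close>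
  define Y where "Y v = (\<Sum>e\<in>C. co v e *s w e)" for v
  have Y: "Vector_Spaces.linear scale scale Y" unfolding Y_def by (rule linear_combination_linear[OF add scl])
  have YP: "Y p = 0" if "p \<in> P" for p using co0[OF that] by (simp add: Y_def)
  have YU: "Y v \<in> U" for v unfolding Y_def using w U by (intro subspace_sum subspace_scale) auto
  have XY: "u - X (Y u) \<in> P" if "u \<in> U" for u
  proof -
    have "X (Y u) = (\<Sum>e\<in>C. co u e *s X (w e))" unfolding Y_def by (rule linear_sum_scale[OF X(1)])
    then have "u - X (Y u) = (u - (\<Sum>e\<in>C. co u e *s e)) + (\<Sum>e\<in>C. co u e *s (e - X (w e)))"
      by (simp add: scale_right_diff_distrib sum_subtractf)
    also have "\<dots> \<in> P" using cosum[OF that] w by (intro subspace_add subspace_sum subspace_scale P) auto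
    finally show ?thesis .
  qed
  have YX: "u - Y (X u) \<in> P" if u: "u \<in> U" for u
  proof (rule inj)
    show "u - Y (X u) \<in> U" by (rule subspace_diff[OF U u YU])
    show "X (u - Y (X u)) \<in> P" using XY[of "X u"] X(3) u by (auto simp: Xd)
  qed
  have E: "Vector_Spaces.linear scale scale (\<lambda>v. D (Y v))"
    using D(1) Y by (auto simp: linear_iff_local)
  have D0: "D 0 = 0" using Dd[of 0 0] by simp
  \<comment> \<open>The two sides are evaluated below as the traces of \<open>D - c\<close> and of
    \<open>D\<close>.\<close>
  have t1: "(\<Sum>e\<in>C. co (X (D (Y e))) e) = (\<Sum>e\<in>C. co (D (Y (X e))) e)"
  proof (rule tr[OF X E])
    show "(\<lambda>v. D (Y v)) ` P \<subseteq> P" using YP subspace_0[OF P] by (auto simp: D0)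
    show "(\<lambda>v. D (Y v)) ` U \<subseteq> U" using YU D(3) by blast
  qed
  have "(\<Sum>e\<in>C. co (D (Y (X e))) e) = (\<Sum>e\<in>C. co (D e) e)"
  proof (rule sum.cong[OF refl])
    fix e assume e: "e \<in> C"
    have "D (e - Y (X e)) \<in> P" using YX[of e] e C(2) D(2) by blast
    then have "D e - D (Y (X e)) \<in> P" by (simp add: Dd)
    then show "co (D (Y (X e))) e = co (D e) e" using co_eq e by metis
  qed
  moreover have "(\<Sum>e\<in>C. co (X (D (Y e))) e) = (\<Sum>e\<in>C. co (D e) e - c)"
  proof (rule sum.cong[OF refl])
    fix e assume e: "e \<in> C"
    have eU: "e \<in> U" using e C by blast
    have 1: "D (e - X (Y e)) \<in> P" using XY[OF eU] D(2) by blast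
    have 2: "c *s (e - X (Y e)) \<in> P" using XY[OF eU] by (rule subspace_scale[OF P])
    have "D (e - X (Y e)) + (D (X (Y e)) - X (D (Y e)) - c *s X (Y e)) - c *s (e - X (Y e)) \<in> P"
      by (rule subspace_diff[OF P subspace_add[OF P 1 comm[OF YU]] 2])
    then have "(D e - c *s e) - X (D (Y e)) \<in> P" by (simp add: Dd algebra_simps)
    then have "co (D e - c *s e) e = co (X (D (Y e))) e" using e by (rule co_eq)
    then show "co (X (D (Y e))) e = co (D e) e - c" by (simp add: dif scl coC[OF e])
  qed
  ultimately have "of_nat (card C) * c = 0" using t1 by (simp add: sum_subtractf)
  moreover have "C \<noteq> {}"
  proof
    assume "C = {}"
    then have "U \<subseteq> P" using cosum by auto
    then show False using PU by blast
  qed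
  ultimately show ?thesis using C(1) by simp
qed

lemma ex_linear_functional:
  assumes "z \<noteq> 0"
  obtains \<phi> :: "'v \<Rightarrow> 'f" where "\<And>x y. \<phi> (x + y) = \<phi> x + \<phi> y" "\<And>k x. \<phi> (k *s x) = k * \<phi> x" "\<phi> z \<noteq> 0"
proof -
  have ind: "independent {z}" using assms by simp
  let ?H = "extend_basis {z}"
  have H: "independent ?H" "span ?H = UNIV" "z \<in> ?H"
    using independent_extend_basis[OF ind] span_extend_basis[OF ind] extend_basis_superset[OF ind] by auto
  show thesis
    using that[of "\<lambda>x. representation ?H x z"] H
    by (auto simp: representation_add representation_scale representation_basis)
qed

end

section \<open>Exclusion of the perfect case and of the Lie complement\<close>

context strange_step begin

text \<open>\<open>\<phi> (x \<odot> y)\<close> is a bilinear form on \<open>U / rad\<close> with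
  invariant nondegenerate symmetrisation \<open>b\<close>, so it is \<open>b (D x) y + b x y\<close>
  for some \<open>D\<close>, which the Leibniz identity makes a derivation modulo
  \<open>rad\<close>. An inner \<open>D\<close> would give \<open>b (D x0) x0 = 0\<close>, but the
  value is \<open>- \<phi> (x0 \<odot> x0)\<close>. Adding an inner derivation turns
  \<open>x0\<close> into an eigenvector of eigenvalue minus one half, and traces give the
  contradiction.\<close>

lemma perfect_impossible:
  assumes c: "cent = U" and perf: "brackets U = U"
    and b0: "\<And>r t. r \<in> rad \<Longrightarrow> t \<in> U \<Longrightarrow> r \<odot> t + t \<odot> r = 0"
    and act: "\<And>i r t. i < k \<Longrightarrow> r \<in> R (Suc i) \<Longrightarrow> t \<in> U \<Longrightarrow> r \<odot> t \<in> R i"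
  shows False
proof -
  have JU0: "j \<odot> x = 0" if "j \<in> J" "x \<in> U" for j x using c that by (auto simp: cent_def)
  obtain x0 where x0: "x0 \<in> U" "x0 \<odot> x0 \<noteq> 0" using nonlie by (auto simp: lie_on_def)
  obtain \<phi> where add: "\<And>x y. \<phi> (x + y) = \<phi> x + \<phi> y" and scl: "\<And>k x. \<phi> (k *s x) = k * \<phi> x"
    and t: "\<phi> (x0 \<odot> x0) \<noteq> 0" using ex_linear_functional[OF x0(2)] by blast
  have \<phi>0: "\<phi> 0 = 0" using scl[of 0 0] by simp
  have dif: "\<phi> (x - y) = \<phi> x - \<phi> y" for x y using add[of "x - y" y] by simp
  define b where "b x y = \<phi> (x \<odot> y + y \<odot> x)" for x y
  have b_add: "b (x + y) z = b x z + b y z" "b z (x + y) = b z x + b z y" for x y z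
    by (simp_all add: b_def bracket_simps add)
  have b_scl: "b (k *s x) z = k * b x z" "b z (k *s x) = k * b z x" for k x z
    by (simp_all add: b_def bracket_simps add scl algebra_simps)
  have b_dif: "b (x - y) z = b x z - b y z" for x y z using b_add(1)[of "x - y" y z] by simp
  have b_sym: "b x y = b y x" for x y by (simp add: b_def add.commute)
  have bJ: "b j x = 0" if "j \<in> J" "x \<in> U" for j x using JU0 J_null that by (simp add: b_def \<phi>0)
  \<comment> \<open>Symmetrised products lie in \<open>J\<close>, which right multiplication by
    \<open>z\<close> annihilates; as that is a derivation, \<open>b\<close> is invariant.\<close>
  have b_inv: "b (x \<odot> z) y + b x (y \<odot> z) = 0" if "x \<in> U" "y \<in> U" "z \<in> U" for x y z
  proof -
    have "(x \<odot> y + y \<odot> x) \<odot> z = 0" using JU0[OF sym_J] that by blast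
    then have "(x \<odot> z) \<odot> y + y \<odot> (x \<odot> z) + (x \<odot> (y \<odot> z) + (y \<odot> z) \<odot> x) = 0"
      by (simp add: bracket_simps leibniz algebra_simps)
    then show ?thesis by (simp add: b_def add[symmetric] \<phi>0)
  qed
  have b_rad: "b r x = 0" if "r \<in> rad" "x \<in> U" for r x using b0[OF that] by (simp add: b_def \<phi>0)
  have \<phi>R: "\<phi> (r \<odot> y) = 0" if "i \<le> k" "r \<in> R i" "y \<in> U" for i r y
    using that
  proof (induction i arbitrary: r y)
    case 0 then show ?case using JU0 R0 by (simp add: \<phi>0)
  next
    case (Suc i)
    have "brackets U \<subseteq> {y. \<phi> (r \<odot> y) = 0}"
    proof (rule brackets_least)
      show "subspace {y. \<phi> (r \<odot> y) = 0}"
        by (rule subspaceI) (auto simp: bracket_simps \<phi>0 add scl)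
      show "x \<odot> y \<in> {y. \<phi> (r \<odot> y) = 0}" if "x \<in> U" "y \<in> U" for x y
        using Suc act[of i r x] act[of i r y] that by (simp add: leibniz dif)
    qed
    then show ?case using Suc perf by blast
  qed
  have \<phi>rad: "\<phi> (r \<odot> y) = 0" if "r \<in> rad" "y \<in> U" for r y
    using \<phi>R[of k] that by (simp add: rad_def)
  have b_nondeg: "e \<in> rad" if e: "e \<in> U" "\<And>y. y \<in> U \<Longrightarrow> b e y = 0" for e
  proof -
    let ?N = "{x\<in>U. \<forall>y\<in>U. b x y = 0}"
    have "ideal_in ?N U"
    proof (rule ideal_aboveI)
      have "b 0 y = 0" for y using b_scl(1)[of 0 0 y] by simp
      then show "subspace ?N"
        using sU by (intro subspaceI) (auto simp: b_add b_scl subspace_add subspace_scale subspace_0)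
      show "J \<subseteq> ?N" using bJ JU by blast
      show "w \<odot> x \<in> ?N" if "w \<in> ?N" "x \<in> U" for w x
      proof -
        have "b (w \<odot> x) y = 0" if "y \<in> U" for y
          using b_inv[of w y x] \<open>w \<in> ?N\<close> \<open>x \<in> U\<close> that UU[OF that \<open>x \<in> U\<close>] by simp
        then show ?thesis using UU that by blast
      qed
    qed blast
    moreover have "rad \<subseteq> ?N" using b_rad rad_U by blast
    moreover have "?N \<noteq> U"
    proof
      assume "?N = U"
      then have "b x0 x0 = 0" using x0 by blast
      then show False using t by (simp add: b_def add)
    qed
    ultimately have "?N = rad" using ideal_above_rad by blast
    then show ?thesis using e by blast
  qed
  obtain C and co :: "'b \<Rightarrow> 'b \<Rightarrow> 'a" where C: "finite C" "C \<subseteq> U"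
    and coadd: "\<And>x y c. co (x + y) c = co x c + co y c" and coscl: "\<And>k x c. co (k *s x) c = k * co x c"
    and co0: "\<And>p c. p \<in> rad \<Longrightarrow> c \<in> C \<Longrightarrow> co p c = 0"
    and coC: "\<And>c d. c \<in> C \<Longrightarrow> co c d = (if d = c then 1 else 0)"
    and cosum: "\<And>u. u \<in> U \<Longrightarrow> u - (\<Sum>c\<in>C. co u c *s c) \<in> rad"
    using coordinates_mod[OF s_rad sU rad_U] by blast
  have cosum': "co (\<Sum>e\<in>C. k e *s e) d = k d" if "d \<in> C" for k d
  proof -
    have "co (\<Sum>e\<in>C'. k e *s e) d = (\<Sum>e\<in>C'. if e = d then k e else 0)" if "finite C'" "C' \<subseteq> C" for C'
      using that
    proof (induction rule: finite_induct)
      case empty then show ?case using coscl[of 0 0 d] by simp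
    next
      case insert then show ?case using coC by (auto simp: coadd coscl)
    qed
    from this[of C] show ?thesis using C that by (simp add: sum.delta')
  qed
  have lin_ext: "g (u :: 'b) = (\<Sum>c\<in>C. co u c * g c)"
    if g: "\<And>x y. g (x + y) = g x + g y" "\<And>k x. g (k *s x) = k * g x" "\<And>r. r \<in> rad \<Longrightarrow> g r = 0"
      and u: "u \<in> U" for g and u
  proof -
    have "g (\<Sum>c\<in>C'. co u c *s c) = (\<Sum>c\<in>C'. co u c * g c)" if "finite C'" for C'
      using that by (induction rule: finite_induct) (use g(2)[of 0 0] in \<open>auto simp: g\<close>)
    moreover have "g u = g (u - (\<Sum>c\<in>C. co u c *s c)) + g (\<Sum>c\<in>C. co u c *s c)"
      by (simp add: g(1)[symmetric])
    ultimately show ?thesis using g(3)[OF cosum[OF u]] C by simp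
  qed
  have repr: "\<exists>e\<in>U. \<forall>y\<in>U. b e y = g y"
    if g: "\<And>x y. g (x + y) = g x + g y" "\<And>k x. g (k *s x) = k * g x" "\<And>r. r \<in> rad \<Longrightarrow> g r = 0" for g
  proof -
    define F where "F e = (\<Sum>c\<in>C. b e c *s c)" for e
    have coF: "co (F e) d = b e d" if "d \<in> C" for e d unfolding F_def using cosum'[OF that] .
    have ext: "b e y = (\<Sum>c\<in>C. co y c * b e c)" if "e \<in> U" "y \<in> U" for e y
      using lin_ext[of "b e" y] b_add b_scl b_rad b_sym that by auto
    let ?a = "\<Sum>c\<in>C. g c *s c"
    have aU: "?a \<in> U" using C by (intro subspace_sum sU subspace_scale) auto
    obtain e where e: "e \<in> U" "?a - F e \<in> rad"
    proof (rule surj_mod[OF _ s_rad sU _ _ _ aU])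
      show "Vector_Spaces.linear scale scale F"
        unfolding F_def by (rule linear_combination_linear) (simp_all add: b_add b_scl)
      show "F ` rad \<subseteq> rad"
      proof
        fix v assume "v \<in> F ` rad"
        then obtain r where r: "r \<in> rad" "v = F r" by blast
        have "F r = 0" unfolding F_def using b_rad[OF r(1)] C by (intro sum.neutral) auto
        then show "v \<in> rad" using r subspace_0[OF s_rad] by simp
      qed
      show "F ` U \<subseteq> U" unfolding F_def using C by (auto intro!: subspace_sum sU subspace_scale)
      show "e \<in> rad" if "e \<in> U" "F e \<in> rad" for e
      proof (rule b_nondeg[OF that(1)])
        fix y assume y: "y \<in> U"
        have "b e c = 0" if "c \<in> C" for c using coF[OF that, of e] co0[OF \<open>F e \<in> rad\<close> that] by simp
        then show "b e y = 0" using ext[OF that(1) y] by simp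
      qed
    qed blast
    have "b e c = g c" if "c \<in> C" for c
    proof -
      have "co ?a c = co (?a - F e) c + co (F e) c" by (simp add: coadd[symmetric])
      then show ?thesis using co0[OF e(2) that] cosum'[OF that] coF[OF that] by simp
    qed
    then have "b e y = g y" if "y \<in> U" for y using ext[OF e(1) that] lin_ext[OF g that] by simp
    then show ?thesis using e by blast
  qed
  \<comment> \<open>The right side is \<open>- \<phi> (y \<odot> d)\<close>. Without the term
    \<open>b d y\<close> the operator would be a derivation plus the identity modulo
    \<open>rad\<close>.\<close>
  have "\<exists>e\<in>U. \<forall>y\<in>U. b e y = \<phi> (d \<odot> y) - b d y" if d: "d \<in> C" for d
  proof (rule repr)
    have dU: "d \<in> U" using d C by blast
    fix r assume r: "r \<in> rad"
    have "\<phi> (d \<odot> r) = 0"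
      using \<phi>rad[OF r dU] b_rad[OF r dU] by (simp add: b_def add)
    moreover have "b d r = 0" using b_rad[OF r dU] b_sym by simp
    ultimately show "\<phi> (d \<odot> r) - b d r = 0" by simp
  qed (simp_all add: bracket_simps add scl b_add b_scl algebra_simps)
  then obtain e where e: "\<And>d. d \<in> C \<Longrightarrow> e d \<in> U" "\<And>d y. d \<in> C \<Longrightarrow> y \<in> U \<Longrightarrow> b (e d) y = \<phi> (d \<odot> y) - b d y"
    by metis
  define D where "D v = (\<Sum>d\<in>C. co v d *s e d)" for v
  have linD: "Vector_Spaces.linear scale scale D" unfolding D_def by (rule linear_combination_linear[OF coadd coscl])
  have D_add: "D (x + y) = D x + D y" for x y using linD by (simp add: linear_iff_local)
  have DU: "D v \<in> U" for v unfolding D_def using e by (intro subspace_sum sU subspace_scale) auto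
  have Drad: "D r = 0" if "r \<in> rad" for r using co0[OF that] by (simp add: D_def)
  have bD: "b (D x) y = \<phi> (x \<odot> y) - b x y" if x: "x \<in> U" and y: "y \<in> U" for x y
  proof -
    have "b (\<Sum>d\<in>C'. co x d *s e d) y = (\<Sum>d\<in>C'. co x d * b (e d) y)" if "finite C'" for C'
      using that by (induction rule: finite_induct) (use b_scl(1)[of 0 0 y] in \<open>auto simp: b_add b_scl\<close>)
    then have "b (D x) y = (\<Sum>d\<in>C. co x d * (\<phi> (d \<odot> y) - b d y))" using C e y by (simp add: D_def)
    also have "\<dots> = \<phi> (x \<odot> y) - b x y"
      by (rule lin_ext[symmetric])
        (use x y b_rad \<phi>rad in \<open>auto simp: bracket_simps add scl b_add b_scl algebra_simps\<close>)
    finally show ?thesis .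
  qed
  have deriv: "D (x \<odot> y) - (D x \<odot> y + x \<odot> D y) \<in> rad" if x: "x \<in> U" and y: "y \<in> U" for x y
  proof (rule b_nondeg)
    show "D (x \<odot> y) - (D x \<odot> y + x \<odot> D y) \<in> U"
      by (rule subspace_diff[OF sU DU subspace_add[OF sU UU[OF DU y] UU[OF x DU]]])
    fix w assume w: "w \<in> U"
    have 1: "b (D (x \<odot> y)) w = \<phi> ((x \<odot> y) \<odot> w) - b (x \<odot> y) w" by (rule bD[OF UU[OF x y] w])
    have 2: "b (D x \<odot> y) w = - (\<phi> (x \<odot> (w \<odot> y)) - b x (w \<odot> y))"
      using b_inv[OF DU[of x] w y] bD[OF x UU[OF w y]] by (metis eq_neg_iff_add_eq_0)
    have "b (x \<odot> D y) w + b (D y \<odot> x) w = 0"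
      using bJ[OF sym_J[OF x DU[of y]] w] by (simp add: b_add)
    then have 3: "b (x \<odot> D y) w = \<phi> (y \<odot> (w \<odot> x)) - b y (w \<odot> x)"
      using b_inv[OF DU[of y] w x] bD[OF y UU[OF w x]] by (simp add: algebra_simps add_eq_0_iff)
    have 4: "b x (w \<odot> y) = - b (x \<odot> y) w" using b_inv[OF x w y] by (simp add: add_eq_0_iff)
    have "(x \<odot> w + w \<odot> x) \<odot> y = 0" using JU0[OF sym_J[OF x w] y] .
    then have 5: "\<phi> ((x \<odot> w) \<odot> y) + \<phi> ((w \<odot> x) \<odot> y) = 0"
      by (simp add: bracket_simps add[symmetric] \<phi>0)
    show "b (D (x \<odot> y) - (D x \<odot> y + x \<odot> D y)) w = 0"
      unfolding b_dif b_add 1 2 3 4 using 5 by (simp add: b_def leibniz add dif algebra_simps)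
  qed
  have x0rad: "x0 \<notin> rad"
  proof
    assume "x0 \<in> rad"
    then have "\<phi> (x0 \<odot> x0) = 0" using \<phi>rad x0 by blast
    then show False using t by simp
  qed
  let ?P = "line rad x0"
  have sP: "subspace ?P" by (rule subspace_line)
  have radP: "rad \<subseteq> ?P" by (rule line_superset)
  have PU: "?P \<subset> U" using line_least[OF sU rad_U x0(1)] line_rad_ne[OF x0(1)] by blast
  let ?X = "\<lambda>x. x \<odot> x0"
  have injX: "u \<in> ?P" if "u \<in> U" "u \<odot> x0 \<in> ?P" for u
    using no_plane[OF x0(1) x0rad that(1)] that(2) line_superset[of ?P u] by blast
  have XU: "?X ` U \<subseteq> U" using UU x0 by blast
  have XP: "?X ` ?P \<subseteq> ?P"
  proof
    fix v assume "v \<in> ?X ` ?P"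
    then obtain p where p: "p \<in> ?P" "v = p \<odot> x0" by blast
    then obtain a where a: "p - a *s x0 \<in> rad" by (auto simp: mem_line[OF s_rad])
    have "(p - a *s x0) \<odot> x0 + a *s (x0 \<odot> x0) \<in> rad"
      using ideal_inD(4)[OF rad_ideal a x0(1)] square_J[OF x0(1)] J_rad
      by (intro subspace_add[OF s_rad _ subspace_scale[OF s_rad]]) auto
    then show "v \<in> ?P" using p radP by (auto simp: bracket_simps)
  qed
  \<comment> \<open>With coefficient one half \<open>?e\<close> is orthogonal to \<open>x0\<close>,
    since \<open>b x0 x0\<close> is twice \<open>\<phi> (x0 \<odot> x0)\<close>.\<close>
  define h :: 'a where "h = 1 / 2"
  have hh: "h + h = 1" by (simp add: h_def)
  let ?e = "D x0 + h *s x0"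
  have eU: "?e \<in> U" by (rule subspace_add[OF sU DU subspace_scale[OF sU x0(1)]])
  \<comment> \<open>By \<open>no_plane\<close>, right multiplication by \<open>x0\<close> is
    injective modulo \<open>?P\<close>, hence surjective. The leftover multiple \<open>a\<close> of
    \<open>x0\<close> is zero, because both \<open>?e\<close> and \<open>y \<odot> x0\<close> are
    orthogonal to \<open>x0\<close>.\<close>
  obtain y where y: "y \<in> U" "?e - y \<odot> x0 \<in> ?P"
    using surj_mod[OF linear_right_mult sP sU XP XU injX eU] by blast
  then obtain a where a: "?e - y \<odot> x0 - a *s x0 \<in> rad" by (auto simp: mem_line[OF s_rad])
  have bx0: "b x0 x0 = \<phi> (x0 \<odot> x0) + \<phi> (x0 \<odot> x0)" by (simp add: b_def add)
  have "b (y \<odot> x0) x0 = 0"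
    using b_inv[OF y(1) x0(1) x0(1)] bJ[OF square_J[OF x0(1)] y(1)] b_sym by simp
  moreover have "b (D x0) x0 + h * b x0 x0 = 0"
  proof -
    have "h * b x0 x0 = (h + h) * \<phi> (x0 \<odot> x0)" unfolding bx0 by (simp add: algebra_simps)
    then show ?thesis unfolding hh using bD[OF x0(1) x0(1)] bx0 by simp
  qed
  ultimately have "a * b x0 x0 = 0" using b_rad[OF a x0(1)] by (simp add: b_dif b_add b_scl)
  moreover have "b x0 x0 \<noteq> 0" using t bx0 by simp
  ultimately have a0: "a = 0" by simp
  \<comment> \<open>The corrected derivation: right multiplication by \<open>y\<close> is added so
    that \<open>x0\<close> has eigenvalue \<open>- h\<close> modulo \<open>rad\<close>.\<close>
  define E where "E v = D v + v \<odot> y" for v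
  have Ex0: "E x0 + h *s x0 \<in> rad"
  proof -
    have "(?e - y \<odot> x0) + (x0 \<odot> y + y \<odot> x0) \<in> rad"
    proof (rule subspace_add[OF s_rad])
      show "?e - y \<odot> x0 \<in> rad" using a a0 by simp
      show "x0 \<odot> y + y \<odot> x0 \<in> rad" using sym_J[OF x0(1) y(1)] J_rad by blast
    qed
    then show ?thesis by (simp add: E_def algebra_simps)
  qed
  have linE: "Vector_Spaces.linear scale scale E"
    using linD by (auto simp: E_def linear_iff_local bracket_simps algebra_simps)
  have EU: "E u \<in> U" if "u \<in> U" for u unfolding E_def using that y UU by (intro subspace_add[OF sU DU]) auto
  have Erad: "E r \<in> rad" if "r \<in> rad" for r
    using ideal_inD(4)[OF rad_ideal that y(1)] Drad[OF that] by (simp add: E_def)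
  have EP: "E ` ?P \<subseteq> ?P"
  proof
    fix v assume "v \<in> E ` ?P"
    then obtain p where p: "p \<in> ?P" "v = E p" by blast
    then obtain a where a: "p - a *s x0 \<in> rad" by (auto simp: mem_line[OF s_rad])
    have "E p = E (p - a *s x0) + a *s (E x0 + h *s x0) - (a * h) *s x0"
      using linE by (simp add: linear_iff_local scale_right_distrib) (metis diff_add_cancel)
    moreover have "E (p - a *s x0) \<in> ?P" using Erad[OF a] radP by blast
    moreover have "E x0 + h *s x0 \<in> ?P" using Ex0 radP by blast
    ultimately show "v \<in> ?P" using p line_self[of x0 rad] by (simp add: subspace_add subspace_diff subspace_scale sP)
  qed
  have "- h = 0"
  proof (rule commutator_scalar_zero[OF sP sU PU linear_right_mult XP XU linE EP])
    show "E ` U \<subseteq> U" using EU by blast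
    show "u \<in> ?P" if "u \<in> U" "u \<odot> x0 \<in> ?P" for u by (rule injX[OF that])
    fix u assume u: "u \<in> U"
    have "D (u \<odot> x0) - (D u \<odot> x0 + u \<odot> D x0) + u \<odot> (E x0 + h *s x0) \<in> rad"
      using deriv[OF u x0(1)] ideal_inD(3)[OF rad_ideal Ex0 u] by (simp add: subspace_add s_rad)
    then have "E (u \<odot> x0) - E u \<odot> x0 - (- h) *s (u \<odot> x0) \<in> rad"
      by (simp add: E_def bracket_simps leibniz algebra_simps)
    then show "E (u \<odot> x0) - E u \<odot> x0 - (- h) *s (u \<odot> x0) \<in> ?P" using radP by blast
  qed
  then show False by (simp add: h_def)
qed

text \<open>Modulo \<open>V\<close>, the algebra \<open>U\<close> is the sum of the line
  \<open>rad\<close> and the Lie ideal \<open>N\<close>, the only complement of this line. The line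
  must be the \<open>S\<close> of \<open>rk_three\<close>, and \<open>N\<close> has two crossed
  lines, so \<open>rk_three\<close> produces a second complement.\<close>

lemma lie_complement_impossible:
  assumes N: "ideal_in N U" "lie_on N" "J \<subseteq> N" and r: "r \<in> rad" "r \<notin> N" and Nr: "line N r = U"
  shows False
proof -
  define V where "V = N \<inter> rad"
  note sN = ideal_inD(1)[OF N(1)] and NU = ideal_inD(2)[OF N(1)]
  have subN: "subalgebra N" using N(1) by (rule ideal_in_subalgebra)
  have VI: "ideal_in V U" unfolding V_def by (intro ideal_in_Int N rad_ideal)
  note sV = ideal_inD(1)[OF VI] and VU = ideal_inD(2)[OF VI]
  have subV: "subalgebra V" using VI by (rule ideal_in_subalgebra)
  have JV: "J \<subseteq> V" using N(3) J_rad by (simp add: V_def)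
  have rU: "r \<in> U" using r rad_U by blast
  have rV: "r \<notin> V" using r by (simp add: V_def)
  have rad_line: "rad = line V p" if "p \<in> rad" "p \<notin> V" for p
  proof -
    have "rad \<subseteq> line V r"
    proof
      fix x assume x: "x \<in> rad"
      then have "x \<in> line N r" using Nr rad_U by blast
      then obtain a where "x - a *s r \<in> N" unfolding mem_line[OF sN] by blast
      moreover have "x - a *s r \<in> rad" using x r s_rad by (simp add: subspace_diff subspace_scale)
      ultimately show "x \<in> line V r" unfolding mem_line[OF sV] by (auto simp: V_def)
    qed
    then have "dim rad \<le> dim (line V r)" by (rule dim_subset)
    also have "\<dots> \<le> Suc (dim V)" by (rule dim_line_le)
    finally show ?thesis using that sV s_rad by (intro line_eqI) (auto simp: V_def)
  qed
  have Vrad: "V \<subseteq> rad" by (simp add: V_def)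
  have "dim rad = Suc (dim V)" using dim_line[OF sV rV] rad_line[OF r(1) rV] by metis
  then have rkV: "rk rad = Suc (rk V)" by (rule rk_codim_one[OF subV rad_subalgebra Vrad])
  have rkU: "rk U = rk V + 3" using rkV rk_rad by simp
  have dimU: "dim U = Suc (dim N)" using dim_line[OF sN r(2)] Nr by simp
  have rkN: "rk N = rk V + 2" using rk_codim_one[OF subN U NU dimU] rkU by simp
  have subVx: "subalgebra (line V x)" if "x \<in> U" for x using line_ideal_subalgebra[OF VI JV that] .
  have rkVx: "rk (line V x) = Suc (rk V)" if "x \<in> U" "x \<notin> V" for x
    using dim_line[OF sV that(2)] by (intro rk_codim_one subV subVx that line_superset)
  have VxU: "line V x \<subseteq> U" if "x \<in> U" for x using line_least[OF sU VU that] .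
  \<comment> \<open>The products of such an \<open>X\<close> cover the perfect quotient
    \<open>U / rad\<close>, and products of \<open>U\<close> lie in \<open>N\<close>; the rest of
    \<open>X\<close> lies in \<open>X \<inter> rad\<close>, which is contained in
    \<open>V\<close>.\<close>
  have uniq: "X \<subseteq> N" if X: "subalgebra X" "V \<subseteq> X" "X \<subseteq> U" "\<not> rad \<subseteq> X" "X \<boxplus> rad = U" for X
  proof
    note sX = subalgebraD(1)[OF X(1)]
    fix x assume x: "x \<in> X"
    have "brackets X \<boxplus> rad = U"
      using supplement_brackets[OF X(5,3) subspace_brackets] brackets_subset[OF X(1)] X(3) bracket_in_brackets
      by blast
    then obtain c p where cp: "c \<in> brackets X" "p \<in> rad" "x = c + p"
      using x X(3) unfolding mem_sums[symmetric] by (metis mem_sums subsetD)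
    have cX: "c \<in> X" using cp brackets_subset[OF X(1)] by blast
    have "brackets X \<subseteq> N"
      using polycyclic_brackets[OF N(1) U dimU] X(3) by (intro brackets_least sN) blast
    then have cN: "c \<in> N" using cp by blast
    have pX: "p \<in> X" using subspace_diff[OF sX x cX] cp by simp
    have "p \<in> V"
    proof (rule ccontr)
      assume "p \<notin> V"
      then have "rad = line V p" using rad_line cp by blast
      then show False using line_least[OF sX X(2) pX] X(4) by simp
    qed
    then show "x \<in> N" using cN cp sN by (auto simp: V_def intro: subspace_add)
  qed
  have sup: "X \<boxplus> rad = U" if X: "subalgebra X" "V \<subseteq> X" "X \<subseteq> U" "p \<in> X" "p \<notin> rad" "q \<in> X \<boxplus> rad" "q \<notin> line rad p" for X p q
  proof (rule ccontr)
    assume ne: "X \<boxplus> rad \<noteq> U"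
    note sX = subalgebraD(1)[OF X(1)]
    have eq: "X \<boxplus> rad = rad \<boxplus> X" by (auto simp: mem_sums) (metis add.commute)+
    have "subalgebra (X \<boxplus> rad)" unfolding eq by (rule subalgebra_sums[OF rad_ideal X(1,3)])
    moreover have "rad \<subseteq> X \<boxplus> rad" by (rule sums_superset(2)[OF sX])
    moreover have "X \<boxplus> rad \<subseteq> U" by (rule sums_least[OF sU X(3) rad_U])
    moreover have "p \<in> X \<boxplus> rad" using X(4) sums_superset(1)[OF s_rad] by blast
    ultimately have "X \<boxplus> rad = line rad p" using ne X(5) by (intro between)
    then show False using X by simp
  qed
  obtain S where S: "subalgebra S" "V \<subseteq> S" "S \<subseteq> U" "rk S = Suc (rk V)"
    and S_join: "\<forall>B. subalgebra B \<and> V \<subseteq> B \<and> B \<subseteq> U \<longrightarrow>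
      (\<exists>X. subalgebra X \<and> S \<subseteq> X \<and> B \<subseteq> X \<and> X \<subseteq> U \<and> rk X \<le> Suc (rk B))"
    and S_compl: "\<forall>N T1 T2. subalgebra N \<and> V \<subseteq> N \<and> N \<subseteq> U \<and> rk N = rk V + 2 \<and> lie_on N \<and> \<not> S \<subseteq> N \<and>
      T1 \<noteq> T2 \<and> crossed rk V S N T1 \<and> crossed rk V S N T2 \<longrightarrow>
      (\<exists>A. subalgebra A \<and> V \<subseteq> A \<and> A \<subseteq> U \<and> rk A = rk V + 2 \<and> A \<noteq> N \<and> \<not> S \<subseteq> A)"
    using rk_three[OF U subV VU rkU] by (elim exE conjE) (rule that)
  \<comment> \<open>If \<open>S\<close> had an element \<open>p\<close> outside \<open>rad\<close>,
    its join with the line of \<open>t + r\<close> would have rank at most \<open>rk V + 2\<close>,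
    cover \<open>U / rad\<close> and contain \<open>t + r \<notin> N\<close>, against
    \<open>uniq\<close>.\<close>
  have "S = rad"
  proof -
    have "V \<noteq> S" using S by auto
    then obtain p where p: "p \<in> S" "p \<notin> V" using S by blast
    have pU: "p \<in> U" using p S by blast
    show ?thesis
    proof (cases "p \<in> rad")
      case True
      then have "rad \<subseteq> S" using rad_line[OF True p(2)] line_least[OF subalgebraD(1)[OF S(1)] S(2) p(1)] by simp
      then show ?thesis using rkV S rad_subalgebra by (intro rk_eqI[symmetric]) auto
    next
      case False
      have "\<not> N \<subseteq> line rad p"
      proof
        assume "N \<subseteq> line rad p"
        then have "U \<subseteq> line rad p"
          using line_least[OF subspace_line, of N rad p r] r line_superset[of rad p] Nr by blast
        then show False using line_rad_ne[OF pU] line_least[OF sU rad_U pU] by blast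
      qed
      then obtain t where t: "t \<in> N" "t \<notin> line rad p" by blast
      let ?x = "t + r"
      have xU: "?x \<in> U" using t NU rU sU by (auto intro: subspace_add)
      have xN: "?x \<notin> N"
      proof
        assume "?x \<in> N"
        from subspace_diff[OF sN this t(1)] show False using r by simp
      qed
      have xV: "?x \<notin> V" using xN by (simp add: V_def)
      obtain X where X: "subalgebra X" "S \<subseteq> X" "line V ?x \<subseteq> X" "X \<subseteq> U" "rk X \<le> Suc (rk (line V ?x))"
        using S_join subVx[OF xU] line_superset[of V ?x] VxU[OF xU] by blast
      have xX: "?x \<in> X" using X(3) line_self by blast
      have VX: "V \<subseteq> X" using S X by blast
      have "t \<in> X \<boxplus> rad"
        unfolding mem_sums using xX r s_rad by (intro bexI[of _ ?x] bexI[of _ "- r"]) (auto simp: subspace_neg)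
      then have Xs: "X \<boxplus> rad = U" using sup[OF X(1) VX X(4)] p X False t by blast
      have "\<not> rad \<subseteq> X"
      proof
        assume "rad \<subseteq> X"
        then have "X = U" using Xs sums_least[OF subalgebraD(1)[OF X(1)] order_refl, of rad] X(4) by blast
        then show False using X(5) rkVx[OF xU xV] rkU by simp
      qed
      then have "X \<subseteq> N" using uniq[OF X(1) VX X(4) _ Xs] by blast
      then show ?thesis using xX xN by blast
    qed
  qed
  have "V \<noteq> N" using rkN by auto
  then obtain t1 where t1: "t1 \<in> N" "t1 \<notin> V" by (auto simp: V_def)
  have t1U: "t1 \<in> U" using t1 NU by blast
  have "line V t1 \<noteq> N" using rkVx[OF t1U t1(2)] rkN by auto
  moreover have "line V t1 \<subseteq> N" using t1 by (intro line_least sN) (auto simp: V_def)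
  ultimately obtain t2 where t2: "t2 \<in> N" "t2 \<notin> line V t1" by blast
  have t2U: "t2 \<in> U" using t2 NU by blast
  have t2V: "t2 \<notin> V" using t2 line_superset by blast
  \<comment> \<open>The third line is spanned by \<open>t + r\<close>, in the plane
    \<open>line rad t\<close>.\<close>
  have cr: "crossed rk V rad N (line V t)" if t: "t \<in> N" "t \<notin> V" for t
  proof -
    have "line V t \<subseteq> N \<and> line V (t + r) \<subseteq> line rad t \<and> rk (line V (t + r)) = Suc (rk V) \<and> line V (t + r) \<noteq> rad \<and>
      line V (t + r) \<noteq> line V t \<and> subalgebra (line rad t) \<and> line V t \<subseteq> line rad t \<and>
      rk (line rad t) \<le> rk V + 2 \<and> subalgebra (line V (t + r))"
    proof -
    have tU: "t \<in> U" using t NU by blast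
    have trad: "t \<notin> rad" using t by (simp add: V_def)
    have xU: "t + r \<in> U" by (rule subspace_add[OF sU tU rU])
    have xN: "t + r \<notin> N"
    proof
      assume "t + r \<in> N"
      from subspace_diff[OF sN this t(1)] show False using r by simp
    qed
    have xrad: "t + r \<notin> rad"
    proof
      assume "t + r \<in> rad"
      from subspace_diff[OF s_rad this r(1)] show False using trad by simp
    qed
    have lVN: "line V t \<subseteq> N" using t by (intro line_least sN) (auto simp: V_def)
    have "t + r \<in> line rad t"
      using r line_superset[of rad t] line_self[of t rad] by (intro subspace_add subspace_line) auto
    then have "line V (t + r) \<subseteq> line rad t"
      using Vrad line_superset[of rad t] by (intro line_least subspace_line) auto
    moreover have "rk (line V (t + r)) = Suc (rk V)" using xN by (intro rkVx xU) (auto simp: V_def)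
    moreover have "line V (t + r) \<noteq> rad" "line V (t + r) \<noteq> line V t"
      using xrad xN lVN line_self[of "t + r" V] by auto
    moreover have "subalgebra (line rad t)" by (rule line_ideal_subalgebra[OF rad_ideal J_rad tU])
    moreover have "line V t \<subseteq> line rad t" using Vrad by (rule line_mono)
    moreover have "rk (line rad t) \<le> rk V + 2" using rk_line_rad[OF tU trad] rkV by simp
    ultimately show ?thesis using lVN subVx[OF xU] by blast
    qed
    moreover have "t \<in> U" using t NU by blast
    ultimately show ?thesis
      unfolding crossed_def using subVx[of t] rkVx[OF _ t(2)] line_superset[of V t] line_superset[of V "t + r"]
        line_superset[of rad t] by blast
  qed
  have VN: "V \<subseteq> N" by (simp add: V_def)
  have ne: "line V t1 \<noteq> line V t2" using t2(2) line_self by blast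
  have rN: "\<not> rad \<subseteq> N" using r by blast
  have "\<exists>A. subalgebra A \<and> V \<subseteq> A \<and> A \<subseteq> U \<and> rk A = rk V + 2 \<and> A \<noteq> N \<and> \<not> rad \<subseteq> A"
    by (rule S_compl[unfolded \<open>S = rad\<close>, rule_format, of N "line V t1" "line V t2"], intro conjI)
      (fact subN VN NU rkN N(2) rN ne cr[OF t1] cr[OF t2(1) t2V])+
  then obtain A where A: "subalgebra A" "V \<subseteq> A" "A \<subseteq> U" "rk A = rk V + 2" "A \<noteq> N" "\<not> rad \<subseteq> A"
    by (elim exE conjE)
  note sA = subalgebraD(1)[OF A(1)]
  have eq: "A \<boxplus> rad = rad \<boxplus> A" by (auto simp: mem_sums) (metis add.commute)+
  have subAr: "subalgebra (A \<boxplus> rad)" unfolding eq by (rule subalgebra_sums[OF rad_ideal A(1,3)])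
  have AU: "A \<boxplus> rad \<subseteq> U" by (rule sums_least[OF sU A(3) rad_U])
  have "A \<subset> A \<boxplus> rad" using sums_superset(1)[OF s_rad] sums_superset(2)[OF sA] A(6) by blast
  then have "rk A < rk (A \<boxplus> rad)" by (intro rk_strict A subAr)
  then have "A \<boxplus> rad = U" using AU subAr U A(4) rkU by (intro rk_eqI) auto
  then have "A \<subseteq> N" using uniq[OF A(1,2,3,6)] by blast
  then show False using A(4,5) rkN A(1) subN rk_eqI by fastforce
qed

end

section \<open>End of the induction\<close>

context nonlie_step begin

lemma polycyclic: "polycyclic U"
proof (rule polycyclic_or_strange)
  fix R :: "nat \<Rightarrow> 'b set" and k
  assume *: "R 0 = J" "\<And>i. i \<le> k \<Longrightarrow> ideal_in (R i) U"
    "\<And>i. i < k \<Longrightarrow> R i \<subseteq> R (Suc i) \<and> dim (R (Suc i)) \<le> Suc (dim (R i))" "J \<subseteq> R k"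
    "rk (R k) + 2 = rk U"
    "\<And>x y. x \<in> U \<Longrightarrow> x \<notin> R k \<Longrightarrow> y \<in> U \<Longrightarrow> y \<notin> line (R k) x \<Longrightarrow> y \<odot> x \<notin> line (line (R k) x) y"
  interpret strange_step scale bracket Basis rk U R k
    by unfold_locales (use * in auto)
  have False
  proof (cases "cent = U")
    case True
    show False
      by (rule lie_complement_or_perfect[OF True]) (use lie_complement_impossible perfect_impossible[OF True] in blast)+
  next
    case False
    show False by (rule lie_complement_of_cent[OF False]) (use lie_complement_impossible in blast)
  qed
  then show ?thesis ..
qed

end

context subalgebra_rank begin

lemma polycyclic_of_not_lie:
  assumes "subalgebra U" "\<not> lie_on U"
  shows "polycyclic U"
  using assms
proof (induction "dim U" arbitrary: U rule: less_induct)
  case less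
  interpret nonlie_step scale bracket Basis rk U
  proof
    fix V assume "subalgebra V" "V \<subset> U" "\<not> lie_on V"
    then show "polycyclic V" using less dim_psubset_subspace[of V U] by (auto dest: subalgebraD)
  qed (use less in auto)
  show ?case by (rule polycyclic)
qed

theorem supersolvable_of_not_lie:
  assumes "\<not> lie_on UNIV"
  shows "supersolvable"
  using polycyclic_of_not_lie[OF subalgebra_UNIV assms] polycyclic_imp_supersolvable_on supersolvable_on_UNIV
  by blast

end

section \<open>The lattice of a supersolvable algebra\<close>

context leibniz_fd begin

lemma supersolvable_chain:
  assumes "supersolvable" and K: "subalgebra K"
  obtains E :: "nat \<Rightarrow> 'v set" and n where "E 0 = {0}" "E n = K" "\<And>i. i \<le> n \<Longrightarrow> ideal_in (E i) K"
    "\<And>i. i < n \<Longrightarrow> E i \<subseteq> E (Suc i) \<and> dim (E (Suc i)) \<le> Suc (dim (E i))"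
proof -
  obtain n and I :: "nat \<Rightarrow> 'v set" where I: "I 0 = {0}" "I n = UNIV" "\<forall>i<n. I i \<subset> I (Suc i)"
    "\<forall>i\<le>n. ideal (I i) \<and> dim (I i) = i"
    using assms(1) unfolding supersolvable_def by blast
  note sK = subalgebraD(1)[OF K]
  have I': "ideal_in (I i) UNIV" if "i \<le> n" for i
    using I(4) that by (auto simp: ideal_in_def ideal_def)
  show thesis
  proof (rule that[of "\<lambda>i. I i \<inter> K" n])
    show "I 0 \<inter> K = {0}" "I n \<inter> K = K" using I sK by (auto simp: subspace_0)
    show "ideal_in (I i \<inter> K) K" if "i \<le> n" for i using I'[OF that] K by (intro ideal_in_restrict) auto
    fix i assume i: "i < n"
    have s: "subspace (I i)" "subspace (I (Suc i))" using I'[of i] I'[of "Suc i"] i by (auto dest: ideal_inD)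
    have le: "I i \<subseteq> I (Suc i)" using I(3) i by blast
    have d: "dim (I (Suc i)) = Suc (dim (I i))" using I(4) i by simp
    have "dim (I (Suc i) \<inter> K) \<le> Suc (dim ((I (Suc i) \<inter> K) \<inter> I i))"
      by (rule dim_Int_codim_one[OF s le d subspace_inter[OF s(2) sK]]) auto
    also have "(I (Suc i) \<inter> K) \<inter> I i = I i \<inter> K" using le by blast
    finally show "I i \<inter> K \<subseteq> I (Suc i) \<inter> K \<and> dim (I (Suc i) \<inter> K) \<le> Suc (dim (I i \<inter> K))" using le by blast
  qed
qed

text \<open>\<open>E\<close> is the first ideal of the chain not inside \<open>A\<close> and
  \<open>F\<close> its predecessor. Joining a subalgebra above \<open>F\<close> with
  \<open>E\<close> adds at most one dimension.\<close>

lemma first_step_outside: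
  assumes "supersolvable" and K: "subalgebra K" and A: "subalgebra A" "A \<subset> K"
  obtains F E where "ideal_in F K" "F \<subseteq> A" "ideal_in E K" "F \<subseteq> E" "\<not> E \<subseteq> A" "dim E \<le> Suc (dim F)"
proof -
  obtain E :: "nat \<Rightarrow> 'v set" and n where E: "E 0 = {0}" "E n = K" "\<And>i. i \<le> n \<Longrightarrow> ideal_in (E i) K"
    "\<And>i. i < n \<Longrightarrow> E i \<subseteq> E (Suc i) \<and> dim (E (Suc i)) \<le> Suc (dim (E i))"
    using supersolvable_chain[OF assms(1) K] by blast
  have "\<not> E n \<subseteq> A" using E(2) A by blast
  then obtain i where i: "\<not> E i \<subseteq> A" "\<And>j. j < i \<Longrightarrow> E j \<subseteq> A" "i \<le> n"
    using exists_least_iff[of "\<lambda>i. \<not> E i \<subseteq> A"] by (metis not_less)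
  have "i \<noteq> 0" using i(1) E(1) subspace_0[OF subalgebraD(1)[OF A(1)]] by (cases i) auto
  then obtain j where j: "i = Suc j" by (cases i) auto
  show thesis
    using that[of "E j" "E i"] i j E(3)[of j] E(3)[of i] E(4)[of j] by auto
qed

lemma dim_sums_le_Suc:
  assumes "subspace E" "subspace B" "F \<subseteq> B" "F \<subseteq> E" "dim E \<le> Suc (dim F)"
  shows "dim (E \<boxplus> B) \<le> Suc (dim B)"
proof -
  have "dim F \<le> dim (E \<inter> B)" using assms by (intro dim_subset) auto
  then show ?thesis using dim_sums[OF assms(1,2)] assms(5) by linarith
qed

lemma subalgebra_plane:
  assumes V: "subalgebra V"
    and "\<And>v. v \<in> V \<Longrightarrow> a \<odot> v \<in> W" "\<And>v. v \<in> V \<Longrightarrow> v \<odot> a \<in> W"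
      "\<And>v. v \<in> V \<Longrightarrow> b \<odot> v \<in> W" "\<And>v. v \<in> V \<Longrightarrow> v \<odot> b \<in> W"
      "a \<odot> a \<in> W" "a \<odot> b \<in> W" "b \<odot> a \<in> W" "b \<odot> b \<in> W"
    and W: "W = line (line V a) b"
  shows "subalgebra W"
  unfolding subalgebra_def
proof (intro conjI ballI)
  note sV = subalgebraD(1)[OF V]
  show sW: "subspace W" by (simp add: W subspace_line)
  have dec: "\<exists>v k l. v \<in> V \<and> u = v + k *s a + l *s b" if "u \<in> W" for u
  proof -
    obtain l where "u - l *s b \<in> line V a" using \<open>u \<in> W\<close> unfolding W mem_line[OF subspace_line] by blast
    then obtain k where "u - l *s b - k *s a \<in> V" unfolding mem_line[OF sV] by blast
    then show ?thesis by (intro exI[of _ "u - l *s b - k *s a"] exI[of _ k] exI[of _ l]) simp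
  qed
  have VW: "V \<subseteq> W" using line_superset unfolding W by blast
  fix u u' assume "u \<in> W" "u' \<in> W"
  then obtain v k l v' k' l' where u: "v \<in> V" "u = v + k *s a + l *s b" "v' \<in> V" "u' = v' + k' *s a + l' *s b"
    using dec by metis
  have "u \<odot> u' = v \<odot> v' + (k' *s (v \<odot> a) + l' *s (v \<odot> b)) + (k *s (a \<odot> v') + l *s (b \<odot> v'))
      + ((k * k') *s (a \<odot> a) + (k * l') *s (a \<odot> b)) + ((l * k') *s (b \<odot> a) + (l * l') *s (b \<odot> b))"
    by (simp add: u bracket_simps algebra_simps)
  moreover have "v \<odot> v' \<in> W" using subalgebraD(2)[OF V] u VW by blast
  ultimately show "u \<odot> u' \<in> W" using assms u sW by (simp add: subspace_add subspace_scale)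
qed

text \<open>The bracket with \<open>z\<close> is scalar modulo the ideal \<open>F\<close>; the extra subalgebra through
  \<open>a + c z\<close> forces these scalars to be those of the action on \<open>a\<close>.\<close>

lemma crossed_weights:
  assumes N: "subalgebra N" "lie_on N" "V \<subseteq> N" and V: "subalgebra V" and FV: "F \<subseteq> V"
    and z: "z \<notin> N" "z \<odot> z \<in> F"
    and lam: "\<forall>x\<in>U. z \<odot> x - lam x *s z \<in> F \<and> x \<odot> z - mu x *s z \<in> F"
    and NU: "N \<subseteq> U" and a: "a \<in> N" "a \<notin> V" and c: "c \<noteq> 0"
    and la: "subalgebra (line V a)" and lc: "subalgebra (line V (a + c *s z))"
  shows "mu a = - lam a"
    and "v \<in> V \<Longrightarrow> mu v = - lam v"
    and "v \<in> V \<Longrightarrow> a \<odot> v - lam v *s a \<in> V"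
    and "v \<in> V \<Longrightarrow> v \<odot> a + lam v *s a \<in> V"
proof -
  note sV = subalgebraD(1)[OF V] and sN = subalgebraD(1)[OF N(1)]
  have ind: "p = 0 \<and> q = 0" if "p *s a + q *s z \<in> V" for p q
  proof -
    have "(p *s a + q *s z) - p *s a \<in> N"
      using that N(3) a by (intro subspace_diff[OF sN _ subspace_scale[OF sN]]) auto
    then have "q *s z \<in> N" by simp
    then have "q = 0" using z mem_scaleD[OF sN] by blast
    then show ?thesis using that a mem_scaleD[OF sV, of p a] by auto
  qed
  let ?w = "a + c *s z"
  have w: "?w \<in> line V ?w" by (rule line_self)
  have Vw: "V \<subseteq> line V ?w" by (rule line_superset)
  have scal: "\<exists>k. u - k *s ?w \<in> V" if "u \<in> line V ?w" for u using that by (simp add: mem_line[OF sV])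
  have main: "mu v = - lam v \<and> a \<odot> v - lam v *s a \<in> V \<and> v \<odot> a + lam v *s a \<in> V" if v: "v \<in> V" for v
  proof -
    have vU: "v \<in> U" using v N NU by blast
    have l1: "z \<odot> v - lam v *s z \<in> V" and m1: "v \<odot> z - mu v *s z \<in> V" using lam vU FV by blast+
    have "a \<odot> v \<in> line V a" using subalgebraD(2)[OF la line_self] v line_superset by blast
    then obtain k where k: "a \<odot> v - k *s a \<in> V" unfolding mem_line[OF sV] by blast
    have "?w \<odot> v \<in> line V ?w" using subalgebraD(2)[OF lc w] v Vw by blast
    then obtain l where l: "?w \<odot> v - l *s ?w \<in> V" using scal by blast
    have "(?w \<odot> v - l *s ?w) - (a \<odot> v - k *s a) - c *s (z \<odot> v - lam v *s z) \<in> V"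
      by (rule subspace_diff[OF sV subspace_diff[OF sV l k] subspace_scale[OF sV l1]])
    then have "(k - l) *s a + (c * (lam v - l)) *s z \<in> V" by (simp add: bracket_simps algebra_simps)
    then have "k - l = 0 \<and> c * (lam v - l) = 0" by (rule ind)
    then have "k = lam v" using c by auto
    then have av: "a \<odot> v - lam v *s a \<in> V" using k by simp
    have anti: "v \<odot> a = - (a \<odot> v)" using lie_on_anti[OF N(2) sN] v N(3) a by blast
    have va: "v \<odot> a + lam v *s a \<in> V" using subspace_neg[OF sV av] by (simp add: anti algebra_simps)
    have "v \<odot> ?w \<in> line V ?w" using subalgebraD(2)[OF lc _ w] v Vw by blast
    then obtain m where m: "v \<odot> ?w - m *s ?w \<in> V" using scal by blast
    have "(v \<odot> ?w - m *s ?w) - (v \<odot> a + lam v *s a) - c *s (v \<odot> z - mu v *s z) \<in> V"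
      by (rule subspace_diff[OF sV subspace_diff[OF sV m va] subspace_scale[OF sV m1]])
    then have "(- lam v - m) *s a + (c * (mu v - m)) *s z \<in> V" by (simp add: bracket_simps algebra_simps)
    then have "- lam v - m = 0 \<and> c * (mu v - m) = 0" by (rule ind)
    then have "mu v = - lam v" using c by auto
    then show ?thesis using av va by blast
  qed
  show "v \<in> V \<Longrightarrow> mu v = - lam v" "v \<in> V \<Longrightarrow> a \<odot> v - lam v *s a \<in> V" "v \<in> V \<Longrightarrow> v \<odot> a + lam v *s a \<in> V"
    using main by blast+
  have aU: "a \<in> U" using a NU by blast
  have l1: "z \<odot> a - lam a *s z \<in> V" and m1: "a \<odot> z - mu a *s z \<in> V" using lam aU FV by blast+
  have zz: "z \<odot> z \<in> V" using z FV by blast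
  have aa: "a \<odot> a = 0" using N(2) a by (simp add: lie_on_def)
  obtain k where k: "?w \<odot> ?w - k *s ?w \<in> V" using scal subalgebraD(2)[OF lc w w] by blast
  have "(?w \<odot> ?w - k *s ?w) - c *s (z \<odot> a - lam a *s z) - c *s (a \<odot> z - mu a *s z) - (c * c) *s (z \<odot> z) \<in> V"
    by (rule subspace_diff[OF sV subspace_diff[OF sV subspace_diff[OF sV k subspace_scale[OF sV l1]]
            subspace_scale[OF sV m1]] subspace_scale[OF sV zz]])
  then have "(- k) *s a + (c * (lam a + mu a) - k * c) *s z \<in> V"
    by (simp add: bracket_simps aa algebra_simps)
  then have "- k = 0 \<and> c * (lam a + mu a) - k * c = 0" by (rule ind)
  then have "lam a + mu a = 0" using c by auto
  then show "mu a = - lam a" by (metis add.commute eq_neg_iff_add_eq_0)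
qed

text \<open>The new complement is sought as the span over \<open>V\<close> of
  \<open>a + s *s z\<close> and \<open>b + t *s z\<close>. By \<open>crossed_weights\<close>,
  \<open>V\<close> acts on \<open>a\<close> and \<open>b\<close> as on \<open>z\<close>, so only the
  product of the two generators imposes a condition: one homogeneous linear equation in
  \<open>s\<close> and \<open>t\<close>. A nonzero solution gives
  \<open>W \<noteq> N\<close>.\<close>

lemma other_complement:
  assumes N: "subalgebra N" "lie_on N" "V \<subseteq> N" "N \<subseteq> U" and V: "subalgebra V"
    and F: "ideal_in F U" "F \<subseteq> V" and z: "z \<in> U" "z \<notin> N" and E: "ideal_in (line F z) U"
    and a: "a \<in> N" "a \<notin> V" and b: "b \<in> N" "b \<notin> line V a" and Neq: "N = line (line V a) b"
    and la: "subalgebra (line V a)" and lb: "subalgebra (line V b)"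
    and c: "c \<noteq> 0" "subalgebra (line V (a + c *s z))" and d: "d \<noteq> 0" "subalgebra (line V (b + d *s z))"
    and sU: "subspace U"
  obtains W where "subalgebra W" "V \<subseteq> W" "W \<subseteq> U" "dim W = dim V + 2" "W \<noteq> N" "z \<notin> W"
proof -
  note sV = subalgebraD(1)[OF V] and sN = subalgebraD(1)[OF N(1)] and sF = ideal_inD(1)[OF F(1)]
  have zF: "z \<notin> F" using z F N by blast
  have ex: "\<exists>k. u - k *s z \<in> F" if "u \<in> line F z" for u using that by (simp add: mem_line[OF sF])
  have "\<exists>l m. z \<odot> x - l *s z \<in> F \<and> x \<odot> z - m *s z \<in> F" if "x \<in> U" for x
    using ex ideal_inD(3,4)[OF E line_self that] by blast
  then obtain lam mu where lam: "\<And>x. x \<in> U \<Longrightarrow> z \<odot> x - lam x *s z \<in> F"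
    and mu: "\<And>x. x \<in> U \<Longrightarrow> x \<odot> z - mu x *s z \<in> F" by metis
  have zz: "z \<odot> z \<in> F"
  proof -
    have "z \<odot> (z \<odot> z - lam z *s z) \<in> F" using ideal_inD(3)[OF F(1) lam[OF z(1)] z(1)] .
    then have 1: "- (lam z *s (z \<odot> z)) \<in> F" by (simp add: bracket_simps bracket_square_zero)
    have "lam z *s (z \<odot> z - lam z *s z) + - (lam z *s (z \<odot> z)) \<in> F"
      by (rule subspace_add[OF sF subspace_scale[OF sF lam[OF z(1)]] 1])
    then have "(- (lam z * lam z)) *s z \<in> F" by (simp add: algebra_simps)
    then have "lam z = 0" using zF mem_scaleD[OF sF, of "- (lam z * lam z)" z] by auto
    then show ?thesis using lam[OF z(1)] by simp
  qed
  have lm: "\<forall>x\<in>U. z \<odot> x - lam x *s z \<in> F \<and> x \<odot> z - mu x *s z \<in> F" using lam mu by blast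
  have bV: "b \<notin> V" using b line_superset by blast
  note wa = crossed_weights[OF N(1,2,3) V F(2) z(2) zz lm N(4) a c(1) la c(2)]
  note wb = crossed_weights[OF N(1,2,3) V F(2) z(2) zz lm N(4) b(1) bV d(1) lb d(2)]
  have "a \<odot> b \<in> N" using subalgebraD(2)[OF N(1) a(1) b(1)] .
  then obtain y where "a \<odot> b - y *s b \<in> line V a" unfolding Neq mem_line[OF subspace_line] by blast
  then obtain x where xy: "a \<odot> b - y *s b - x *s a \<in> V" unfolding mem_line[OF sV] by blast
  \<comment> \<open>The coefficient of \<open>z\<close> in \<open>a1 \<odot> b1\<close> is
    \<open>s * lam b - t * lam a\<close> modulo \<open>V\<close>, while that in
    \<open>x *s a1 + y *s b1\<close> is \<open>x * s + y * t\<close>; the equation says that they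
    agree.\<close>
  obtain s t where st: "s * (lam b - x) = t * (lam a + y)" "s \<noteq> 0 \<or> t \<noteq> 0"
  proof (cases "lam b = x \<and> lam a + y = 0")
    case True then show thesis using that[of 1 0] by simp
  next
    case False
    then show thesis using that[of "lam a + y" "lam b - x"] by (auto simp: mult.commute)
  qed
  define a1 where "a1 = a + s *s z"
  define b1 where "b1 = b + t *s z"
  define W where "W = line (line V a1) b1"
  have aU: "a \<in> U" and bU: "b \<in> U" using a b N by auto
  have sW: "subspace W" by (simp add: W_def subspace_line)
  have VW: "V \<subseteq> W" and a1W: "a1 \<in> W" and b1W: "b1 \<in> W"
    using line_superset line_self unfolding W_def by blast+
  have inW: "u \<in> W" if "u - k *s a1 - l *s b1 \<in> V" for u k l
  proof -
    have "(u - k *s a1 - l *s b1) + (k *s a1 + l *s b1) \<in> W"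
      using that VW a1W b1W sW by (intro subspace_add[OF sW] subspace_scale[OF sW]) auto
    then show ?thesis by simp
  qed
  have FVD: "u \<in> V" if "u \<in> F" for u using that F(2) by blast
  have one: "w1 \<odot> v - lam v *s w1 \<in> V \<and> v \<odot> w1 + lam v *s w1 \<in> V"
    if w: "w \<odot> v - lam v *s w \<in> V" "v \<odot> w + lam v *s w \<in> V" "mu v = - lam v" and v: "v \<in> V"
      and w1: "w1 = w + r *s z" for w w1 v r
  proof -
    have vU: "v \<in> U" using v N by blast
    have "(w \<odot> v - lam v *s w) + r *s (z \<odot> v - lam v *s z) \<in> V"
      by (rule subspace_add[OF sV w(1) subspace_scale[OF sV FVD[OF lam[OF vU]]]])
    moreover have "(v \<odot> w + lam v *s w) + r *s (v \<odot> z - mu v *s z) \<in> V"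
      by (rule subspace_add[OF sV w(2) subspace_scale[OF sV FVD[OF mu[OF vU]]]])
    ultimately show ?thesis by (simp add: w1 w(3) bracket_simps algebra_simps)
  qed
  have oa: "a1 \<odot> v - lam v *s a1 \<in> V" "v \<odot> a1 + lam v *s a1 \<in> V" if "v \<in> V" for v
    using one[OF wa(3,4)[OF that] wa(2)[OF that] that a1_def] by auto
  have ob: "b1 \<odot> v - lam v *s b1 \<in> V" "v \<odot> b1 + lam v *s b1 \<in> V" if "v \<in> V" for v
    using one[OF wb(3,4)[OF that] wb(2)[OF that] that b1_def] by auto
  have sq: "w1 \<odot> w1 \<in> V" if w: "w \<in> N" "mu w = - lam w" and w1: "w1 = w + r *s z" for w w1 r
  proof -
    have wU: "w \<in> U" using w N by blast
    have ww: "w \<odot> w = 0" using N(2) w by (simp add: lie_on_def)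
    have "r *s ((w \<odot> z - mu w *s z) + (z \<odot> w - lam w *s z)) + (r * r) *s (z \<odot> z) \<in> V"
      using FVD[OF lam[OF wU]] FVD[OF mu[OF wU]] FVD[OF zz] by (simp add: subspace_add subspace_scale sV)
    then show ?thesis by (simp add: w1 w(2) ww bracket_simps algebra_simps)
  qed
  have st': "s * lam b - t * lam a = x * s + y * t" using st(1) by (simp add: algebra_simps)
  have "(a \<odot> b - y *s b - x *s a) + t *s (a \<odot> z - mu a *s z) + s *s (z \<odot> b - lam b *s z) + (s * t) *s (z \<odot> z) \<in> V"
    using xy FVD[OF lam[OF bU]] FVD[OF mu[OF aU]] FVD[OF zz] by (simp add: subspace_add subspace_scale sV)
  moreover have "a1 \<odot> b1 - x *s a1 - y *s b1 = (a \<odot> b - y *s b - x *s a) + t *s (a \<odot> z - mu a *s z)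
      + s *s (z \<odot> b - lam b *s z) + (s * t) *s (z \<odot> z) + (s * lam b - t * lam a - (x * s + y * t)) *s z"
    by (simp add: a1_def b1_def wa(1) bracket_simps algebra_simps)
  ultimately have ab1: "a1 \<odot> b1 - x *s a1 - y *s b1 \<in> V" unfolding st' by simp
  have anti: "b \<odot> a = - (a \<odot> b)" using lie_on_anti[OF N(2) sN b(1) a(1)] .
  have "- (a \<odot> b - y *s b - x *s a) + s *s (b \<odot> z - mu b *s z) + t *s (z \<odot> a - lam a *s z) + (s * t) *s (z \<odot> z) \<in> V"
    using subspace_neg[OF sV xy] FVD[OF lam[OF aU]] FVD[OF mu[OF bU]] FVD[OF zz]
    by (intro subspace_add[OF sV] subspace_scale[OF sV])
  moreover have "b1 \<odot> a1 - (- x) *s a1 - (- y) *s b1 = - (a \<odot> b - y *s b - x *s a) + s *s (b \<odot> z - mu b *s z)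
      + t *s (z \<odot> a - lam a *s z) + (s * t) *s (z \<odot> z) - (s * lam b - t * lam a - (x * s + y * t)) *s z"
    by (simp add: a1_def b1_def wb(1) anti bracket_simps algebra_simps)
  ultimately have ba1: "b1 \<odot> a1 - (- x) *s a1 - (- y) *s b1 \<in> V" unfolding st' by simp
  have subW: "subalgebra W"
  proof (rule subalgebra_plane[OF V _ _ _ _ _ _ _ _ W_def])
    fix v assume v: "v \<in> V"
    show "a1 \<odot> v \<in> W" using oa(1)[OF v] inW[of _ "lam v" 0] by simp
    show "v \<odot> a1 \<in> W" using oa(2)[OF v] inW[of _ "- lam v" 0] by simp
    show "b1 \<odot> v \<in> W" using ob(1)[OF v] inW[of _ 0 "lam v"] by simp
    show "v \<odot> b1 \<in> W" using ob(2)[OF v] inW[of _ 0 "- lam v"] by simp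
  next
    show "a1 \<odot> a1 \<in> W" "b1 \<odot> b1 \<in> W"
      using sq[OF a(1) wa(1) a1_def] sq[OF b(1) wb(1) b1_def] VW by auto
    show "a1 \<odot> b1 \<in> W" using ab1 by (rule inW)
    show "b1 \<odot> a1 \<in> W" using ba1 by (rule inW)
  qed
  have indep: "q = 0 \<and> k = 0 \<and> l = 0" if "q *s z + k *s a + l *s b \<in> V" for q k l
  proof -
    have "(q *s z + k *s a + l *s b) - (k *s a + l *s b) \<in> N"
      using that N(3) a b by (intro subspace_diff[OF sN _ subspace_add[OF sN subspace_scale[OF sN] subspace_scale[OF sN]]]) auto
    then have "q *s z \<in> N" by simp
    then have q: "q = 0" using z mem_scaleD[OF sN] by blast
    have "l = 0"
    proof (rule ccontr)
      assume l: "l \<noteq> 0"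
      have "l *s b - (- k) *s a \<in> V" using that q by (simp add: add.commute)
      then have "b - (- k / l) *s a \<in> V" using l by (rule mem_divide_coeff[OF sV])
      then show False using b(2) mem_line[OF sV] by blast
    qed
    then show ?thesis using that q a mem_scaleD[OF sV, of k a] by auto
  qed
  have a1V: "a1 \<notin> V" using indep[of s 1 0] by (auto simp: a1_def add.commute)
  have b1V: "b1 \<notin> line V a1"
  proof
    assume "b1 \<in> line V a1"
    then obtain k where "b1 - k *s a1 \<in> V" unfolding mem_line[OF sV] by blast
    then have "(t - k * s) *s z + (- k) *s a + 1 *s b \<in> V" by (simp add: a1_def b1_def algebra_simps)
    then show False using indep by fastforce
  qed
  have "W \<noteq> N"
  proof
    assume eq: "W = N"
    have "a1 - a \<in> N" "b1 - b \<in> N" using a1W b1W a b unfolding eq by (auto intro: subspace_diff[OF sN])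
    then have "s *s z \<in> N" "t *s z \<in> N" by (auto simp: a1_def b1_def)
    then show False using st(2) z mem_scaleD[OF sN] by blast
  qed
  moreover have "z \<notin> W"
  proof
    assume "z \<in> W"
    then obtain l where "z - l *s b1 \<in> line V a1" unfolding W_def mem_line[OF subspace_line] by blast
    then obtain k where "z - l *s b1 - k *s a1 \<in> V" unfolding mem_line[OF sV] by blast
    then have "(1 - l * t - k * s) *s z + (- k) *s a + (- l) *s b \<in> V" by (simp add: a1_def b1_def algebra_simps)
    then have "1 - l * t - k * s = 0 \<and> - k = 0 \<and> - l = 0" by (rule indep)
    then show False by auto
  qed
  moreover have "W \<subseteq> U"
  proof -
    have "a1 \<in> U" "b1 \<in> U" unfolding a1_def b1_def using aU bU z sU by (auto intro: subspace_add subspace_scale)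
    then show ?thesis unfolding W_def using N by (intro line_least sU) auto
  qed
  ultimately show thesis using that[OF subW VW] dim_line[OF sV a1V] dim_line[OF subspace_line b1V]
    by (simp add: W_def)
qed

end

section \<open>Dimension as a rank function on a supersolvable algebra\<close>

context leibniz_fd begin

text \<open>Modulo \<open>V\<close> the third line lies in the plane spanned by \<open>a\<close> and
  \<open>z\<close> and differs from both their lines, so after scaling it is generated by
  \<open>a + c *s z\<close> with \<open>c \<noteq> 0\<close>.\<close>

lemma crossedE:
  assumes cr: "crossed dim V S N T" and V: "subalgebra V" and S: "S = line V z" and z: "z \<notin> N"
    and N: "subalgebra N" "V \<subseteq> N"
  obtains a c where "a \<in> T" "a \<notin> V" "T = line V a" "c \<noteq> 0" "subalgebra (line V (a + c *s z))"
proof -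
  note sV = subalgebraD(1)[OF V] and sN = subalgebraD(1)[OF N(1)]
  obtain C X where T: "subalgebra T" "V \<subseteq> T" "T \<subseteq> N" "dim T = Suc (dim V)"
    and C: "subalgebra C" "V \<subseteq> C" "C \<subseteq> X" "dim C = Suc (dim V)" "C \<noteq> S" "C \<noteq> T"
    and X: "subalgebra X" "S \<subseteq> X" "T \<subseteq> X" "dim X \<le> dim V + 2"
    using cr unfolding crossed_def by blast
  note sT = subalgebraD(1)[OF T(1)] and sC = subalgebraD(1)[OF C(1)] and sX = subalgebraD(1)[OF X(1)]
  have sS: "subspace S" by (simp add: S subspace_line)
  have "V \<noteq> T" "V \<noteq> C" using T C by auto
  then obtain a e where a: "a \<in> T" "a \<notin> V" and e: "e \<in> C" "e \<notin> V" using T C by blast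
  have Ta: "T = line V a" using T a sV sT by (intro line_eqI) auto
  have Ce: "C = line V e" using C e sV sC by (intro line_eqI) auto
  have zV: "z \<notin> V" using z N by blast
  have "a \<notin> S"
  proof
    assume "a \<in> S"
    then obtain k where k: "a - k *s z \<in> V" unfolding S mem_line[OF sV] by blast
    have "k *s z \<in> N" using subspace_diff[OF sN, of a "a - k *s z"] k a T N by auto
    then have "k = 0" using z mem_scaleD[OF sN] by blast
    then show False using k a by simp
  qed
  then have "X = line S a"
    using X a sS sX dim_line[OF sV zV] by (intro line_eqI) (auto simp: S)
  then have "e \<in> line S a" using e C by blast
  then obtain p where "e - p *s a \<in> S" unfolding mem_line[OF sS] by blast
  then obtain q where pq: "e - p *s a - q *s z \<in> V" unfolding S mem_line[OF sV] by blast
  have p0: "p \<noteq> 0"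
  proof
    assume "p = 0"
    then have "e \<in> S" using pq unfolding S mem_line[OF sV] by auto
    then have "C \<subseteq> S" unfolding Ce using S line_superset by (intro line_least[OF sS]) auto
    then show False using C(4,5) sC sS dim_line[OF sV zV] subspace_dim_equal[of C S] by (simp add: S)
  qed
  have q0: "q \<noteq> 0"
  proof
    assume "q = 0"
    then have "e \<in> T" using pq unfolding Ta mem_line[OF sV] by auto
    then have "C \<subseteq> T" unfolding Ce using T by (intro line_least[OF sT]) auto
    then show False using C(4,6) T(4) sC sT subspace_dim_equal[of C T] by simp
  qed
  let ?w = "a + (q / p) *s z"
  have "e - p *s ?w \<in> V" using pq p0 by (simp add: algebra_simps)
  then have pw: "p *s ?w \<in> C" using subspace_diff[OF sC e(1), of "e - p *s ?w"] C(2) by auto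
  then have wC: "?w \<in> C" using p0 mem_scaleD[OF sC] by blast
  have wV: "?w \<notin> V"
  proof
    assume "?w \<in> V"
    from subspace_add[OF sV \<open>e - p *s ?w \<in> V\<close> subspace_scale[OF sV this, of p]]
    show False using e by simp
  qed
  have "C = line V ?w" using C wC wV sV sC by (intro line_eqI) auto
  then show thesis using that[OF a Ta, of "q / p"] C(1) p0 q0 by simp
qed

lemma supersolvable_dim_cover:
  assumes ss: "supersolvable" and A: "subalgebra A" and B: "subalgebra B" and AB: "A \<subset> B"
    and mx: "\<And>C. subalgebra C \<Longrightarrow> A \<subset> C \<Longrightarrow> C \<subseteq> B \<Longrightarrow> C = B"
  shows "dim B = Suc (dim A)"
proof -
  note sA = subalgebraD(1)[OF A]
  obtain F E where E: "ideal_in F B" "F \<subseteq> A" "ideal_in E B" "F \<subseteq> E" "\<not> E \<subseteq> A" "dim E \<le> Suc (dim F)"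
    using first_step_outside[OF ss B A AB] by blast
  note sE = ideal_inD(1)[OF E(3)]
  have "E \<boxplus> A = B"
  proof (rule mx)
    show "subalgebra (E \<boxplus> A)" using subalgebra_sums[OF E(3) A] AB by blast
    show "A \<subset> E \<boxplus> A" using sums_superset(1)[OF sA, of E] sums_superset(2)[OF sE, of A] E(5) by blast
    show "E \<boxplus> A \<subseteq> B" using ideal_inD(2)[OF E(3)] AB subalgebraD(1)[OF B] by (intro sums_least) auto
  qed
  then have "dim B \<le> Suc (dim A)" using dim_sums_le_Suc[OF sE sA E(2,4,6)] by simp
  then show ?thesis using dim_psubset_subspace[OF sA subalgebraD(1)[OF B] AB] by simp
qed

text \<open>The chain of ideals of \<open>U\<close> is joined with \<open>A\<close>. A join with an
  ideal is a sum, so the dimension formula for sums gives the bound on the joins.\<close>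

lemma supersolvable_dim_chain:
  assumes ss: "supersolvable" and A: "subalgebra A" and U: "subalgebra U" and AU: "A \<subseteq> U"
  shows "\<exists>(R :: nat \<Rightarrow> 'v set) k. R 0 = A \<and> R k = U \<and>
        (\<forall>i<k. R i \<subseteq> R (Suc i) \<and> dim (R (Suc i)) \<le> Suc (dim (R i))) \<and>
        (\<forall>i\<le>k. subalgebra (R i) \<and> (\<forall>B. subalgebra B \<and> A \<subseteq> B \<and> B \<subseteq> U \<longrightarrow>
          (\<exists>X. subalgebra X \<and> R i \<subseteq> X \<and> B \<subseteq> X \<and> X \<subseteq> U \<and> dim X + dim A \<le> dim (R i) + dim B)))"
proof -
  note sA = subalgebraD(1)[OF A] and sU = subalgebraD(1)[OF U]
  obtain E :: "nat \<Rightarrow> 'v set" and n where E: "E 0 = {0}" "E n = U" "\<And>i. i \<le> n \<Longrightarrow> ideal_in (E i) U"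
    "\<And>i. i < n \<Longrightarrow> E i \<subseteq> E (Suc i) \<and> dim (E (Suc i)) \<le> Suc (dim (E i))"
    using supersolvable_chain[OF ss U] by blast
  have sE: "subspace (E i)" if "i \<le> n" for i using ideal_inD(1)[OF E(3)[OF that]] .
  have EU: "E i \<subseteq> U" if "i \<le> n" for i using ideal_inD(2)[OF E(3)[OF that]] .
  define R where "R i = E i \<boxplus> A" for i
  have sR: "subspace (R i)" if "i \<le> n" for i unfolding R_def using sE[OF that] sA by (rule subspace_boxplus)
  have f0: "R 0 = A" using E(1) by (auto simp: R_def mem_sums)
  have fn: "R n = U"
    unfolding R_def E(2) using sums_superset(1)[OF sA, of U] sums_least[OF sU order_refl AU] by blast
  have fstep: "R i \<subseteq> R (Suc i) \<and> dim (R (Suc i)) \<le> Suc (dim (R i))" if i: "i < n" for i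
  proof
    show "R i \<subseteq> R (Suc i)" unfolding R_def using E(4)[OF i] by (intro sums_mono) auto
    have s: "subspace (E i)" "subspace (E (Suc i))" "subspace (R i)" using sE sR i by auto
    have "R (Suc i) \<subseteq> E (Suc i) \<boxplus> R i"
      unfolding R_def using sums_superset(2)[OF s(1), of A] by (intro sums_mono) auto
    then have "dim (R (Suc i)) \<le> dim (E (Suc i) \<boxplus> R i)" by (rule dim_subset)
    also have "\<dots> \<le> Suc (dim (R i))"
      using E(4)[OF i] sums_superset(1)[OF sA, of "E i"]
      by (intro dim_sums_le_Suc[OF s(2,3), of "E i"]) (auto simp: R_def)
    finally show "dim (R (Suc i)) \<le> Suc (dim (R i))" .
  qed
  have fsub: "subalgebra (R i)" if "i \<le> n" for i
    unfolding R_def by (rule subalgebra_sums[OF E(3)[OF that] A AU])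
  have fjoin: "\<exists>X. subalgebra X \<and> R i \<subseteq> X \<and> B \<subseteq> X \<and> X \<subseteq> U \<and> dim X + dim A \<le> dim (R i) + dim B"
    if i: "i \<le> n" and B: "subalgebra B" "A \<subseteq> B" "B \<subseteq> U" for i B
  proof (intro exI conjI)
    note sB = subalgebraD(1)[OF B(1)]
    show "subalgebra (E i \<boxplus> B)" by (rule subalgebra_sums[OF E(3)[OF i] B(1,3)])
    show RX: "R i \<subseteq> E i \<boxplus> B" unfolding R_def using B by (intro sums_mono) auto
    show BX: "B \<subseteq> E i \<boxplus> B" by (rule sums_superset(2)[OF sE[OF i]])
    show "E i \<boxplus> B \<subseteq> U" by (rule sums_least[OF sU EU[OF i] B(3)])
    have "E i \<boxplus> B \<subseteq> R i \<boxplus> B" unfolding R_def using sums_superset(1)[OF sA] by (intro sums_mono) auto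
    then have "dim (E i \<boxplus> B) \<le> dim (R i \<boxplus> B)" by (rule dim_subset)
    moreover have "A \<subseteq> R i \<inter> B" using sums_superset(2)[OF sE[OF i], of A] B by (auto simp: R_def)
    then have "dim A \<le> dim (R i \<inter> B)" by (rule dim_subset)
    ultimately show "dim (E i \<boxplus> B) + dim A \<le> dim (R i) + dim B"
      using dim_sums[OF sR[OF i] sB] by linarith
  qed
  show ?thesis
  proof (intro exI[of _ R] exI[of _ n] conjI allI impI)
    show "R i \<subseteq> R (Suc i)" "dim (R (Suc i)) \<le> Suc (dim (R i))" if "i < n" for i using fstep[OF that] by auto
    show "\<exists>X. subalgebra X \<and> R i \<subseteq> X \<and> B \<subseteq> X \<and> X \<subseteq> U \<and> dim X + dim A \<le> dim (R i) + dim B"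
      if "i \<le> n" "subalgebra B \<and> A \<subseteq> B \<and> B \<subseteq> U" for i B using fjoin that by blast
  qed (fact f0 fn fsub)+
qed

text \<open>\<open>S\<close> is the join of \<open>V\<close> with the first ideal not inside it; two
  crossed lines in \<open>N\<close> provide the generators that \<open>other_complement\<close> asks
  for.\<close>

lemma supersolvable_dim_three:
  assumes ss: "supersolvable" and U: "subalgebra U" and V: "subalgebra V" "V \<subseteq> U" and d: "dim U = dim V + 3"
  shows "\<exists>S. subalgebra S \<and> V \<subseteq> S \<and> S \<subseteq> U \<and> dim S = Suc (dim V) \<and>
        (\<forall>B. subalgebra B \<and> V \<subseteq> B \<and> B \<subseteq> U \<longrightarrow>
          (\<exists>X. subalgebra X \<and> S \<subseteq> X \<and> B \<subseteq> X \<and> X \<subseteq> U \<and> dim X \<le> Suc (dim B))) \<and>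
        (\<forall>N T1 T2. subalgebra N \<and> V \<subseteq> N \<and> N \<subseteq> U \<and> dim N = dim V + 2 \<and> lie_on N \<and> \<not> S \<subseteq> N \<and>
          T1 \<noteq> T2 \<and> crossed dim V S N T1 \<and> crossed dim V S N T2 \<longrightarrow>
          (\<exists>A. subalgebra A \<and> V \<subseteq> A \<and> A \<subseteq> U \<and> dim A = dim V + 2 \<and> A \<noteq> N \<and> \<not> S \<subseteq> A))"
proof -
  note sV = subalgebraD(1)[OF V(1)] and sU = subalgebraD(1)[OF U]
  have VU: "V \<subset> U" using V d by auto
  obtain F E where E: "ideal_in F U" "F \<subseteq> V" "ideal_in E U" "F \<subseteq> E" "\<not> E \<subseteq> V" "dim E \<le> Suc (dim F)"
    using first_step_outside[OF ss U V(1) VU] by blast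
  note sE = ideal_inD(1)[OF E(3)] and sF = ideal_inD(1)[OF E(1)] and EU = ideal_inD(2)[OF E(3)]
  obtain z where z: "z \<in> E" "z \<notin> V" using E(5) by blast
  have zF: "z \<notin> F" using z E by blast
  have Ez: "E = line F z" using sE sF E z zF by (intro line_eqI) auto
  have zU: "z \<in> U" using z EU by blast
  define S where "S = line V z"
  have sS: "subspace S" by (simp add: S_def subspace_line)
  have VS: "V \<subseteq> S" unfolding S_def by (rule line_superset)
  have dimS: "dim S = Suc (dim V)" unfolding S_def by (rule dim_line[OF sV z(2)])
  have EV_S: "E \<boxplus> V = S"
  proof
    show "E \<boxplus> V \<subseteq> S" unfolding S_def Ez using E(2) line_superset line_mono[OF E(2)]
      by (intro sums_least subspace_line)
    show "S \<subseteq> E \<boxplus> V" unfolding S_def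
      using sums_superset(1)[OF sV, of E] sums_superset(2)[OF sE, of V] z
      by (intro line_least subspace_boxplus sE sV) auto
  qed
  have subS: "subalgebra S" using subalgebra_sums[OF E(3) V] EV_S by simp
  have SU: "S \<subseteq> U" unfolding S_def by (rule line_least[OF sU V(2) zU])
  have join: "\<exists>X. subalgebra X \<and> S \<subseteq> X \<and> B \<subseteq> X \<and> X \<subseteq> U \<and> dim X \<le> Suc (dim B)"
    if B: "subalgebra B" "V \<subseteq> B" "B \<subseteq> U" for B
  proof (intro exI conjI)
    note sB = subalgebraD(1)[OF B(1)]
    show "subalgebra (E \<boxplus> B)" by (rule subalgebra_sums[OF E(3) B(1,3)])
    show "S \<subseteq> E \<boxplus> B" unfolding EV_S[symmetric] using B by (intro sums_mono) auto
    show "B \<subseteq> E \<boxplus> B" by (rule sums_superset(2)[OF sE])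
    show "E \<boxplus> B \<subseteq> U" by (rule sums_least[OF sU EU B(3)])
    show "dim (E \<boxplus> B) \<le> Suc (dim B)" using E(2) B by (intro dim_sums_le_Suc[OF sE sB _ E(4,6)]) auto
  qed
  have compl: "\<exists>A. subalgebra A \<and> V \<subseteq> A \<and> A \<subseteq> U \<and> dim A = dim V + 2 \<and> A \<noteq> N \<and> \<not> S \<subseteq> A"
    if N: "subalgebra N" "V \<subseteq> N" "N \<subseteq> U" "dim N = dim V + 2" "lie_on N" "\<not> S \<subseteq> N"
      and T: "T1 \<noteq> T2" "crossed dim V S N T1" "crossed dim V S N T2" for N T1 T2
  proof -
    note sN = subalgebraD(1)[OF N(1)]
    have zN: "z \<notin> N" using N(6) line_least[OF sN N(2)] unfolding S_def by blast
    obtain a c where a: "a \<in> T1" "a \<notin> V" "T1 = line V a" "c \<noteq> 0" "subalgebra (line V (a + c *s z))"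
      using crossedE[OF T(2) V(1) S_def zN N(1,2)] by blast
    obtain b e where b: "b \<in> T2" "b \<notin> V" "T2 = line V b" "e \<noteq> 0" "subalgebra (line V (b + e *s z))"
      using crossedE[OF T(3) V(1) S_def zN N(1,2)] by blast
    have subT: "subalgebra T1" "subalgebra T2" "T1 \<subseteq> N" "T2 \<subseteq> N"
      using T unfolding crossed_def by blast+
    have bT1: "b \<notin> line V a"
    proof
      assume "b \<in> line V a"
      then have "line V b \<subseteq> line V a" using line_superset by (intro line_least subspace_line) auto
      then have "line V b = line V a"
        using dim_line[OF sV a(2)] dim_line[OF sV b(2)] by (intro subspace_dim_equal subspace_line) auto
      then show False using T(1) a b by simp
    qed
    have Neq: "N = line (line V a) b"
      using subT a b bT1 N dim_line[OF sV a(2)] by (intro line_eqI subspace_line sN) auto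
    obtain W where "subalgebra W" "V \<subseteq> W" "W \<subseteq> U" "dim W = dim V + 2" "W \<noteq> N" "z \<notin> W"
      using other_complement[OF N(1,5,2,3) V(1) E(1,2) zU zN _ _ a(2) _ bT1 Neq _ _ a(4,5) b(4,5) sU]
        E(3) subT a b unfolding Ez by blast
    moreover have "z \<in> S" unfolding S_def by (rule line_self)
    ultimately show ?thesis by blast
  qed
  show ?thesis
  proof (rule exI[of _ S], intro conjI allI impI)
    show "\<exists>X. subalgebra X \<and> S \<subseteq> X \<and> B \<subseteq> X \<and> X \<subseteq> U \<and> dim X \<le> Suc (dim B)"
      if "subalgebra B \<and> V \<subseteq> B \<and> B \<subseteq> U" for B using join that by blast
    show "\<exists>A. subalgebra A \<and> V \<subseteq> A \<and> A \<subseteq> U \<and> dim A = dim V + 2 \<and> A \<noteq> N \<and> \<not> S \<subseteq> A"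
      if "subalgebra N \<and> V \<subseteq> N \<and> N \<subseteq> U \<and> dim N = dim V + 2 \<and> lie_on N \<and> \<not> S \<subseteq> N \<and>
          T1 \<noteq> T2 \<and> crossed dim V S N T1 \<and> crossed dim V S N T2" for N T1 T2
      using compl[of N T1 T2] that by blast
  qed (fact subS VS SU dimS)+
qed

lemma supersolvable_subalgebra_rank:
  assumes "supersolvable"
  shows "subalgebra_rank scale bracket Basis dim"
proof (unfold_locales, goal_cases)
  case 1 show ?case by simp
next
  case (2 A B)
  then show ?case by (intro dim_psubset_subspace) (auto dest: subalgebraD)
next
  case 3 from supersolvable_dim_cover[OF assms this] show ?case .
next
  case 4 from supersolvable_dim_chain[OF assms this] show ?case .
next
  case 5 from supersolvable_dim_three[OF assms this] show ?case .
qed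

section \<open>Recognising Lie subalgebras in the lattice\<close>

lemma inj_on_of_surj:
  assumes f: "Vector_Spaces.linear scale scale f" and Q: "subspace Q" and surj: "Q \<subseteq> f ` Q" and h: "h \<in> Q" "f h = 0"
  shows "h = 0"
proof -
  have lin: "f (x + y) = f x + f y" "f (c *s x) = c *s f x" for x y c using f by (auto simp: linear_iff_local)
  have f0: "f 0 = 0" using lin(2)[of 0 0] by simp
  have linp: "(f ^^ k) (x + y) = (f ^^ k) x + (f ^^ k) y" "(f ^^ k) (c *s x) = c *s (f ^^ k) x"
    "(f ^^ k) 0 = 0" for k x y c by (induction k) (auto simp: lin f0)
  \<comment> \<open>Dual to \<open>surj_mod\<close>: the kernels of the powers of \<open>f\<close>
    stabilise, while surjectivity writes \<open>h\<close> as \<open>(f ^^ k) g\<close> with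
    \<open>g \<in> Q\<close>.\<close>
  define K where "K k = {x\<in>Q. (f ^^ k) x = 0}" for k
  have sK: "subspace (K k)" for k
    using Q by (intro subspaceI) (auto simp: K_def linp subspace_add subspace_scale subspace_0)
  have inc: "K k \<subseteq> K (Suc k)" for k by (auto simp: K_def f0)
  have "\<exists>k. K k = K (Suc k)"
  proof (rule ccontr)
    assume "\<nexists>k. K k = K (Suc k)"
    then have lt: "dim (K k) < dim (K (Suc k))" for k using inc sK by (intro dim_psubset_subspace) auto
    have "k \<le> dim (K k)" for k
    proof (induction k)
      case (Suc k) then show ?case using lt[of k] by simp
    qed simp
    from this[of "Suc dimension"] show False using dim_subset_UNIV[of "K (Suc dimension)"] by simp
  qed
  then obtain k where k: "K k = K (Suc k)" by blast
  have "\<exists>g\<in>Q. (f ^^ k) g = h" for k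
  proof (induction k)
    case 0 then show ?case using h by auto
  next
    case (Suc k)
    then obtain g where "g \<in> Q" "(f ^^ k) g = h" by blast
    moreover obtain g' where "g' \<in> Q" "g = f g'" using surj \<open>g \<in> Q\<close> by blast
    ultimately show ?case by (intro bexI[of _ g']) (auto simp: funpow_swap1)
  qed
  then obtain g where g: "g \<in> Q" "(f ^^ k) g = h" by blast
  then have "g \<in> K (Suc k)" using h by (simp add: K_def)
  then have "g \<in> K k" using k by simp
  then show ?thesis using g by (simp add: K_def)
qed

text \<open>A minimal subalgebra that is not a Lie algebra is cyclic, generated by some \<open>x\<close>; besides the
  span of \<open>x\<^sup>2, x\<^sup>3, \<dots>\<close> it has at most one maximal subalgebra.\<close>

lemma nonlie_two_maximal:
  assumes K: "subalgebra K" "\<not> lie_on K"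
  obtains X M1 M2 where "subalgebra X" "X \<subseteq> K" "subalgebra M1" "M1 \<subset> X" "M1 \<noteq> {0}" "subalgebra M2" "M2 \<subset> X"
    "\<And>M. subalgebra M \<Longrightarrow> M \<subset> X \<Longrightarrow> M \<subseteq> M1 \<or> M \<subseteq> M2"
proof -
  define P where "P X \<longleftrightarrow> subalgebra X \<and> X \<subseteq> K \<and> \<not> lie_on X" for X
  have "P K" using K by (simp add: P_def)
  then obtain X where PX: "P X" and mn: "\<And>C. P C \<Longrightarrow> dim X \<le> dim C" using ex_min_dim[of P] by blast
  have X: "subalgebra X" "X \<subseteq> K" "\<not> lie_on X" using PX by (auto simp: P_def)
  note sX = subalgebraD(1)[OF X(1)]
  have lieM: "lie_on M" if M: "subalgebra M" "M \<subset> X" for M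
    using mn[of M] dim_psubset_subspace[OF subalgebraD(1)[OF M(1)] sX M(2)] M X by (auto simp: P_def)
  obtain x where x: "x \<in> X" "x \<odot> x \<noteq> 0" using X(3) by (auto simp: lie_on_def)
  define p where "p k = ((\<lambda>y. y \<odot> x) ^^ k) (x \<odot> x)" for k
  define Q where "Q = span (range p)"
  have sQ: "subspace Q" by (simp add: Q_def)
  have pS: "p k \<odot> x = p (Suc k)" for k by (simp add: p_def)
  have pX: "p k \<in> X" for k by (induction k) (use x subalgebraD(2)[OF X(1)] in \<open>auto simp: p_def\<close>)
  have QX: "Q \<subseteq> X" unfolding Q_def using pX sX by (intro span_minimal) auto
  have xxQ: "x \<odot> x \<in> Q" unfolding Q_def by (rule span_base) (metis p_def funpow_0 rangeI)
  have p0: "y \<odot> p k = 0" for y k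
  proof (induction k arbitrary: y)
    case 0 then show ?case by (simp add: p_def bracket_square_zero)
  next
    case (Suc k) then show ?case unfolding pS[symmetric] leibniz by (simp add: bracket_simps)
  qed
  have Qn: "y \<odot> q = 0" if "q \<in> Q" for y q
    using that unfolding Q_def by (induction rule: span_induct_alt) (auto simp: bracket_simps p0)
  have Qx: "q \<odot> x \<in> Q" if "q \<in> Q" for q
    using that unfolding Q_def
  proof (induction rule: span_induct_alt)
    case (step c g y)
    then obtain k where "g = p k" by blast
    then have "g \<odot> x \<in> span (range p)" using pS span_base by (metis rangeI)
    then show ?case using step by (simp add: bracket_simps span_add span_scale)
  qed (simp add: bracket_simps span_zero)
  have prod: "u \<odot> v \<in> Q" if uv: "u \<in> line Q x" "v \<in> line Q x" for u v
  proof -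
    obtain k l where k: "u - k *s x \<in> Q" and l: "v - l *s x \<in> Q" using uv by (auto simp: mem_line[OF sQ])
    have "u \<odot> v = l *s ((u - k *s x) \<odot> x) + (k * l) *s (x \<odot> x) + u \<odot> (v - l *s x)"
      by (simp add: bracket_simps algebra_simps)
    then show ?thesis using Qx[OF k] xxQ Qn[OF l] sQ by (simp add: subspace_add subspace_scale)
  qed
  have "subalgebra (line Q x)"
    using prod line_superset[of Q x] by (auto simp: subalgebra_def subspace_line)
  moreover have le: "line Q x \<subseteq> X" by (rule line_least[OF sX QX x(1)])
  moreover have "\<not> lie_on (line Q x)" using x line_self by (auto simp: lie_on_def)
  ultimately have Xeq: "X = line Q x" using lieM by blast
  have xQ: "x \<notin> Q" using Qn[of x x] x by blast
  have QX': "Q \<subset> X" using QX xQ x by blast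
  have subQ: "subalgebra Q" using Qn sQ subspace_0[OF sQ] by (auto simp: subalgebra_def)
  have Q0: "Q \<noteq> {0}" using xxQ x by auto
  \<comment> \<open>A proper subalgebra not inside \<open>Q\<close> contains some
    \<open>x + q\<close>, and being Lie forces \<open>q \<odot> x = - (x \<odot> x)\<close>. Then
    right multiplication by \<open>x\<close> maps \<open>Q\<close> onto \<open>Q\<close>, hence is
    injective there, and \<open>q\<close> is unique.\<close>
  have out: "\<exists>q\<in>Q. x + q \<in> M \<and> q \<odot> x = - (x \<odot> x) \<and> M = line {0} (x + q) \<and> (\<forall>h\<in>Q. h \<odot> x = 0 \<longrightarrow> h = 0)"
    if M: "subalgebra M" "M \<subset> X" "\<not> M \<subseteq> Q" for M
  proof -
    note sM = subalgebraD(1)[OF M(1)] and lie = lieM[OF M(1,2)]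
    obtain m where m: "m \<in> M" "m \<notin> Q" using M by blast
    have "m \<in> line Q x" using m M Xeq by blast
    then obtain k where k: "m - k *s x \<in> Q" unfolding mem_line[OF sQ] by blast
    have k0: "k \<noteq> 0" using k m by auto
    define q where "q = inverse k *s (m - k *s x)"
    have qQ: "q \<in> Q" unfolding q_def by (rule subspace_scale[OF sQ k])
    have "inverse k *s m \<in> M" by (rule subspace_scale[OF sM m(1)])
    moreover have "x + q = inverse k *s m" using k0 by (simp add: q_def scale_right_diff_distrib)
    ultimately have xq: "x + q \<in> M" by simp
    have "(x + q) \<odot> (x + q) = 0" using lie xq by (simp add: lie_on_def)
    then have "x \<odot> x + q \<odot> x = 0" using Qn[OF qQ] by (simp add: bracket_simps)
    then have qx: "q \<odot> x = - (x \<odot> x)" by (metis add.commute eq_neg_iff_add_eq_0)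
    have "Q \<subseteq> (\<lambda>y. y \<odot> x) ` Q"
      unfolding Q_def
    proof (rule span_minimal)
      have "p k \<in> (\<lambda>y. y \<odot> x) ` Q" for k
      proof (cases k)
        case 0
        have "p k = (- q) \<odot> x" using qx 0 by (simp add: p_def bracket_simps)
        then show ?thesis using qQ subspace_neg[OF sQ] by blast
      next
        case (Suc j)
        have "p j \<in> Q" unfolding Q_def by (rule span_base) blast
        then show ?thesis using pS[of j] Suc by (metis image_eqI)
      qed
      then show "range p \<subseteq> (\<lambda>y. y \<odot> x) ` span (range p)" by (auto simp: Q_def)
      show "subspace ((\<lambda>y. y \<odot> x) ` span (range p))"
        using module_hom.subspace_image[OF linear_left[of x, folded module_hom_iff_linear] sQ] by (simp add: Q_def)
    qed
    then have inj: "h = 0" if "h \<in> Q" "h \<odot> x = 0" for h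
      using inj_on_of_surj[OF linear_left sQ _ that] by blast
    have "M = line {0} (x + q)"
    proof
      show "line {0} (x + q) \<subseteq> M" using xq subspace_0[OF sM] by (intro line_least[OF sM]) auto
      show "M \<subseteq> line {0} (x + q)"
      proof
        fix u assume u: "u \<in> M"
        then have "u \<in> line Q x" using M Xeq by blast
        then obtain l where l: "u - l *s x \<in> Q" unfolding mem_line[OF sQ] by blast
        let ?h = "u - l *s (x + q)"
        have hQ: "?h \<in> Q"
          using subspace_diff[OF sQ l subspace_scale[OF sQ qQ, of l]] by (simp add: algebra_simps)
        have hM: "?h \<in> M" by (rule subspace_diff[OF sM u subspace_scale[OF sM xq]])
        have "?h \<odot> (x + q) = - ((x + q) \<odot> ?h)" by (rule lie_on_anti[OF lie sM hM xq])
        then have "?h \<odot> x = 0" using Qn[OF qQ, of ?h] Qn[OF hQ, of "x + q"] by (simp only: bracket_add_right) simp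
        then have "?h = 0" using inj hQ by blast
        then show "u \<in> line {0} (x + q)" by (auto simp: mem_line intro!: exI[of _ l])
      qed
    qed
    then show ?thesis using qQ xq qx inj by blast
  qed
  have uniq: "M = M'" if MM: "subalgebra M" "M \<subset> X" "\<not> M \<subseteq> Q" "subalgebra M'" "M' \<subset> X" "\<not> M' \<subseteq> Q" for M M'
  proof -
    obtain q where q: "q \<in> Q" "q \<odot> x = - (x \<odot> x)" "M = line {0} (x + q)" "\<forall>h\<in>Q. h \<odot> x = 0 \<longrightarrow> h = 0"
      using out[OF MM(1-3)] by blast
    obtain q' where q': "q' \<in> Q" "q' \<odot> x = - (x \<odot> x)" "M' = line {0} (x + q')" using out[OF MM(4-6)] by blast
    have "(q - q') \<odot> x = 0" using q q' by (simp add: bracket_simps)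
    then have "q - q' = 0" using q(4) subspace_diff[OF sQ q(1) q'(1)] by blast
    then show ?thesis using q q' by simp
  qed
  show thesis
  proof (cases "\<exists>M. subalgebra M \<and> M \<subset> X \<and> \<not> M \<subseteq> Q")
    case True
    then obtain M where M: "subalgebra M" "M \<subset> X" "\<not> M \<subseteq> Q" by blast
    show thesis using that[OF X(1,2) subQ QX' Q0 M(1,2)] uniq[OF M] by blast
  next
    case False
    then show thesis using that[OF X(1,2) subQ QX' Q0 subQ QX'] by blast
  qed
qed

text \<open>A vector space is not the union of two proper subspaces, and in a Lie algebra a vector
  outside both spans a subalgebra. The condition \<open>M1 \<noteq> {0}\<close> excludes
  \<open>dim Y = 1\<close>, where this line would be all of \<open>Y\<close>.\<close>

lemma lie_not_two_maximal:
  assumes Y: "subalgebra Y" "lie_on Y" and M: "subalgebra M1" "M1 \<subset> Y" "M1 \<noteq> {0}" "subalgebra M2" "M2 \<subset> Y"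
  obtains C where "subalgebra C" "C \<subset> Y" "\<not> C \<subseteq> M1" "\<not> C \<subseteq> M2"
proof -
  note sY = subalgebraD(1)[OF Y(1)] and s1 = subalgebraD(1)[OF M(1)] and s2 = subalgebraD(1)[OF M(4)]
  have "\<exists>y\<in>Y. y \<notin> M1 \<and> y \<notin> M2"
  proof (rule ccontr)
    assume no: "\<not> ?thesis"
    obtain y1 y2 where y: "y1 \<in> Y" "y1 \<notin> M1" "y2 \<in> Y" "y2 \<notin> M2" using M by blast
    then have y': "y1 \<in> M2" "y2 \<in> M1" using no by blast+
    have "y1 + y2 \<in> M1 \<or> y1 + y2 \<in> M2" using no subspace_add[OF sY y(1,3)] by blast
    then show False
      using subspace_diff[OF s1, of "y1 + y2" y2] subspace_diff[OF s2, of "y1 + y2" y1] y y' by auto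
  qed
  then obtain y where y: "y \<in> Y" "y \<notin> M1" "y \<notin> M2" by blast
  have s0: "subspace {0}" by simp
  have y0: "y \<noteq> 0" using y subspace_0[OF s1] by blast
  have yy: "y \<odot> y = 0" using Y y by (simp add: lie_on_def)
  let ?C = "line {0} y"
  have "subalgebra ?C"
    unfolding subalgebra_def
  proof (intro conjI ballI subspace_line)
    fix u v assume "u \<in> ?C" "v \<in> ?C"
    then obtain k l where "u = k *s y" "v = l *s y" by (auto simp: mem_line[OF s0])
    then show "u \<odot> v \<in> ?C" by (simp add: bracket_simps yy subspace_0[OF subspace_line])
  qed
  moreover have "?C \<subseteq> Y" using y subspace_0[OF sY] by (intro line_least[OF sY]) auto
  moreover have "?C \<noteq> Y"
  proof
    assume "?C = Y"
    then have "dim Y = 1" using dim_line[OF s0, of y] y0 by auto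
    moreover have "dim M1 < dim Y" by (rule dim_psubset_subspace[OF s1 sY M(2)])
    ultimately have "dim M1 = 0" by simp
    then show False using M(3) subspace_0[OF s1] by auto
  qed
  moreover have "y \<in> ?C" by (rule line_self)
  ultimately show thesis using that[of ?C] y by blast
qed

end

section \<open>Transfer along a lattice isomorphism\<close>

text \<open>The lattice isomorphism is kept as a pair of inverse order isomorphisms; ranks are
  pulled back along \<open>g\<close>, from the second algebra to the first.\<close>

locale lattice_pair = L: leibniz_fd sL mL BL + T: leibniz_fd sT mT BT
  for sL :: "'f::field_char_0 \<Rightarrow> 'v::ab_group_add \<Rightarrow> 'v" and mL :: "'v \<Rightarrow> 'v \<Rightarrow> 'v" and BL :: "'v set"
    and sT :: "'f \<Rightarrow> 'w::ab_group_add \<Rightarrow> 'w" and mT :: "'w \<Rightarrow> 'w \<Rightarrow> 'w" and BT :: "'w set" +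
  fixes g :: "'w set \<Rightarrow> 'v set" and h :: "'v set \<Rightarrow> 'w set"
  assumes g: "T.subalgebra A \<Longrightarrow> L.subalgebra (g A)"
    and h: "L.subalgebra B \<Longrightarrow> T.subalgebra (h B)"
    and gh: "L.subalgebra B \<Longrightarrow> g (h B) = B"
    and g_le_iff: "T.subalgebra A \<Longrightarrow> T.subalgebra A' \<Longrightarrow> g A \<subseteq> g A' \<longleftrightarrow> A \<subseteq> A'"
begin

lemma g_inj: "T.subalgebra A \<Longrightarrow> T.subalgebra A' \<Longrightarrow> g A = g A' \<longleftrightarrow> A = A'"
  using g_le_iff[of A A'] g_le_iff[of A' A] by blast

lemma hg: "T.subalgebra A \<Longrightarrow> h (g A) = A"
  using g_inj[of "h (g A)" A] gh[OF g] h[OF g] by blast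

lemma g_less_iff: "T.subalgebra A \<Longrightarrow> T.subalgebra A' \<Longrightarrow> g A \<subset> g A' \<longleftrightarrow> A \<subset> A'"
  using g_le_iff[of A A'] g_le_iff[of A' A] by blast

lemma h_le_iff: "L.subalgebra B \<Longrightarrow> L.subalgebra B' \<Longrightarrow> h B \<subseteq> h B' \<longleftrightarrow> B \<subseteq> B'"
  using g_le_iff[of "h B" "h B'"] h gh by simp

lemma le_h_iff: "T.subalgebra A \<Longrightarrow> L.subalgebra B \<Longrightarrow> A \<subseteq> h B \<longleftrightarrow> g A \<subseteq> B"
  using g_le_iff[of A "h B"] h gh by simp

lemma h_le_iff': "T.subalgebra A \<Longrightarrow> L.subalgebra B \<Longrightarrow> h B \<subseteq> A \<longleftrightarrow> B \<subseteq> g A"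
  using g_le_iff[of "h B" A] h gh by simp

lemma h_zero: "h {0} = {0}"
proof -
  have "h {0} \<subseteq> {0}"
    using h_le_iff'[OF T.subalgebra_zero L.subalgebra_zero]
      L.subspace_0[OF L.subalgebraD(1)[OF g[OF T.subalgebra_zero]]] by simp
  moreover have "0 \<in> h {0}"
    using T.subspace_0[OF T.subalgebraD(1)[OF h[OF L.subalgebra_zero]]] .
  ultimately show ?thesis by blast
qed

lemma g_zero: "g {0} = {0}"
  using gh[OF L.subalgebra_zero] h_zero by simp

text \<open>If \<open>g N\<close> were not Lie, it would contain an \<open>X\<close> with two proper
  subalgebras that between them bound all others. This is a property of the order, so the Lie
  subalgebra \<open>h X\<close> would share it, against \<open>lie_not_two_maximal\<close>.\<close>

lemma lie_on_g:
  assumes N: "T.subalgebra N" "T.lie_on N"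
  shows "L.lie_on (g N)"
proof (rule ccontr)
  assume nl: "\<not> L.lie_on (g N)"
  obtain X M1 M2 where X: "L.subalgebra X" "X \<subseteq> g N" and M1: "L.subalgebra M1" "M1 \<subset> X" "M1 \<noteq> {0}"
    and M2: "L.subalgebra M2" "M2 \<subset> X"
    and mx: "\<And>M. L.subalgebra M \<Longrightarrow> M \<subset> X \<Longrightarrow> M \<subseteq> M1 \<or> M \<subseteq> M2"
    by (rule L.nonlie_two_maximal[OF g[OF N(1)] nl]) blast
  have less: "h B \<subset> h X" if "L.subalgebra B" "B \<subset> X" for B
    using h_le_iff[OF that(1) X(1)] h_le_iff[OF X(1) that(1)] that(2) by blast
  have lie: "T.lie_on (h X)"
    using N(2) h_le_iff'[OF N(1) X(1)] X(2) unfolding T.lie_on_def by blast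
  have ne: "h M1 \<noteq> {0}" using M1(3) gh[OF M1(1)] g_zero by auto
  obtain C where C: "T.subalgebra C" "C \<subset> h X" "\<not> C \<subseteq> h M1" "\<not> C \<subseteq> h M2"
    using T.lie_not_two_maximal[OF h[OF X(1)] lie h[OF M1(1)] less[OF M1(1,2)] ne h[OF M2(1)] less[OF M2]] .
  have "g C \<subset> X" using g_less_iff[OF C(1) h[OF X(1)]] C(2) gh[OF X(1)] by simp
  then have "g C \<subseteq> M1 \<or> g C \<subseteq> M2" by (rule mx[OF g[OF C(1)]])
  then show False using C le_h_iff M1(1) M2(1) by blast
qed

lemma crossed_g:
  assumes "T.subalgebra V" "T.subalgebra S" "T.subalgebra N" "T.crossed (\<lambda>A. r (g A)) V S N A"
  shows "L.crossed r (g V) (g S) (g N) (g A)"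
proof -
  obtain C X where A: "T.subalgebra A" "V \<subseteq> A" "A \<subseteq> N" "r (g A) = Suc (r (g V))"
    and C: "T.subalgebra C" "V \<subseteq> C" "C \<subseteq> X" "r (g C) = Suc (r (g V))" "C \<noteq> S" "C \<noteq> A"
    and X: "T.subalgebra X" "S \<subseteq> X" "A \<subseteq> X" "r (g X) \<le> r (g V) + 2"
    using assms(4) unfolding T.crossed_def by blast
  show ?thesis
    unfolding L.crossed_def
    by (intro conjI exI[of _ "g C"] exI[of _ "g X"]) (use A C X assms g g_le_iff g_inj in auto)
qed

text \<open>All conditions are order theoretic except \<open>lie_on\<close>, which occurs only as a
  premise in \<open>rk_three\<close>; hence the one direction in \<open>lie_on_g\<close> is
  enough.\<close>

lemma subalgebra_rank_transfer:
  assumes "subalgebra_rank sL mL BL r"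
  shows "subalgebra_rank sT mT BT (\<lambda>A. r (g A))"
proof -
  interpret R: subalgebra_rank sL mL BL r by fact
  show ?thesis
  proof (unfold_locales, goal_cases)
    case 1 show ?case by (simp add: g_zero R.rk_zero)
  next
    case (2 A B)
    then show ?case by (intro R.rk_strict) (auto simp: g g_less_iff)
  next
    case (3 A B)
    show ?case
    proof (rule R.rk_cover)
      show "L.subalgebra (g A)" "L.subalgebra (g B)" "g A \<subset> g B" using 3 by (auto simp: g g_less_iff)
      fix C assume C: "L.subalgebra C" "g A \<subset> C" "C \<subseteq> g B"
      have "A \<subset> h C" using g_less_iff[OF 3(1) h[OF C(1)]] C gh by simp
      moreover have "h C \<subseteq> B" using h_le_iff'[OF 3(2) C(1)] C by simp
      ultimately have "h C = B" using 3(4) h[OF C(1)] by blast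
      then show "C = g B" using gh[OF C(1)] by simp
    qed
  next
    case (4 A U)
    obtain R k where R: "R 0 = g A" "R k = g U"
      "\<And>i. i < k \<Longrightarrow> R i \<subseteq> R (Suc i) \<and> r (R (Suc i)) \<le> Suc (r (R i))"
      and Rs: "\<And>i. i \<le> k \<Longrightarrow> L.subalgebra (R i)"
      and Rj: "\<And>i B. i \<le> k \<Longrightarrow> L.subalgebra B \<Longrightarrow> g A \<subseteq> B \<Longrightarrow> B \<subseteq> g U \<Longrightarrow>
        \<exists>X. L.subalgebra X \<and> R i \<subseteq> X \<and> B \<subseteq> X \<and> X \<subseteq> g U \<and> r X + r (g A) \<le> r (R i) + r B"
      using R.rk_chain[OF g g, of A U] 4 g_le_iff by metis
    show ?case
    proof (intro exI[of _ "\<lambda>i. h (R i)"] exI[of _ k] conjI allI impI)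
      show "h (R 0) = A" "h (R k) = U" using R 4 hg by auto
      fix i assume i: "i < k"
      show "h (R i) \<subseteq> h (R (Suc i))" "r (g (h (R (Suc i)))) \<le> Suc (r (g (h (R i))))"
        using R(3)[OF i] Rs[of i] Rs[of "Suc i"] i by (auto simp: h_le_iff gh)
    next
      fix i assume i: "i \<le> k"
      show "T.subalgebra (h (R i))" using h Rs i by blast
      fix B assume B: "T.subalgebra B \<and> A \<subseteq> B \<and> B \<subseteq> U"
      then obtain X where X: "L.subalgebra X" "R i \<subseteq> X" "g B \<subseteq> X" "X \<subseteq> g U" "r X + r (g A) \<le> r (R i) + r (g B)"
        using Rj[OF i g, of B] g_le_iff 4 by blast
      then show "\<exists>X. T.subalgebra X \<and> h (R i) \<subseteq> X \<and> B \<subseteq> X \<and> X \<subseteq> U \<and>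
          r (g X) + r (g A) \<le> r (g (h (R i))) + r (g B)"
        using B 4 Rs[OF i] by (intro exI[of _ "h X"]) (auto simp: h gh h_le_iff h_le_iff' le_h_iff)
    qed
  next
    case (5 U V)
    have gVU: "g V \<subseteq> g U" using 5 g_le_iff by blast
    obtain S where S: "L.subalgebra S" "g V \<subseteq> S" "S \<subseteq> g U" "r S = Suc (r (g V))"
      and Sj: "\<forall>B. L.subalgebra B \<and> g V \<subseteq> B \<and> B \<subseteq> g U \<longrightarrow>
        (\<exists>X. L.subalgebra X \<and> S \<subseteq> X \<and> B \<subseteq> X \<and> X \<subseteq> g U \<and> r X \<le> Suc (r B))"
      and Sc: "\<forall>N T1 T2. L.subalgebra N \<and> g V \<subseteq> N \<and> N \<subseteq> g U \<and> r N = r (g V) + 2 \<and> L.lie_on N \<and>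
        \<not> S \<subseteq> N \<and> T1 \<noteq> T2 \<and> L.crossed r (g V) S N T1 \<and> L.crossed r (g V) S N T2 \<longrightarrow>
        (\<exists>A. L.subalgebra A \<and> g V \<subseteq> A \<and> A \<subseteq> g U \<and> r A = r (g V) + 2 \<and> A \<noteq> N \<and> \<not> S \<subseteq> A)"
      using R.rk_three[OF g[OF 5(1)] g[OF 5(2)] gVU 5(4)] by (elim exE conjE) (rule that)
    show ?case
    proof (rule exI[of _ "h S"], intro conjI allI impI)
      show "T.subalgebra (h S)" "V \<subseteq> h S" "h S \<subseteq> U" "r (g (h S)) = Suc (r (g V))"
        using S 5 by (auto simp: h gh le_h_iff h_le_iff')
    next
      fix B assume B: "T.subalgebra B \<and> V \<subseteq> B \<and> B \<subseteq> U"
      then obtain X where X: "L.subalgebra X" "S \<subseteq> X" "g B \<subseteq> X" "X \<subseteq> g U" "r X \<le> Suc (r (g B))"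
        using Sj[rule_format, of "g B"] g_le_iff g 5 by blast
      then show "\<exists>X. T.subalgebra X \<and> h S \<subseteq> X \<and> B \<subseteq> X \<and> X \<subseteq> U \<and> r (g X) \<le> Suc (r (g B))"
        using B 5 S(1) by (intro exI[of _ "h X"]) (auto simp: h gh h_le_iff h_le_iff' le_h_iff)
    next
      fix N T1 T2
      assume a: "T.subalgebra N \<and> V \<subseteq> N \<and> N \<subseteq> U \<and> r (g N) = r (g V) + 2 \<and> T.lie_on N \<and> \<not> h S \<subseteq> N \<and>
          T1 \<noteq> T2 \<and> T.crossed (\<lambda>A. r (g A)) V (h S) N T1 \<and> T.crossed (\<lambda>A. r (g A)) V (h S) N T2"
      then have N: "T.subalgebra N" "V \<subseteq> N" "N \<subseteq> U" "r (g N) = r (g V) + 2" "T.lie_on N" "\<not> h S \<subseteq> N" "T1 \<noteq> T2"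
        by auto
      have T: "T.subalgebra T1" "T.subalgebra T2" using a by (auto simp: T.crossed_def)
      have cr: "L.crossed r (g V) S (g N) (g T1)" "L.crossed r (g V) S (g N) (g T2)"
        using crossed_g[OF 5(2) h[OF S(1)] N(1)] a gh[OF S(1)] by auto
      have "g V \<subseteq> g N" "g N \<subseteq> g U" "\<not> S \<subseteq> g N" "g T1 \<noteq> g T2"
        using N T 5 by (auto simp: g_le_iff g_inj h_le_iff' S(1))
      then obtain A where "L.subalgebra A" "g V \<subseteq> A" "A \<subseteq> g U" "r A = r (g V) + 2" "A \<noteq> g N" "\<not> S \<subseteq> A"
        using Sc[rule_format, of "g N" "g T1" "g T2"] g[OF N(1)] N(4) lie_on_g[OF N(1,5)] cr by blast
      then show "\<exists>A. T.subalgebra A \<and> V \<subseteq> A \<and> A \<subseteq> U \<and> r (g A) = r (g V) + 2 \<and> A \<noteq> N \<and> \<not> h S \<subseteq> A"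
        using 5 N S(1) by (intro exI[of _ "h A"]) (auto simp: h gh h_le_iff h_le_iff' le_h_iff)
    qed
  qed
qed

lemma supersolvable_transfer:
  assumes "L.supersolvable" "\<not> L.lie_on UNIV"
  shows "T.supersolvable"
proof -
  interpret R: subalgebra_rank sT mT BT "\<lambda>A. L.dim (g A)"
    by (rule subalgebra_rank_transfer[OF L.supersolvable_subalgebra_rank[OF assms(1)]])
  have "g UNIV = UNIV"
    using h_le_iff'[OF T.subalgebra_UNIV L.subalgebra_UNIV] by blast
  then have "\<not> T.lie_on UNIV" using lie_on_g[OF T.subalgebra_UNIV] assms(2) by auto
  then show ?thesis by (rule R.supersolvable_of_not_lie)
qed

end

section \<open>From the lattice isomorphism to the theorem\<close>

lemma lattice_isomorphism_order:
  assumes "bilinear_algebra s1 m1" "bilinear_algebra s2 m2" and iso: "lattice_isomorphism s1 m1 s2 m2 \<theta>"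
    and A: "bilinear_algebra.subalgebra s1 m1 A" "bilinear_algebra.subalgebra s1 m1 B"
  shows "\<theta> A \<subseteq> \<theta> B \<longleftrightarrow> A \<subseteq> B"
proof -
  interpret A1: bilinear_algebra s1 m1 by fact
  have AB: "A \<in> A1.subalgebras" "B \<in> A1.subalgebras" using A by (auto simp: A1.subalgebras_def)
  have bij: "bij_betw \<theta> A1.subalgebras (bilinear_algebra.subalgebras s2 m2)"
    and int: "\<theta> (A \<inter> B) = \<theta> A \<inter> \<theta> B"
    using iso AB unfolding lattice_isomorphism_def by auto
  have "A1.subalgebra (A \<inter> B)"
    using A by (auto simp: A1.subalgebra_def A1.subspace_inter)
  then have "A \<inter> B \<in> A1.subalgebras" by (simp add: A1.subalgebras_def)
  then have "\<theta> (A \<inter> B) = \<theta> A \<longleftrightarrow> A \<inter> B = A"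
    using bij AB by (auto simp: bij_betw_def dest: inj_onD)
  then show ?thesis using int by auto
qed

theorem corollary4p4:
  fixes scale :: "'f::field_char_0 \<Rightarrow> 'v::ab_group_add \<Rightarrow> 'v"
    and bracket :: "'v \<Rightarrow> 'v \<Rightarrow> 'v"
    and scale' :: "'f \<Rightarrow> 'w::ab_group_add \<Rightarrow> 'w"
    and bracket' :: "'w \<Rightarrow> 'w \<Rightarrow> 'w"
  assumes "leibniz_algebra scale bracket"
    and "\<exists>B. finite_dimensional_vector_space scale B"
    and "\<not> lie_algebra scale bracket"
    and "bilinear_algebra.supersolvable scale bracket"
    and "leibniz_algebra scale' bracket'"
    and "\<exists>B. finite_dimensional_vector_space scale' B"
    and "\<exists>\<theta>. lattice_isomorphism scale bracket scale' bracket' \<theta>"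
  shows "bilinear_algebra.supersolvable scale' bracket'"
proof -
  obtain BL where BL: "finite_dimensional_vector_space scale BL" using assms(2) ..
  obtain BT where BT: "finite_dimensional_vector_space scale' BT" using assms(6) ..
  obtain \<theta> where iso: "lattice_isomorphism scale bracket scale' bracket' \<theta>" using assms(7) ..
  interpret L: leibniz_fd scale bracket BL
    by (intro leibniz_fd.intro assms BL)
  interpret T: leibniz_fd scale' bracket' BT
    by (intro leibniz_fd.intro assms BT)
  have bij: "bij_betw \<theta> L.subalgebras T.subalgebras"
    using iso by (simp add: lattice_isomorphism_def)
  let ?g = "inv_into L.subalgebras \<theta>"
  have g: "L.subalgebra (?g A)" "\<theta> (?g A) = A" if "T.subalgebra A" for A
  proof -
    have "A \<in> T.subalgebras" using that by (simp add: T.subalgebras_def)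
    then have "?g A \<in> L.subalgebras" "\<theta> (?g A) = A"
      using bij by (auto simp: bij_betw_def inv_into_into f_inv_into_f)
    then show "L.subalgebra (?g A)" "\<theta> (?g A) = A" by (auto simp: L.subalgebras_def)
  qed
  have ord: "\<theta> A \<subseteq> \<theta> B \<longleftrightarrow> A \<subseteq> B" if "L.subalgebra A" "L.subalgebra B" for A B
    by (rule lattice_isomorphism_order[OF L.bilinear_algebra_axioms T.bilinear_algebra_axioms iso that])
  interpret lattice_pair scale bracket BL scale' bracket' BT ?g \<theta>
  proof
    show "L.subalgebra (?g A)" if "T.subalgebra A" for A using g that by blast
    fix B assume B: "L.subalgebra B"
    then have "B \<in> L.subalgebras" by (simp add: L.subalgebras_def)
    then show "?g (\<theta> B) = B" using bij by (simp add: bij_betw_inv_into_left)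
    have "\<theta> B \<in> T.subalgebras" using bij \<open>B \<in> L.subalgebras\<close> by (rule bij_betwE[rule_format])
    then show "T.subalgebra (\<theta> B)" by (simp add: T.subalgebras_def)
  next
    show "?g A \<subseteq> ?g A' \<longleftrightarrow> A \<subseteq> A'" if "T.subalgebra A" "T.subalgebra A'" for A A'
      using ord[of "?g A" "?g A'"] g that by simp
  qed
  have "\<not> L.lie_on UNIV" using assms(3) L.lie_algebra_iff by (simp add: L.lie_on_def)
  then show ?thesis by (rule supersolvable_transfer[OF assms(4)])
qed

end
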